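(* Let $H$ be a BiHom-bialgebra over a field $\Bbbk$ and $m,n,p,q,s,t,u,v\in\mathbb{Z}$. The (strict) monoidal category $\mathcal{LR}(H)\binom{m,n,p,q}{s,t,u,v}$ of BiHom-$\binom{m,n,p,q}{s,t,u,v}$-Yetter-Drinfel'd-Long bimodules is a prebraided monoidal category with prebraiding $c_{M,N}:M\otimes N\to N\otimes M$, $$c_{M,N}(x\otimes y)=\alpha^{s}\beta^{p+1}\omega^{q}\psi^{t+1}(x_{[-1]})\triangleright\beta_N^{-1}\psi_N^{-1}(y_{(0)})\otimes\alpha_M^{-1}\omega_M^{-1}(x_{[0]})\triangleleft\alpha^{m+1}\beta^{u}\omega^{v+1}\psi^{n}(y_{(1)}),$$ for all objects $M,N$ and $x\in M$, $y\in N$. Moreover, if $H$ is a BiHom-Hopf algebra with bijective antipode $S$, then $\mathcal{LR}(H)\binom{m,n,p,q}{s,t,u,v}$ is braided, with the inverse of $c_{M,N}$ given by $c_{M,N}^{-1}:N\otimes M\to M\otimes N$, $$c_{M,N}^{-1}(y\otimes x)=\alpha_M^{-1}\omega_M\psi_M^{-2}(x_{[0]})\triangleleft S^{-1}\alpha^{m}\beta^{u+1}\omega^{v}\psi^{n+1}(y_{(1)})\otimes S^{-1}\alpha^{s+1}\beta^{p}\omega^{q+1}\psi^{t}(x_{[-1]})\triangleright\beta_N^{-1}\omega_N^{-2}\psi_N(y_{(0)}).$$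
   Context: All spaces are over a field $\Bbbk$; $\Delta(h)=h_1\otimes h_2$ (summation suppressed). BiHom-algebra $(A,\mu,1_A,\alpha_A,\beta_A)$: a vector space with $\mu(a\otimes b)=ab$, an element $1_A$, and commuting linear isomorphisms $\alpha_A,\beta_A$ that are multiplicative and fix $1_A$, with $a1_A=\alpha_A(a)$, $1_Aa=\beta_A(a)$, $\alpha_A(a)(bc)=(ab)\beta_A(c)$. A BiHom-algebra map commutes with $\alpha,\beta$ and preserves products and units. BiHom-coalgebra $(C,\Delta,\varepsilon,\omega_C,\psi_C)$: commuting linear isomorphisms $\omega_C,\psi_C$ with $\varepsilon\omega_C=\varepsilon\psi_C=\varepsilon$, $\Delta\omega_C=(\omega_C\otimes\omega_C)\Delta$, $\Delta\psi_C=(\psi_C\otimes\psi_C)\Delta$, $c_1\varepsilon(c_2)=\omega_C(c)$, $\varepsilon(c_1)c_2=\psi_C(c)$, $\omega_C(c_1)\otimes\Delta(c_2)=\Delta(c_1)\otimes\psi_C(c_2)$. A BiHom-coalgebra map commutes with $\omega,\psi$ and preserves $\Delta$ and $\varepsilon$. BiHom-bialgebra $(H,\mu,1,\Delta,\varepsilon,\alpha,\beta,\omega,\psi)$: $(H,\mu,1,\alpha,\beta)$ is a BiHom-algebra, $(H,\Delta,\varepsilon,\omega,\psi)$ is a BiHom-coalgebra, $\Delta(hg)=h_1g_1\otimes h_2g_2$, $\varepsilon(hg)=\varepsilon(h)\varepsilon(g)$, $\Delta(1)=1\otimes1$, $\varepsilon(1)=1$, $\alpha,\beta$ are BiHom-coalgebra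 maps, $\omega,\psi$ are BiHom-algebra maps, and $\alpha,\beta,\omega,\psi$ commute with each other. BiHom-Hopf algebra: a BiHom-bialgebra with a linear map $S:H\to H$ (antipode) commuting with $\alpha,\beta,\omega,\psi$ and satisfying $h_1S(h_2)=S(h_1)h_2=\varepsilon(h)1_H$. Left $H$-module $(M,\triangleright,\alpha_M,\beta_M,\omega_M,\psi_M)$: $\alpha_M,\beta_M,\omega_M,\psi_M$ are mutually commuting linear automorphisms, $\theta_M(h\triangleright x)=\theta(h)\triangleright\theta_M(x)$ for $\theta\in\{\alpha,\beta,\omega,\psi\}$, $\alpha(h)\triangleright(g\triangleright x)=(hg)\triangleright\beta_M(x)$, $1_H\triangleright x=\beta_M(x)$. Right $H$-module: symmetrically, $\theta_M(x\triangleleft h)=\theta_M(x)\triangleleft\theta(h)$, $(x\triangleleft h)\triangleleft\beta(g)=\alpha_M(x)\triangleleft(hg)$, $x\triangleleft1_H=\alpha_M(x)$. $H$-bimodule: both, with $\alpha(a)\triangleright(x\triangleleft b)=(a\triangleright x)\triangleleft\beta(b)$. Right $H$-comodule, $x\mapsto x_{(0)}\otimes x_{(1)}\in M\otimes H$: the coaction is compatible with $\theta_M$ and $\theta$ for $\theta\in\{\alpha,\beta,\omega,\psi\}$, $\omega_M(x_{(0)})\otimes x_{(1)1}\otimes x_{(1)2}=x_{(0)(0)}\otimes x_{(0)(1)}\otimes\psi(x_{(1)})$, $x_{(0)}\varepsilon(x_{(1)})=\omega_M(x)$. Left $H$-comodule, $x\mapsto x_{[-1]}\otimes x_{[0]}\in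 H\otimes M$: symmetrically, $x_{[-1]1}\otimes x_{[-1]2}\otimes\psi_M(x_{[0]})=\omega(x_{[-1]})\otimes x_{[0][-1]}\otimes x_{[0][0]}$, $\varepsilon(x_{[-1]})x_{[0]}=\psi_M(x)$. $H$-bicomodule: both, with $\omega(x_{[-1]})\otimes x_{[0](0)}\otimes x_{[0](1)}=x_{(0)[-1]}\otimes x_{(0)[0]}\otimes\psi(x_{(1)})$. Objects of $\mathcal{LR}(H)\binom{m,n,p,q}{s,t,u,v}$ (BiHom-$\binom{m,n,p,q}{s,t,u,v}$-Yetter-Drinfel'd-Long bimodules): vector spaces $M$ with $H$-bimodule and $H$-bicomodule structures (same automorphisms $\alpha_M,\beta_M,\omega_M,\psi_M$) such that for all $x\in M$, $h\in H$: (i) $(\alpha^{s}\beta^{p+1}\omega^{q}\psi^{t+1}(h_1)\triangleright x)_{[-1]}\,\alpha\beta^{-1}\psi^{-1}\omega(h_2)\otimes(\alpha^{s}\beta^{p+1}\omega^{q}\psi^{t+1}(h_1)\triangleright x)_{[0]}=h_1\alpha(x_{[-1]})\otimes\alpha^{s}\beta^{p+1}\omega^{q+1}\psi^{t+1}(h_2)\triangleright x_{[0]}$; (ii) $(h\triangleright x)_{(0)}\otimes(h\triangleright x)_{(1)}=\omega(h)\triangleright x_{(0)}\otimes\beta(x_{(1)})$; (iii) $[x\triangleleft\alpha^{m+1}\beta^{u}\omega^{v+1}\psi^{n}(h_2)]_{(0)}\otimes\alpha^{-1}\beta\psi\omega^{-1}(h_1)[x\triangleleft\alpha^{m+1}\beta^{u}\omega^{v+1}\psi^{n}(h_2)]_{(1)}=x_{(0)}\triangleleft\alpha^{m+1}\beta^{u}\omega^{v+1}\psi^{n+1}(h_1)\otimes\beta(x_{(1)})h_2$;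 (iv) $(x\triangleleft h)_{[-1]}\otimes(x\triangleleft h)_{[0]}=\alpha(x_{[-1]})\otimes x_{[0]}\triangleleft\psi(h)$. Morphisms are the $H$-bilinear and $H$-bicolinear maps (in particular commuting with $\alpha_M,\beta_M,\omega_M,\psi_M$). Monoidal structure: it is taken to be strict (associativity and unit constraints are identities), with $M\otimes N$ the vector space tensor product and $h\triangleright(x\otimes y)=h_1\triangleright x\otimes h_2\triangleright y$, $(x\otimes y)\triangleleft h=x\triangleleft h_1\otimes y\triangleleft h_2$, left coaction $x\otimes y\mapsto\alpha^{-1}\omega^{-1}(x_{[-1]})\beta^{-1}\psi^{-1}(y_{[-1]})\otimes x_{[0]}\otimes y_{[0]}$, right coaction $x\otimes y\mapsto x_{(0)}\otimes y_{(0)}\otimes\alpha^{-1}\omega^{-1}(x_{(1)})\beta^{-1}\psi^{-1}(y_{(1)})$, and structure automorphisms $\theta_M\otimes\theta_N$. A prebraiding on a monoidal category with associativity constraint $a_{U,V,W}:(U\otimes V)\otimes W\to U\otimes(V\otimes W)$ is a natural family $c_{U,V}:U\otimes V\to V\otimes U$ with $c_{U,V\otimes W}=a_{V,W,U}^{-1}(V\otimes c_{U,W})a_{V,U,W}(c_{U,V}\otimes W)a_{U,V,W}^{-1}$ and $c_{U\otimes V,W}=a_{W,U,V}(c_{U,W}\otimes V)a_{U,W,V}^{-1}(U\otimes c_{V,W})a_{U,V,W}$; it is a braiding if all $c_{U,V}$ are isomorphisms.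
   Formalization: The category is not strict: with identity constraints the prebraiding axioms fail (e.g. H=k, ω_M≠ψ_M). The constraints used are (x⊗y)⊗z ↦ ω⁻¹(x)⊗(y⊗ψ(z)), 1⊗x ↦ ψ⁻¹(x), x⊗1 ↦ ω⁻¹(x). *)

theory Defs
  imports "HOL-Algebra.Module" "HOL-Library.FuncSet"
begin

section \<open>Monoidal categories and braidings\<close>

text \<open>
  \<open>cmp C g f\<close> is the composite \<open>g \<circ> f\<close>; it is only constrained on composable arrows.
\<close>

record ('o, 'm) cat =
  Obj :: "'o set"
  Hom :: "'o \<Rightarrow> 'o \<Rightarrow> 'm set"
  Id :: "'o \<Rightarrow> 'm"
  cmp :: "'m \<Rightarrow> 'm \<Rightarrow> 'm"

record ('o, 'm) moncat = "('o, 'm) cat" +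
  tobj :: "'o \<Rightarrow> 'o \<Rightarrow> 'o"
  tarr :: "'m \<Rightarrow> 'm \<Rightarrow> 'm"
  unit_obj :: 'o
  assoc :: "'o \<Rightarrow> 'o \<Rightarrow> 'o \<Rightarrow> 'm"
  lunit :: "'o \<Rightarrow> 'm"
  runit :: "'o \<Rightarrow> 'm"

locale category =
  fixes C :: "('o, 'm, 'z) cat_scheme"
  assumes hom_disjoint: "\<lbrakk>f \<in> Hom C A B; f \<in> Hom C A' B'\<rbrakk> \<Longrightarrow> A = A' \<and> B = B'"
    and id_hom: "A \<in> Obj C \<Longrightarrow> Id C A \<in> Hom C A A"
    and cmp_hom: "\<lbrakk>A \<in> Obj C; B \<in> Obj C; D \<in> Obj C; f \<in> Hom C A B; g \<in> Hom C B D\<rbrakk>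
                  \<Longrightarrow> cmp C g f \<in> Hom C A D"
    and cmp_id_right: "\<lbrakk>A \<in> Obj C; B \<in> Obj C; f \<in> Hom C A B\<rbrakk> \<Longrightarrow> cmp C f (Id C A) = f"
    and cmp_id_left: "\<lbrakk>A \<in> Obj C; B \<in> Obj C; f \<in> Hom C A B\<rbrakk> \<Longrightarrow> cmp C (Id C B) f = f"
    and cmp_assoc: "\<lbrakk>A \<in> Obj C; B \<in> Obj C; D \<in> Obj C; E \<in> Obj C;
                     f \<in> Hom C A B; g \<in> Hom C B D; h \<in> Hom C D E\<rbrakk>
                    \<Longrightarrow> cmp C h (cmp C g f) = cmp C (cmp C h g) f"

definition inverse_arrows :: "('o, 'm, 'z) cat_scheme \<Rightarrow> 'o \<Rightarrow> 'o \<Rightarrow> 'm \<Rightarrow> 'm \<Rightarrow> bool" where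
  "inverse_arrows C A B f g \<longleftrightarrow>
     f \<in> Hom C A B \<and> g \<in> Hom C B A \<and> cmp C g f = Id C A \<and> cmp C f g = Id C B"

definition iso_arrow :: "('o, 'm, 'z) cat_scheme \<Rightarrow> 'o \<Rightarrow> 'o \<Rightarrow> 'm \<Rightarrow> bool" where
  "iso_arrow C A B f \<longleftrightarrow> (\<exists>g. inverse_arrows C A B f g)"

definition inv_arrow :: "('o, 'm, 'z) cat_scheme \<Rightarrow> 'o \<Rightarrow> 'o \<Rightarrow> 'm \<Rightarrow> 'm" where
  "inv_arrow C A B f = (THE g. inverse_arrows C A B f g)"

locale monoidal_category = category C
  for C :: "('o, 'm, 'z) moncat_scheme" +
  assumes tobj_obj: "\<lbrakk>A \<in> Obj C; B \<in> Obj C\<rbrakk> \<Longrightarrow> tobj C A B \<in> Obj C"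
    and unit_obj: "unit_obj C \<in> Obj C"
    and tarr_hom: "\<lbrakk>A \<in> Obj C; A' \<in> Obj C; B \<in> Obj C; B' \<in> Obj C;
                    f \<in> Hom C A A'; g \<in> Hom C B B'\<rbrakk>
                   \<Longrightarrow> tarr C f g \<in> Hom C (tobj C A B) (tobj C A' B')"
    and tarr_id: "\<lbrakk>A \<in> Obj C; B \<in> Obj C\<rbrakk> \<Longrightarrow> tarr C (Id C A) (Id C B) = Id C (tobj C A B)"
    and tarr_cmp: "\<lbrakk>A \<in> Obj C; A' \<in> Obj C; A'' \<in> Obj C; B \<in> Obj C; B' \<in> Obj C; B'' \<in> Obj C;
                    f \<in> Hom C A A'; f' \<in> Hom C A' A''; g \<in> Hom C B B'; g' \<in> Hom C B' B''\<rbrakk>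
                   \<Longrightarrow> tarr C (cmp C f' f) (cmp C g' g) = cmp C (tarr C f' g') (tarr C f g)"
    and assoc_iso: "\<lbrakk>X \<in> Obj C; Y \<in> Obj C; Z \<in> Obj C\<rbrakk>
                    \<Longrightarrow> iso_arrow C (tobj C (tobj C X Y) Z) (tobj C X (tobj C Y Z)) (assoc C X Y Z)"
    and assoc_natural: "\<lbrakk>X \<in> Obj C; X' \<in> Obj C; Y \<in> Obj C; Y' \<in> Obj C; Z \<in> Obj C; Z' \<in> Obj C;
                    f \<in> Hom C X X'; g \<in> Hom C Y Y'; h \<in> Hom C Z Z'\<rbrakk>
                   \<Longrightarrow> cmp C (assoc C X' Y' Z') (tarr C (tarr C f g) h)
                       = cmp C (tarr C f (tarr C g h)) (assoc C X Y Z)"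
    and lunit_iso: "X \<in> Obj C \<Longrightarrow> iso_arrow C (tobj C (unit_obj C) X) X (lunit C X)"
    and lunit_natural: "\<lbrakk>X \<in> Obj C; X' \<in> Obj C; f \<in> Hom C X X'\<rbrakk>
                   \<Longrightarrow> cmp C (lunit C X') (tarr C (Id C (unit_obj C)) f) = cmp C f (lunit C X)"
    and runit_iso: "X \<in> Obj C \<Longrightarrow> iso_arrow C (tobj C X (unit_obj C)) X (runit C X)"
    and runit_natural: "\<lbrakk>X \<in> Obj C; X' \<in> Obj C; f \<in> Hom C X X'\<rbrakk>
                   \<Longrightarrow> cmp C (runit C X') (tarr C f (Id C (unit_obj C))) = cmp C f (runit C X)"
    and pentagon: "\<lbrakk>W \<in> Obj C; X \<in> Obj C; Y \<in> Obj C; Z \<in> Obj C\<rbrakk>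
                   \<Longrightarrow> cmp C (assoc C W X (tobj C Y Z)) (assoc C (tobj C W X) Y Z)
                       = cmp C (tarr C (Id C W) (assoc C X Y Z))
                           (cmp C (assoc C W (tobj C X Y) Z) (tarr C (assoc C W X Y) (Id C Z)))"
    and triangle: "\<lbrakk>X \<in> Obj C; Y \<in> Obj C\<rbrakk>
                   \<Longrightarrow> cmp C (tarr C (Id C X) (lunit C Y)) (assoc C X (unit_obj C) Y)
                       = tarr C (runit C X) (Id C Y)"
begin

definition assoc_inv :: "'o \<Rightarrow> 'o \<Rightarrow> 'o \<Rightarrow> 'm" where
  "assoc_inv X Y Z =
     inv_arrow C (tobj C (tobj C X Y) Z) (tobj C X (tobj C Y Z)) (assoc C X Y Z)"

end

locale prebraided_monoidal_category = monoidal_category C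
  for C :: "('o, 'm, 'z) moncat_scheme"
  and c :: "'o \<Rightarrow> 'o \<Rightarrow> 'm" +
  assumes braid_hom: "\<lbrakk>U \<in> Obj C; V \<in> Obj C\<rbrakk> \<Longrightarrow> c U V \<in> Hom C (tobj C U V) (tobj C V U)"
    and braid_natural: "\<lbrakk>U \<in> Obj C; U' \<in> Obj C; V \<in> Obj C; V' \<in> Obj C;
                         f \<in> Hom C U U'; g \<in> Hom C V V'\<rbrakk>
                        \<Longrightarrow> cmp C (c U' V') (tarr C f g) = cmp C (tarr C g f) (c U V)"
    and braid_tensor_right: "\<lbrakk>U \<in> Obj C; V \<in> Obj C; W \<in> Obj C\<rbrakk>
       \<Longrightarrow> c U (tobj C V W) =
           cmp C (assoc_inv V W U) (cmp C (tarr C (Id C V) (c U W)) (cmp C (assoc C V U W)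
             (cmp C (tarr C (c U V) (Id C W)) (assoc_inv U V W))))"
    and braid_tensor_left: "\<lbrakk>U \<in> Obj C; V \<in> Obj C; W \<in> Obj C\<rbrakk>
       \<Longrightarrow> c (tobj C U V) W =
           cmp C (assoc C W U V) (cmp C (tarr C (c U W) (Id C V)) (cmp C (assoc_inv U W V)
             (cmp C (tarr C (Id C U) (c V W)) (assoc C U V W))))"

locale braided_monoidal_category = prebraided_monoidal_category C c
  for C :: "('o, 'm, 'z) moncat_scheme"
  and c :: "'o \<Rightarrow> 'o \<Rightarrow> 'm" +
  assumes braid_iso: "\<lbrakk>U \<in> Obj C; V \<in> Obj C\<rbrakk>
                      \<Longrightarrow> iso_arrow C (tobj C U V) (tobj C V U) (c U V)"


section \<open>Vector spaces and tensor products\<close>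

text \<open>
  A category has a set of objects, which must live in one type. All vector spaces over \<open>K\<close>
  considered below have a carrier contained in the following type, which is closed under forming
  formal sums of pairs and hence under tensor products. Via \<open>Atom\<close> it contains a copy of an arbitrary
  type \<open>'a\<close>, so every vector space, and every structure on it, occurs up to isomorphism for a
  suitable \<open>'a\<close>. A vector space over \<open>K\<close> is a \<open>module\<close> over the field \<open>K\<close>; the fields \<open>mult\<close> and
  \<open>one\<close> that the record type inherits from rings carry the product of an algebra and are
  meaningless for other spaces.
\<close>

datatype ('k, 'a) univ =
    Atom 'a
  | Scalar (the_scalar: 'k)
  | Tensor (summands: "(('k, 'a) univ \<times> ('k, 'a) univ) list")

definition linear_map ::
  "('k, 'c) ring_scheme \<Rightarrow> ('k, 'v, 'd) module_scheme \<Rightarrow> ('k, 'w, 'e) module_scheme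
     \<Rightarrow> ('v \<Rightarrow> 'w) \<Rightarrow> bool" where
  "linear_map K V W f \<longleftrightarrow>
     f \<in> carrier V \<rightarrow> carrier W \<and>
     (\<forall>x\<in>carrier V. \<forall>y\<in>carrier V. f (x \<oplus>\<^bsub>V\<^esub> y) = f x \<oplus>\<^bsub>W\<^esub> f y) \<and>
     (\<forall>a\<in>carrier K. \<forall>x\<in>carrier V. f (a \<odot>\<^bsub>V\<^esub> x) = a \<odot>\<^bsub>W\<^esub> f x)"

definition linear_form ::
  "('k, 'c) ring_scheme \<Rightarrow> ('k, 'v, 'd) module_scheme \<Rightarrow> ('v \<Rightarrow> 'k) \<Rightarrow> bool" where
  "linear_form K V f \<longleftrightarrow>
     f \<in> carrier V \<rightarrow> carrier K \<and>
     (\<forall>x\<in>carrier V. \<forall>y\<in>carrier V. f (x \<oplus>\<^bsub>V\<^esub> y) = f x \<oplus>\<^bsub>K\<^esub> f y) \<and>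
     (\<forall>a\<in>carrier K. \<forall>x\<in>carrier V. f (a \<odot>\<^bsub>V\<^esub> x) = a \<otimes>\<^bsub>K\<^esub> f x)"

definition linear_aut ::
  "('k, 'c) ring_scheme \<Rightarrow> ('k, 'v, 'd) module_scheme \<Rightarrow> ('v \<Rightarrow> 'v) \<Rightarrow> bool" where
  "linear_aut K V f \<longleftrightarrow> linear_map K V V f \<and> bij_betw f (carrier V) (carrier V)"

definition bilinear_map ::
  "('k, 'c) ring_scheme \<Rightarrow> ('k, 'u, 'd) module_scheme \<Rightarrow> ('k, 'v, 'e) module_scheme
     \<Rightarrow> ('k, 'w, 'f) module_scheme \<Rightarrow> ('u \<Rightarrow> 'v \<Rightarrow> 'w) \<Rightarrow> bool" where
  "bilinear_map K U V W F \<longleftrightarrow>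
     (\<forall>x\<in>carrier U. linear_map K V W (F x)) \<and> (\<forall>y\<in>carrier V. linear_map K U W (\<lambda>x. F x y))"

definition commute_on :: "'v set \<Rightarrow> ('v \<Rightarrow> 'v) \<Rightarrow> ('v \<Rightarrow> 'v) \<Rightarrow> bool" where
  "commute_on A f g \<longleftrightarrow> (\<forall>x\<in>A. f (g x) = g (f x))"

text \<open>
  The list \<open>[(x\<^sub>1, y\<^sub>1), \<dots>, (x\<^sub>n, y\<^sub>n)]\<close> stands for the formal sum of the \<open>x\<^sub>i \<otimes> y\<^sub>i\<close>; two such sums are
  identified if they have the same image in \<open>V \<otimes> W\<close>.
\<close>

inductive tensor_eq ::
  "('k, 'c) ring_scheme \<Rightarrow> ('k, 'v, 'd) module_scheme \<Rightarrow> ('k, 'w, 'e) module_scheme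
     \<Rightarrow> ('v \<times> 'w) list \<Rightarrow> ('v \<times> 'w) list \<Rightarrow> bool"
  for K V W where
  refl: "l \<in> lists (carrier V \<times> carrier W) \<Longrightarrow> tensor_eq K V W l l"
| sym: "tensor_eq K V W l l' \<Longrightarrow> tensor_eq K V W l' l"
| trans: "\<lbrakk>tensor_eq K V W l l'; tensor_eq K V W l' l''\<rbrakk> \<Longrightarrow> tensor_eq K V W l l''"
| append: "\<lbrakk>tensor_eq K V W l\<^sub>1 l\<^sub>1'; tensor_eq K V W l\<^sub>2 l\<^sub>2'\<rbrakk> \<Longrightarrow> tensor_eq K V W (l\<^sub>1 @ l\<^sub>2) (l\<^sub>1' @ l\<^sub>2')"
| comm: "\<lbrakk>l\<^sub>1 \<in> lists (carrier V \<times> carrier W); l\<^sub>2 \<in> lists (carrier V \<times> carrier W)\<rbrakk>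
         \<Longrightarrow> tensor_eq K V W (l\<^sub>1 @ l\<^sub>2) (l\<^sub>2 @ l\<^sub>1)"
| zero: "y \<in> carrier W \<Longrightarrow> tensor_eq K V W [(\<zero>\<^bsub>V\<^esub>, y)] []"
| add_left: "\<lbrakk>x \<in> carrier V; x' \<in> carrier V; y \<in> carrier W\<rbrakk>
         \<Longrightarrow> tensor_eq K V W [(x \<oplus>\<^bsub>V\<^esub> x', y)] [(x, y), (x', y)]"
| add_right: "\<lbrakk>x \<in> carrier V; y \<in> carrier W; y' \<in> carrier W\<rbrakk>
         \<Longrightarrow> tensor_eq K V W [(x, y \<oplus>\<^bsub>W\<^esub> y')] [(x, y), (x, y')]"
| balanced: "\<lbrakk>a \<in> carrier K; x \<in> carrier V; y \<in> carrier W\<rbrakk>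
         \<Longrightarrow> tensor_eq K V W [(a \<odot>\<^bsub>V\<^esub> x, y)] [(x, a \<odot>\<^bsub>W\<^esub> y)]"

text \<open>
  An element of \<open>V \<otimes> W\<close> is represented by one chosen formal sum from its equivalence class, so
  that equality in \<open>V \<otimes> W\<close> is equality of representatives.
\<close>

definition tclass ::
  "('k, 'c) ring_scheme \<Rightarrow> ('k, ('k, 'a) univ, 'd) module_scheme
     \<Rightarrow> ('k, ('k, 'a) univ, 'e) module_scheme
     \<Rightarrow> (('k, 'a) univ \<times> ('k, 'a) univ) list \<Rightarrow> ('k, 'a) univ" where
  "tclass K V W l = Tensor (SOME l'. tensor_eq K V W l l')"

definition tens ::
  "('k, 'c) ring_scheme \<Rightarrow> ('k, ('k, 'a) univ, 'd) module_scheme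
     \<Rightarrow> ('k, ('k, 'a) univ, 'e) module_scheme
     \<Rightarrow> ('k, 'a) univ \<Rightarrow> ('k, 'a) univ \<Rightarrow> ('k, 'a) univ" where
  "tens K V W x y = tclass K V W [(x, y)]"

definition tsp ::
  "('k, 'c) ring_scheme \<Rightarrow> ('k, ('k, 'a) univ, 'd) module_scheme
     \<Rightarrow> ('k, ('k, 'a) univ, 'e) module_scheme \<Rightarrow> ('k, ('k, 'a) univ) module" where
  "tsp K V W =
     \<lparr>carrier = tclass K V W ` lists (carrier V \<times> carrier W),
      mult = undefined, one = undefined,
      zero = tclass K V W [],
      add = (\<lambda>r r'. tclass K V W (summands r @ summands r')),
      smult = (\<lambda>a r. tclass K V W (map (\<lambda>(x, y). (a \<odot>\<^bsub>V\<^esub> x, y)) (summands r)))\<rparr>"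

definition tens3 ::
  "('k, 'c) ring_scheme \<Rightarrow> ('k, ('k, 'a) univ, 'd) module_scheme
     \<Rightarrow> ('k, ('k, 'a) univ, 'e) module_scheme \<Rightarrow> ('k, ('k, 'a) univ, 'f) module_scheme
     \<Rightarrow> ('k, 'a) univ \<Rightarrow> ('k, 'a) univ \<Rightarrow> ('k, 'a) univ \<Rightarrow> ('k, 'a) univ" where
  "tens3 K U V W x y z = tens K U (tsp K V W) x (tens K V W y z)"

definition tsp3 ::
  "('k, 'c) ring_scheme \<Rightarrow> ('k, ('k, 'a) univ, 'd) module_scheme
     \<Rightarrow> ('k, ('k, 'a) univ, 'e) module_scheme \<Rightarrow> ('k, ('k, 'a) univ, 'f) module_scheme
     \<Rightarrow> ('k, ('k, 'a) univ) module" where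
  "tsp3 K U V W = tsp K U (tsp K V W)"

text \<open>
  Sweedler notation: for a bilinear \<open>F\<close> with values in \<open>Z\<close>, \<open>sw Z r F\<close> is the image of the tensor \<open>r\<close>
  under the linear map with \<open>x \<otimes> y \<mapsto> F x y\<close>. Thus the expression \<open>F(h\<^sub>1, h\<^sub>2)\<close> with
  \<open>\<Delta>(h) = h\<^sub>1 \<otimes> h\<^sub>2\<close> is \<open>sw Z (\<Delta> h) (\<lambda>h\<^sub>1 h\<^sub>2. F h\<^sub>1 h\<^sub>2)\<close>.
\<close>

definition sw ::
  "('k, 'w, 'd) module_scheme \<Rightarrow> ('k, 'a) univ \<Rightarrow> (('k, 'a) univ \<Rightarrow> ('k, 'a) univ \<Rightarrow> 'w) \<Rightarrow> 'w" where
  "sw Z r F = foldr (\<lambda>(x, y) z. F x y \<oplus>\<^bsub>Z\<^esub> z) (summands r) \<zero>\<^bsub>Z\<^esub>"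

definition tmap ::
  "('k, 'c) ring_scheme \<Rightarrow> ('k, ('k, 'a) univ, 'd) module_scheme
     \<Rightarrow> ('k, ('k, 'a) univ, 'e) module_scheme
     \<Rightarrow> (('k, 'a) univ \<Rightarrow> ('k, 'a) univ) \<Rightarrow> (('k, 'a) univ \<Rightarrow> ('k, 'a) univ)
     \<Rightarrow> ('k, 'a) univ \<Rightarrow> ('k, 'a) univ" where
  "tmap K V' W' f g r = sw (tsp K V' W') r (\<lambda>x y. tens K V' W' (f x) (g y))"


section \<open>BiHom-bialgebras\<close>

definition bihom_algebra ::
  "('k, 'c) ring_scheme \<Rightarrow> ('k, 'v, 'd) module_scheme \<Rightarrow> ('v \<Rightarrow> 'v) \<Rightarrow> ('v \<Rightarrow> 'v) \<Rightarrow> bool" where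
  "bihom_algebra K A \<alpha> \<beta> \<longleftrightarrow>
     Module.module K A \<and> bilinear_map K A A A (mult A) \<and> \<one>\<^bsub>A\<^esub> \<in> carrier A \<and>
     linear_aut K A \<alpha> \<and> linear_aut K A \<beta> \<and> commute_on (carrier A) \<alpha> \<beta> \<and>
     (\<forall>\<theta>\<in>{\<alpha>, \<beta>}. \<theta> \<one>\<^bsub>A\<^esub> = \<one>\<^bsub>A\<^esub> \<and>
        (\<forall>a\<in>carrier A. \<forall>b\<in>carrier A. \<theta> (a \<otimes>\<^bsub>A\<^esub> b) = \<theta> a \<otimes>\<^bsub>A\<^esub> \<theta> b)) \<and>
     (\<forall>a\<in>carrier A. a \<otimes>\<^bsub>A\<^esub> \<one>\<^bsub>A\<^esub> = \<alpha> a \<and> \<one>\<^bsub>A\<^esub> \<otimes>\<^bsub>A\<^esub> a = \<beta> a) \<and>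
     (\<forall>a\<in>carrier A. \<forall>b\<in>carrier A. \<forall>c\<in>carrier A.
        \<alpha> a \<otimes>\<^bsub>A\<^esub> (b \<otimes>\<^bsub>A\<^esub> c) = (a \<otimes>\<^bsub>A\<^esub> b) \<otimes>\<^bsub>A\<^esub> \<beta> c)"

definition bihom_algebra_map ::
  "('k, 'c) ring_scheme \<Rightarrow> ('k, 'v, 'd) module_scheme \<Rightarrow> ('v \<Rightarrow> 'v) \<Rightarrow> ('v \<Rightarrow> 'v)
     \<Rightarrow> ('k, 'w, 'e) module_scheme \<Rightarrow> ('w \<Rightarrow> 'w) \<Rightarrow> ('w \<Rightarrow> 'w) \<Rightarrow> ('v \<Rightarrow> 'w) \<Rightarrow> bool" where
  "bihom_algebra_map K A \<alpha>\<^sub>A \<beta>\<^sub>A B \<alpha>\<^sub>B \<beta>\<^sub>B f \<longleftrightarrow>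
     linear_map K A B f \<and>
     (\<forall>a\<in>carrier A. f (\<alpha>\<^sub>A a) = \<alpha>\<^sub>B (f a) \<and> f (\<beta>\<^sub>A a) = \<beta>\<^sub>B (f a)) \<and>
     (\<forall>a\<in>carrier A. \<forall>b\<in>carrier A. f (a \<otimes>\<^bsub>A\<^esub> b) = f a \<otimes>\<^bsub>B\<^esub> f b) \<and>
     f \<one>\<^bsub>A\<^esub> = \<one>\<^bsub>B\<^esub>"

definition bihom_coalgebra ::
  "('k, 'c) ring_scheme \<Rightarrow> ('k, ('k, 'a) univ, 'd) module_scheme
     \<Rightarrow> (('k, 'a) univ \<Rightarrow> ('k, 'a) univ) \<Rightarrow> (('k, 'a) univ \<Rightarrow> 'k)
     \<Rightarrow> (('k, 'a) univ \<Rightarrow> ('k, 'a) univ) \<Rightarrow> (('k, 'a) univ \<Rightarrow> ('k, 'a) univ) \<Rightarrow> bool" where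
  "bihom_coalgebra K C \<Delta> \<epsilon> \<omega> \<psi> \<longleftrightarrow>
     Module.module K C \<and> linear_map K C (tsp K C C) \<Delta> \<and> linear_form K C \<epsilon> \<and>
     linear_aut K C \<omega> \<and> linear_aut K C \<psi> \<and> commute_on (carrier C) \<omega> \<psi> \<and>
     (\<forall>\<theta>\<in>{\<omega>, \<psi>}. \<forall>c\<in>carrier C. \<epsilon> (\<theta> c) = \<epsilon> c \<and> \<Delta> (\<theta> c) = tmap K C C \<theta> \<theta> (\<Delta> c)) \<and>
     (\<forall>c\<in>carrier C.
        sw C (\<Delta> c) (\<lambda>c\<^sub>1 c\<^sub>2. \<epsilon> c\<^sub>2 \<odot>\<^bsub>C\<^esub> c\<^sub>1) = \<omega> c \<and>
        sw C (\<Delta> c) (\<lambda>c\<^sub>1 c\<^sub>2. \<epsilon> c\<^sub>1 \<odot>\<^bsub>C\<^esub> c\<^sub>2) = \<psi> c \<and>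
        sw (tsp3 K C C C) (\<Delta> c) (\<lambda>c\<^sub>1 c\<^sub>2. sw (tsp3 K C C C) (\<Delta> c\<^sub>2) (\<lambda>c\<^sub>2\<^sub>1 c\<^sub>2\<^sub>2.
            tens3 K C C C (\<omega> c\<^sub>1) c\<^sub>2\<^sub>1 c\<^sub>2\<^sub>2))
        = sw (tsp3 K C C C) (\<Delta> c) (\<lambda>c\<^sub>1 c\<^sub>2. sw (tsp3 K C C C) (\<Delta> c\<^sub>1) (\<lambda>c\<^sub>1\<^sub>1 c\<^sub>1\<^sub>2.
            tens3 K C C C c\<^sub>1\<^sub>1 c\<^sub>1\<^sub>2 (\<psi> c\<^sub>2))))"

definition bihom_coalgebra_map ::
  "('k, 'c) ring_scheme \<Rightarrow> ('k, ('k, 'a) univ, 'd) module_scheme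
     \<Rightarrow> (('k, 'a) univ \<Rightarrow> ('k, 'a) univ) \<Rightarrow> (('k, 'a) univ \<Rightarrow> 'k)
     \<Rightarrow> (('k, 'a) univ \<Rightarrow> ('k, 'a) univ) \<Rightarrow> (('k, 'a) univ \<Rightarrow> ('k, 'a) univ)
     \<Rightarrow> ('k, ('k, 'a) univ, 'e) module_scheme
     \<Rightarrow> (('k, 'a) univ \<Rightarrow> ('k, 'a) univ) \<Rightarrow> (('k, 'a) univ \<Rightarrow> 'k)
     \<Rightarrow> (('k, 'a) univ \<Rightarrow> ('k, 'a) univ) \<Rightarrow> (('k, 'a) univ \<Rightarrow> ('k, 'a) univ)
     \<Rightarrow> (('k, 'a) univ \<Rightarrow> ('k, 'a) univ) \<Rightarrow> bool" where
  "bihom_coalgebra_map K C \<Delta>\<^sub>C \<epsilon>\<^sub>C \<omega>\<^sub>C \<psi>\<^sub>C D \<Delta>\<^sub>D \<epsilon>\<^sub>D \<omega>\<^sub>D \<psi>\<^sub>D f \<longleftrightarrow>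
     linear_map K C D f \<and>
     (\<forall>c\<in>carrier C. f (\<omega>\<^sub>C c) = \<omega>\<^sub>D (f c) \<and> f (\<psi>\<^sub>C c) = \<psi>\<^sub>D (f c) \<and>
        \<Delta>\<^sub>D (f c) = tmap K D D f f (\<Delta>\<^sub>C c) \<and> \<epsilon>\<^sub>D (f c) = \<epsilon>\<^sub>C c)"

record ('k, 'v) aut_module = "('k, 'v) module" +
  alpha :: "'v \<Rightarrow> 'v"
  beta :: "'v \<Rightarrow> 'v"
  omega :: "'v \<Rightarrow> 'v"
  psi :: "'v \<Rightarrow> 'v"

record ('k, 'v) bihom_bialg = "('k, 'v) aut_module" +
  comult :: "'v \<Rightarrow> 'v"
  counit :: "'v \<Rightarrow> 'k"

definition commuting_auts :: "('k, 'c) ring_scheme \<Rightarrow> ('k, 'v, 'd) aut_module_scheme \<Rightarrow> bool" where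
  "commuting_auts K M \<longleftrightarrow>
     (\<forall>\<theta>\<in>{alpha M, beta M, omega M, psi M}. linear_aut K M \<theta> \<and>
        (\<forall>\<eta>\<in>{alpha M, beta M, omega M, psi M}. commute_on (carrier M) \<theta> \<eta>))"

definition zpow :: "'v set \<Rightarrow> ('v \<Rightarrow> 'v) \<Rightarrow> int \<Rightarrow> 'v \<Rightarrow> 'v" where
  "zpow A f n = (if n \<ge> 0 then f ^^ nat n else inv_into A f ^^ nat (- n))"

text \<open>\<open>aut M i j k l\<close> is \<open>\<alpha>\<^sup>i \<beta>\<^sup>j \<omega>\<^sup>k \<psi>\<^sup>l\<close> for the structure automorphisms of \<open>M\<close>.\<close>

definition aut :: "('k, 'v, 'd) aut_module_scheme \<Rightarrow> int \<Rightarrow> int \<Rightarrow> int \<Rightarrow> int \<Rightarrow> 'v \<Rightarrow> 'v" where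
  "aut M i j k l = zpow (carrier M) (alpha M) i \<circ> zpow (carrier M) (beta M) j \<circ>
     zpow (carrier M) (omega M) k \<circ> zpow (carrier M) (psi M) l"

definition bihom_bialgebra ::
  "('k, 'c) ring_scheme \<Rightarrow> ('k, ('k, 'a) univ, 'd) bihom_bialg_scheme \<Rightarrow> bool" where
  "bihom_bialgebra K H \<longleftrightarrow>
     bihom_algebra K H (alpha H) (beta H) \<and>
     bihom_coalgebra K H (comult H) (counit H) (omega H) (psi H) \<and>
     (\<forall>h\<in>carrier H. \<forall>g\<in>carrier H.
        comult H (h \<otimes>\<^bsub>H\<^esub> g) =
          sw (tsp K H H) (comult H h) (\<lambda>h\<^sub>1 h\<^sub>2. sw (tsp K H H) (comult H g) (\<lambda>g\<^sub>1 g\<^sub>2.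
            tens K H H (h\<^sub>1 \<otimes>\<^bsub>H\<^esub> g\<^sub>1) (h\<^sub>2 \<otimes>\<^bsub>H\<^esub> g\<^sub>2))) \<and>
        counit H (h \<otimes>\<^bsub>H\<^esub> g) = counit H h \<otimes>\<^bsub>K\<^esub> counit H g) \<and>
     comult H \<one>\<^bsub>H\<^esub> = tens K H H \<one>\<^bsub>H\<^esub> \<one>\<^bsub>H\<^esub> \<and> counit H \<one>\<^bsub>H\<^esub> = \<one>\<^bsub>K\<^esub> \<and>
     (\<forall>\<theta>\<in>{alpha H, beta H}. bihom_coalgebra_map K H (comult H) (counit H) (omega H) (psi H)
        H (comult H) (counit H) (omega H) (psi H) \<theta>) \<and>
     (\<forall>\<theta>\<in>{omega H, psi H}. bihom_algebra_map K H (alpha H) (beta H) H (alpha H) (beta H) \<theta>) \<and>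
     commuting_auts K H"

definition antipode ::
  "('k, 'c) ring_scheme \<Rightarrow> ('k, ('k, 'a) univ, 'd) bihom_bialg_scheme
     \<Rightarrow> (('k, 'a) univ \<Rightarrow> ('k, 'a) univ) \<Rightarrow> bool" where
  "antipode K H S \<longleftrightarrow>
     linear_map K H H S \<and>
     (\<forall>\<theta>\<in>{alpha H, beta H, omega H, psi H}. commute_on (carrier H) S \<theta>) \<and>
     (\<forall>h\<in>carrier H.
        sw H (comult H h) (\<lambda>h\<^sub>1 h\<^sub>2. h\<^sub>1 \<otimes>\<^bsub>H\<^esub> S h\<^sub>2) = counit H h \<odot>\<^bsub>H\<^esub> \<one>\<^bsub>H\<^esub> \<and>
        sw H (comult H h) (\<lambda>h\<^sub>1 h\<^sub>2. S h\<^sub>1 \<otimes>\<^bsub>H\<^esub> h\<^sub>2) = counit H h \<odot>\<^bsub>H\<^esub> \<one>\<^bsub>H\<^esub>)"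

definition bihom_hopf_algebra ::
  "('k, 'c) ring_scheme \<Rightarrow> ('k, ('k, 'a) univ, 'd) bihom_bialg_scheme
     \<Rightarrow> (('k, 'a) univ \<Rightarrow> ('k, 'a) univ) \<Rightarrow> bool" where
  "bihom_hopf_algebra K H S \<longleftrightarrow> bihom_bialgebra K H \<and> antipode K H S"


section \<open>Bimodules and bicomodules\<close>

text \<open>
  In \<open>lact M h x\<close> (for \<open>h \<triangleright> x\<close>) and \<open>ract M x h\<close> (for \<open>x \<triangleleft> h\<close>) the arguments are in the order of the
  written formula; \<open>lcoact M x\<close> lies in \<open>H \<otimes> M\<close> and \<open>rcoact M x\<close> in \<open>M \<otimes> H\<close>.
\<close>

record ('k, 'v) ydl = "('k, 'v) aut_module" +
  lact :: "'v \<Rightarrow> 'v \<Rightarrow> 'v"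
  ract :: "'v \<Rightarrow> 'v \<Rightarrow> 'v"
  lcoact :: "'v \<Rightarrow> 'v"
  rcoact :: "'v \<Rightarrow> 'v"

type_synonym ('k, 'a) bialg = "('k, ('k, 'a) univ) bihom_bialg"
type_synonym ('k, 'a) ydlobj = "('k, ('k, 'a) univ) ydl"

definition theta_pairs ::
  "('k, 'v, 'd) aut_module_scheme \<Rightarrow> ('k, 'v, 'e) aut_module_scheme
     \<Rightarrow> (('v \<Rightarrow> 'v) \<times> ('v \<Rightarrow> 'v)) set" where
  "theta_pairs H M =
     {(alpha H, alpha M), (beta H, beta M), (omega H, omega M), (psi H, psi M)}"

definition left_module ::
  "('k, 'c) ring_scheme \<Rightarrow> ('k, 'a) bialg \<Rightarrow> ('k, 'a) ydlobj \<Rightarrow> bool" where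
  "left_module K H M \<longleftrightarrow>
     Module.module K M \<and> commuting_auts K M \<and> bilinear_map K H M M (lact M) \<and>
     (\<forall>(\<theta>, \<theta>\<^sub>M)\<in>theta_pairs H M. \<forall>h\<in>carrier H. \<forall>x\<in>carrier M.
        \<theta>\<^sub>M (lact M h x) = lact M (\<theta> h) (\<theta>\<^sub>M x)) \<and>
     (\<forall>h\<in>carrier H. \<forall>g\<in>carrier H. \<forall>x\<in>carrier M.
        lact M (alpha H h) (lact M g x) = lact M (h \<otimes>\<^bsub>H\<^esub> g) (beta M x)) \<and>
     (\<forall>x\<in>carrier M. lact M \<one>\<^bsub>H\<^esub> x = beta M x)"

definition right_module ::
  "('k, 'c) ring_scheme \<Rightarrow> ('k, 'a) bialg \<Rightarrow> ('k, 'a) ydlobj \<Rightarrow> bool" where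
  "right_module K H M \<longleftrightarrow>
     Module.module K M \<and> commuting_auts K M \<and> bilinear_map K M H M (ract M) \<and>
     (\<forall>(\<theta>, \<theta>\<^sub>M)\<in>theta_pairs H M. \<forall>h\<in>carrier H. \<forall>x\<in>carrier M.
        \<theta>\<^sub>M (ract M x h) = ract M (\<theta>\<^sub>M x) (\<theta> h)) \<and>
     (\<forall>h\<in>carrier H. \<forall>g\<in>carrier H. \<forall>x\<in>carrier M.
        ract M (ract M x h) (beta H g) = ract M (alpha M x) (h \<otimes>\<^bsub>H\<^esub> g)) \<and>
     (\<forall>x\<in>carrier M. ract M x \<one>\<^bsub>H\<^esub> = alpha M x)"

definition bimodule ::
  "('k, 'c) ring_scheme \<Rightarrow> ('k, 'a) bialg \<Rightarrow> ('k, 'a) ydlobj \<Rightarrow> bool" where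
  "bimodule K H M \<longleftrightarrow>
     left_module K H M \<and> right_module K H M \<and>
     (\<forall>a\<in>carrier H. \<forall>b\<in>carrier H. \<forall>x\<in>carrier M.
        lact M (alpha H a) (ract M x b) = ract M (lact M a x) (beta H b))"

definition right_comodule ::
  "('k, 'c) ring_scheme \<Rightarrow> ('k, 'a) bialg \<Rightarrow> ('k, 'a) ydlobj \<Rightarrow> bool" where
  "right_comodule K H M \<longleftrightarrow>
     Module.module K M \<and> commuting_auts K M \<and> linear_map K M (tsp K M H) (rcoact M) \<and>
     (\<forall>(\<theta>, \<theta>\<^sub>M)\<in>theta_pairs H M. \<forall>x\<in>carrier M.
        rcoact M (\<theta>\<^sub>M x) = tmap K M H \<theta>\<^sub>M \<theta> (rcoact M x)) \<and>
     (\<forall>x\<in>carrier M.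
        sw (tsp3 K M H H) (rcoact M x) (\<lambda>x\<^sub>0 x\<^sub>1. sw (tsp3 K M H H) (comult H x\<^sub>1) (\<lambda>x\<^sub>1\<^sub>1 x\<^sub>1\<^sub>2.
            tens3 K M H H (omega M x\<^sub>0) x\<^sub>1\<^sub>1 x\<^sub>1\<^sub>2))
        = sw (tsp3 K M H H) (rcoact M x) (\<lambda>x\<^sub>0 x\<^sub>1. sw (tsp3 K M H H) (rcoact M x\<^sub>0) (\<lambda>x\<^sub>0\<^sub>0 x\<^sub>0\<^sub>1.
            tens3 K M H H x\<^sub>0\<^sub>0 x\<^sub>0\<^sub>1 (psi H x\<^sub>1))) \<and>
        sw M (rcoact M x) (\<lambda>x\<^sub>0 x\<^sub>1. counit H x\<^sub>1 \<odot>\<^bsub>M\<^esub> x\<^sub>0) = omega M x)"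

definition left_comodule ::
  "('k, 'c) ring_scheme \<Rightarrow> ('k, 'a) bialg \<Rightarrow> ('k, 'a) ydlobj \<Rightarrow> bool" where
  "left_comodule K H M \<longleftrightarrow>
     Module.module K M \<and> commuting_auts K M \<and> linear_map K M (tsp K H M) (lcoact M) \<and>
     (\<forall>(\<theta>, \<theta>\<^sub>M)\<in>theta_pairs H M. \<forall>x\<in>carrier M.
        lcoact M (\<theta>\<^sub>M x) = tmap K H M \<theta> \<theta>\<^sub>M (lcoact M x)) \<and>
     (\<forall>x\<in>carrier M.
        sw (tsp3 K H H M) (lcoact M x) (\<lambda>x\<^sub>m x\<^sub>0. sw (tsp3 K H H M) (comult H x\<^sub>m) (\<lambda>x\<^sub>m\<^sub>1 x\<^sub>m\<^sub>2.
            tens3 K H H M x\<^sub>m\<^sub>1 x\<^sub>m\<^sub>2 (psi M x\<^sub>0)))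
        = sw (tsp3 K H H M) (lcoact M x) (\<lambda>x\<^sub>m x\<^sub>0. sw (tsp3 K H H M) (lcoact M x\<^sub>0) (\<lambda>x\<^sub>0\<^sub>m x\<^sub>0\<^sub>0.
            tens3 K H H M (omega H x\<^sub>m) x\<^sub>0\<^sub>m x\<^sub>0\<^sub>0)) \<and>
        sw M (lcoact M x) (\<lambda>x\<^sub>m x\<^sub>0. counit H x\<^sub>m \<odot>\<^bsub>M\<^esub> x\<^sub>0) = psi M x)"

definition bicomodule ::
  "('k, 'c) ring_scheme \<Rightarrow> ('k, 'a) bialg \<Rightarrow> ('k, 'a) ydlobj \<Rightarrow> bool" where
  "bicomodule K H M \<longleftrightarrow>
     left_comodule K H M \<and> right_comodule K H M \<and>
     (\<forall>x\<in>carrier M.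
        sw (tsp3 K H M H) (lcoact M x) (\<lambda>x\<^sub>m x\<^sub>0. sw (tsp3 K H M H) (rcoact M x\<^sub>0) (\<lambda>x\<^sub>0\<^sub>0 x\<^sub>0\<^sub>1.
            tens3 K H M H (omega H x\<^sub>m) x\<^sub>0\<^sub>0 x\<^sub>0\<^sub>1))
        = sw (tsp3 K H M H) (rcoact M x) (\<lambda>x\<^sub>0 x\<^sub>1. sw (tsp3 K H M H) (lcoact M x\<^sub>0) (\<lambda>x\<^sub>0\<^sub>m x\<^sub>0\<^sub>0.
            tens3 K H M H x\<^sub>0\<^sub>m x\<^sub>0\<^sub>0 (psi H x\<^sub>1))))"


section \<open>Yetter-Drinfel'd-Long bimodules\<close>

definition ydl_bimodule ::
  "('k, 'c) ring_scheme \<Rightarrow> ('k, 'a) bialg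
     \<Rightarrow> int \<Rightarrow> int \<Rightarrow> int \<Rightarrow> int \<Rightarrow> int \<Rightarrow> int \<Rightarrow> int \<Rightarrow> int \<Rightarrow> ('k, 'a) ydlobj \<Rightarrow> bool" where
  "ydl_bimodule K H m n p q s t u v M \<longleftrightarrow>
     bimodule K H M \<and> bicomodule K H M \<and>
     (\<forall>x\<in>carrier M. \<forall>h\<in>carrier H.
        sw (tsp K H M) (comult H h) (\<lambda>h\<^sub>1 h\<^sub>2.
          sw (tsp K H M) (lcoact M (lact M (aut H s (p + 1) q (t + 1) h\<^sub>1) x)) (\<lambda>y\<^sub>m y\<^sub>0.
            tens K H M (y\<^sub>m \<otimes>\<^bsub>H\<^esub> aut H 1 (-1) 1 (-1) h\<^sub>2) y\<^sub>0))
        = sw (tsp K H M) (comult H h) (\<lambda>h\<^sub>1 h\<^sub>2. sw (tsp K H M) (lcoact M x) (\<lambda>x\<^sub>m x\<^sub>0.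
            tens K H M (h\<^sub>1 \<otimes>\<^bsub>H\<^esub> alpha H x\<^sub>m) (lact M (aut H s (p + 1) (q + 1) (t + 1) h\<^sub>2) x\<^sub>0)))) \<and>
     (\<forall>x\<in>carrier M. \<forall>h\<in>carrier H.
        rcoact M (lact M h x)
        = sw (tsp K M H) (rcoact M x) (\<lambda>x\<^sub>0 x\<^sub>1. tens K M H (lact M (omega H h) x\<^sub>0) (beta H x\<^sub>1))) \<and>
     (\<forall>x\<in>carrier M. \<forall>h\<in>carrier H.
        sw (tsp K M H) (comult H h) (\<lambda>h\<^sub>1 h\<^sub>2.
          sw (tsp K M H) (rcoact M (ract M x (aut H (m + 1) u (v + 1) n h\<^sub>2))) (\<lambda>y\<^sub>0 y\<^sub>1.
            tens K M H y\<^sub>0 (aut H (-1) 1 (-1) 1 h\<^sub>1 \<otimes>\<^bsub>H\<^esub> y\<^sub>1)))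
        = sw (tsp K M H) (comult H h) (\<lambda>h\<^sub>1 h\<^sub>2. sw (tsp K M H) (rcoact M x) (\<lambda>x\<^sub>0 x\<^sub>1.
            tens K M H (ract M x\<^sub>0 (aut H (m + 1) u (v + 1) (n + 1) h\<^sub>1)) (beta H x\<^sub>1 \<otimes>\<^bsub>H\<^esub> h\<^sub>2)))) \<and>
     (\<forall>x\<in>carrier M. \<forall>h\<in>carrier H.
        lcoact M (ract M x h)
        = sw (tsp K H M) (lcoact M x) (\<lambda>x\<^sub>m x\<^sub>0. tens K H M (alpha H x\<^sub>m) (ract M x\<^sub>0 (psi H h))))"

definition ydl_morphism ::
  "('k, 'c) ring_scheme \<Rightarrow> ('k, 'a) bialg \<Rightarrow> ('k, 'a) ydlobj \<Rightarrow> ('k, 'a) ydlobj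
     \<Rightarrow> (('k, 'a) univ \<Rightarrow> ('k, 'a) univ) \<Rightarrow> bool" where
  "ydl_morphism K H M N f \<longleftrightarrow>
     linear_map K M N f \<and>
     (\<forall>x\<in>carrier M.
        f (alpha M x) = alpha N (f x) \<and> f (beta M x) = beta N (f x) \<and>
        f (omega M x) = omega N (f x) \<and> f (psi M x) = psi N (f x) \<and>
        (\<forall>h\<in>carrier H. f (lact M h x) = lact N h (f x) \<and> f (ract M x h) = ract N (f x) h) \<and>
        lcoact N (f x) = tmap K H N id f (lcoact M x) \<and>
        rcoact N (f x) = tmap K N H f id (rcoact M x))"

text \<open>
  An arrow is a triple of source, target and underlying map. The map is extensional on the
  carrier of the source, so that equality of arrows is equality on that carrier.
\<close>

type_synonym ('k, 'a) ydlarr =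
  "('k, 'a) ydlobj \<times> ('k, 'a) ydlobj \<times> (('k, 'a) univ \<Rightarrow> ('k, 'a) univ)"

definition arr ::
  "('k, 'a) ydlobj \<Rightarrow> ('k, 'a) ydlobj \<Rightarrow> (('k, 'a) univ \<Rightarrow> ('k, 'a) univ) \<Rightarrow> ('k, 'a) ydlarr" where
  "arr M N f = (M, N, restrict f (carrier M))"

definition ydl_hom ::
  "('k, 'c) ring_scheme \<Rightarrow> ('k, 'a) bialg \<Rightarrow> ('k, 'a) ydlobj \<Rightarrow> ('k, 'a) ydlobj
     \<Rightarrow> ('k, 'a) ydlarr set" where
  "ydl_hom K H M N = {(M, N, f) | f. f \<in> extensional (carrier M) \<and> ydl_morphism K H M N f}"

fun ydl_cmp :: "('k, 'a) ydlarr \<Rightarrow> ('k, 'a) ydlarr \<Rightarrow> ('k, 'a) ydlarr" where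
  "ydl_cmp (N', P, g) (M, N, f) = arr M P (g \<circ> f)"

definition ydl_tensor ::
  "('k, 'c) ring_scheme \<Rightarrow> ('k, 'a) bialg \<Rightarrow> ('k, 'a) ydlobj \<Rightarrow> ('k, 'a) ydlobj
     \<Rightarrow> ('k, 'a) ydlobj" where
  "ydl_tensor K H M N = (let T = tsp K M N in
     \<lparr>carrier = carrier T, mult = undefined, one = undefined, zero = \<zero>\<^bsub>T\<^esub>, add = add T,
      smult = smult T,
      alpha = tmap K M N (alpha M) (alpha N),
      beta = tmap K M N (beta M) (beta N),
      omega = tmap K M N (omega M) (omega N),
      psi = tmap K M N (psi M) (psi N),
      lact = (\<lambda>h r. sw T (comult H h) (\<lambda>h\<^sub>1 h\<^sub>2. sw T r (\<lambda>x y.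
                tens K M N (lact M h\<^sub>1 x) (lact N h\<^sub>2 y)))),
      ract = (\<lambda>r h. sw T (comult H h) (\<lambda>h\<^sub>1 h\<^sub>2. sw T r (\<lambda>x y.
                tens K M N (ract M x h\<^sub>1) (ract N y h\<^sub>2)))),
      lcoact = (\<lambda>r. sw (tsp K H T) r (\<lambda>x y.
                sw (tsp K H T) (lcoact M x) (\<lambda>x\<^sub>m x\<^sub>0. sw (tsp K H T) (lcoact N y) (\<lambda>y\<^sub>m y\<^sub>0.
                  tens K H T (aut H (-1) 0 (-1) 0 x\<^sub>m \<otimes>\<^bsub>H\<^esub> aut H 0 (-1) 0 (-1) y\<^sub>m)
                    (tens K M N x\<^sub>0 y\<^sub>0))))),
      rcoact = (\<lambda>r. sw (tsp K T H) r (\<lambda>x y.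
                sw (tsp K T H) (rcoact M x) (\<lambda>x\<^sub>0 x\<^sub>1. sw (tsp K T H) (rcoact N y) (\<lambda>y\<^sub>0 y\<^sub>1.
                  tens K T H (tens K M N x\<^sub>0 y\<^sub>0)
                    (aut H (-1) 0 (-1) 0 x\<^sub>1 \<otimes>\<^bsub>H\<^esub> aut H 0 (-1) 0 (-1) y\<^sub>1)))))\<rparr>)"

fun ydl_tensor_arr ::
  "('k, 'c) ring_scheme \<Rightarrow> ('k, 'a) bialg \<Rightarrow> ('k, 'a) ydlarr \<Rightarrow> ('k, 'a) ydlarr
     \<Rightarrow> ('k, 'a) ydlarr" where
  "ydl_tensor_arr K H (M, M', f) (N, N', g) =
     arr (ydl_tensor K H M N) (ydl_tensor K H M' N') (tmap K M' N' f g)"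

definition scalar_space :: "('k, 'c) ring_scheme \<Rightarrow> ('k, ('k, 'a) univ) module" where
  "scalar_space K =
     \<lparr>carrier = Scalar ` carrier K, mult = undefined, one = undefined,
      zero = Scalar \<zero>\<^bsub>K\<^esub>,
      add = (\<lambda>x y. Scalar (the_scalar x \<oplus>\<^bsub>K\<^esub> the_scalar y)),
      smult = (\<lambda>a x. Scalar (a \<otimes>\<^bsub>K\<^esub> the_scalar x))\<rparr>"

text \<open>The unit object is \<open>K\<close> with the actions through \<open>\<epsilon>\<close> and the coactions through \<open>1\<^sub>H\<close>.\<close>

definition ydl_unit :: "('k, 'c) ring_scheme \<Rightarrow> ('k, 'a) bialg \<Rightarrow> ('k, 'a) ydlobj" where
  "ydl_unit K H = (let I = scalar_space K in
     \<lparr>carrier = carrier I, mult = undefined, one = undefined, zero = \<zero>\<^bsub>I\<^esub>, add = add I,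
      smult = smult I,
      alpha = id, beta = id, omega = id, psi = id,
      lact = (\<lambda>h x. counit H h \<odot>\<^bsub>I\<^esub> x),
      ract = (\<lambda>x h. counit H h \<odot>\<^bsub>I\<^esub> x),
      lcoact = (\<lambda>x. tens K H I \<one>\<^bsub>H\<^esub> x),
      rcoact = (\<lambda>x. tens K I H x \<one>\<^bsub>H\<^esub>)\<rparr>)"

text \<open>
  In Sweedler notation all brackets and factors \<open>K\<close> are suppressed, but \<open>(x \<otimes> y) \<otimes> z \<mapsto> x \<otimes> (y \<otimes> z)\<close> is
  in general not \<open>H\<close>-linear: \<open>h\<close> acts by \<open>h\<^sub>1\<^sub>1 \<otimes> h\<^sub>1\<^sub>2 \<otimes> h\<^sub>2\<close> on the left-hand side and by
  \<open>h\<^sub>1 \<otimes> h\<^sub>2\<^sub>1 \<otimes> h\<^sub>2\<^sub>2\<close> on the right-hand side, which are related by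
  \<open>\<omega>(h\<^sub>1) \<otimes> h\<^sub>2\<^sub>1 \<otimes> h\<^sub>2\<^sub>2 = h\<^sub>1\<^sub>1 \<otimes> h\<^sub>1\<^sub>2 \<otimes> \<psi>(h\<^sub>2)\<close>. Likewise \<open>h \<triangleright> (1 \<otimes> x) = 1 \<otimes> \<psi>(h) \<triangleright> x\<close> and
  \<open>h \<triangleright> (x \<otimes> 1) = \<omega>(h) \<triangleright> x \<otimes> 1\<close>. The constraints therefore carry the structure automorphisms:
  \<open>(x \<otimes> y) \<otimes> z \<mapsto> \<omega>\<^sup>-\<^sup>1(x) \<otimes> (y \<otimes> \<psi>(z))\<close>, \<open>1 \<otimes> x \<mapsto> \<psi>\<^sup>-\<^sup>1(x)\<close> and \<open>x \<otimes> 1 \<mapsto> \<omega>\<^sup>-\<^sup>1(x)\<close>. On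
  objects whose \<open>\<omega>\<close> and \<open>\<psi>\<close> are identities they are the usual identifications.
\<close>

definition ydl_assoc ::
  "('k, 'c) ring_scheme \<Rightarrow> ('k, 'a) bialg \<Rightarrow> ('k, 'a) ydlobj \<Rightarrow> ('k, 'a) ydlobj
     \<Rightarrow> ('k, 'a) ydlobj \<Rightarrow> ('k, 'a) ydlarr" where
  "ydl_assoc K H M N P =
     arr (ydl_tensor K H (ydl_tensor K H M N) P) (ydl_tensor K H M (ydl_tensor K H N P))
       (\<lambda>r. sw (tsp3 K M N P) r (\<lambda>w z. sw (tsp3 K M N P) w (\<lambda>x y.
          tens3 K M N P (aut M 0 0 (-1) 0 x) y (psi P z))))"

definition ydl_lunit ::
  "('k, 'c) ring_scheme \<Rightarrow> ('k, 'a) bialg \<Rightarrow> ('k, 'a) ydlobj \<Rightarrow> ('k, 'a) ydlarr" where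
  "ydl_lunit K H M =
     arr (ydl_tensor K H (ydl_unit K H) M) M
       (\<lambda>r. sw M r (\<lambda>a x. the_scalar a \<odot>\<^bsub>M\<^esub> aut M 0 0 0 (-1) x))"

definition ydl_runit ::
  "('k, 'c) ring_scheme \<Rightarrow> ('k, 'a) bialg \<Rightarrow> ('k, 'a) ydlobj \<Rightarrow> ('k, 'a) ydlarr" where
  "ydl_runit K H M =
     arr (ydl_tensor K H M (ydl_unit K H)) M
       (\<lambda>r. sw M r (\<lambda>x a. the_scalar a \<odot>\<^bsub>M\<^esub> aut M 0 0 (-1) 0 x))"

definition LR ::
  "('k, 'c) ring_scheme \<Rightarrow> ('k, 'a) bialg
     \<Rightarrow> int \<Rightarrow> int \<Rightarrow> int \<Rightarrow> int \<Rightarrow> int \<Rightarrow> int \<Rightarrow> int \<Rightarrow> int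
     \<Rightarrow> (('k, 'a) ydlobj, ('k, 'a) ydlarr) moncat" where
  "LR K H m n p q s t u v =
     \<lparr>Obj = {M. ydl_bimodule K H m n p q s t u v M},
      Hom = ydl_hom K H,
      Id = (\<lambda>M. arr M M id),
      cmp = ydl_cmp,
      tobj = ydl_tensor K H,
      tarr = ydl_tensor_arr K H,
      unit_obj = ydl_unit K H,
      assoc = ydl_assoc K H,
      lunit = ydl_lunit K H,
      runit = ydl_runit K H\<rparr>"

definition ydl_braiding ::
  "('k, 'c) ring_scheme \<Rightarrow> ('k, 'a) bialg
     \<Rightarrow> int \<Rightarrow> int \<Rightarrow> int \<Rightarrow> int \<Rightarrow> int \<Rightarrow> int \<Rightarrow> int \<Rightarrow> int
     \<Rightarrow> ('k, 'a) ydlobj \<Rightarrow> ('k, 'a) ydlobj \<Rightarrow> ('k, 'a) ydlarr" where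
  "ydl_braiding K H m n p q s t u v M N =
     arr (ydl_tensor K H M N) (ydl_tensor K H N M)
       (\<lambda>r. sw (tsp K N M) r (\<lambda>x y.
          sw (tsp K N M) (lcoact M x) (\<lambda>x\<^sub>m x\<^sub>0. sw (tsp K N M) (rcoact N y) (\<lambda>y\<^sub>0 y\<^sub>1.
            tens K N M
              (lact N (aut H s (p + 1) q (t + 1) x\<^sub>m) (aut N 0 (-1) 0 (-1) y\<^sub>0))
              (ract M (aut M (-1) 0 (-1) 0 x\<^sub>0) (aut H (m + 1) u (v + 1) n y\<^sub>1))))))"

definition ydl_braiding_inv ::
  "('k, 'c) ring_scheme \<Rightarrow> ('k, 'a) bialg \<Rightarrow> (('k, 'a) univ \<Rightarrow> ('k, 'a) univ)
     \<Rightarrow> int \<Rightarrow> int \<Rightarrow> int \<Rightarrow> int \<Rightarrow> int \<Rightarrow> int \<Rightarrow> int \<Rightarrow> int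
     \<Rightarrow> ('k, 'a) ydlobj \<Rightarrow> ('k, 'a) ydlobj \<Rightarrow> ('k, 'a) ydlarr" where
  "ydl_braiding_inv K H S m n p q s t u v M N =
     arr (ydl_tensor K H N M) (ydl_tensor K H M N)
       (\<lambda>r. sw (tsp K M N) r (\<lambda>y x.
          sw (tsp K M N) (lcoact M x) (\<lambda>x\<^sub>m x\<^sub>0. sw (tsp K M N) (rcoact N y) (\<lambda>y\<^sub>0 y\<^sub>1.
            tens K M N
              (ract M (aut M (-1) 0 1 (-2) x\<^sub>0)
                (inv_into (carrier H) S (aut H m (u + 1) v (n + 1) y\<^sub>1)))
              (lact N (inv_into (carrier H) S (aut H (s + 1) p (q + 1) t x\<^sub>m))
                (aut N 0 (-1) (-2) 1 y\<^sub>0))))))"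

end

theory Submission
  imports Defs
begin

text \<open>
  All identities are checked on pure tensors, where both sides become iterated Sweedler sums. The
  structure automorphisms are moved onto the innermost variables, where their exponents add up. What
  remains is to apply coassociativity, the commutation of the two coactions, and the compatibility
  conditions (i) and (iii), which hold for arbitrary multilinear expressions in the Sweedler
  components.

  For the inverse braiding, put \<open>\<phi> = \<alpha>\<omega>\<close> and \<open>\<chi> = \<beta>\<psi>\<close>. Up to the twists \<open>\<phi>\<^sup>-\<^sup>1\<chi>\<close> and \<open>\<chi>\<^sup>-\<^sup>1\<phi>\<close>, the
  antipode is a right and a left convolution inverse of the identity of the untwisted bialgebra; if \<open>S\<close>
  is bijective this forces \<open>\<phi>\<^sup>2 = \<chi>\<^sup>2\<close>. With this relation \<open>S\<close> is a twisted antihomomorphism, so that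
  \<open>S\<^sup>-\<^sup>1\<close> satisfies the antipode identities for the opposite product, and these cancel all Sweedler
  components in the two composites. The inverse is a morphism because it is the inverse of a bijective
  morphism.
\<close>


section \<open>Linear maps and finite sums\<close>

text \<open>A tensor is one chosen formal sum and \<open>sw\<close> adds over that list, so
  \<open>sw Z r F\<close> respects the tensor product only for bilinear \<open>F\<close>. Nearly
  every rewrite therefore carries linearity and membership conditions, and much of the general
  theory is there to let the simplifier discharge them: linearity is stated for one variable at a
  time, and the bound variables of a Sweedler sum come with their carriers. Coassociativity is
  needed in both directions. It is kept out of the default rewrite rules and invoked where two
  components of one element have to be brought next to each other. The braiding carries exactly the
  exponents of conditions (i) and (iii). This is why each of its four compatibilities rests on one
  of them: linearity on (i) for \<open>M\<close> and (iii) for \<open>N\<close>, colinearity on (i)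
  for \<open>N\<close> and (iii) for \<open>M\<close>, where the element that acts is itself a
  component of a coaction.\<close>

lemma linear_mapI:
  assumes "\<And>x. x \<in> carrier V \<Longrightarrow> f x \<in> carrier W"
    and "\<And>x y. x \<in> carrier V \<Longrightarrow> y \<in> carrier V \<Longrightarrow> f (x \<oplus>\<^bsub>V\<^esub> y) = f x \<oplus>\<^bsub>W\<^esub> f y"
    and "\<And>a x. a \<in> carrier K \<Longrightarrow> x \<in> carrier V \<Longrightarrow> f (a \<odot>\<^bsub>V\<^esub> x) = a \<odot>\<^bsub>W\<^esub> f x"
  shows "linear_map K V W f"
  using assms by (auto simp: linear_map_def)

lemma linear_map_closed: "linear_map K V W f \<Longrightarrow> x \<in> carrier V \<Longrightarrow> f x \<in> carrier W"
  by (auto simp: linear_map_def)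

lemma linear_map_add:
  "linear_map K V W f \<Longrightarrow> x \<in> carrier V \<Longrightarrow> y \<in> carrier V \<Longrightarrow> f (x \<oplus>\<^bsub>V\<^esub> y) = f x \<oplus>\<^bsub>W\<^esub> f y"
  by (auto simp: linear_map_def)

lemma linear_map_smult:
  "linear_map K V W f \<Longrightarrow> a \<in> carrier K \<Longrightarrow> x \<in> carrier V \<Longrightarrow> f (a \<odot>\<^bsub>V\<^esub> x) = a \<odot>\<^bsub>W\<^esub> f x"
  by (auto simp: linear_map_def)

lemma linear_map_comp:
  "linear_map K V W f \<Longrightarrow> linear_map K U V e \<Longrightarrow> linear_map K U W (\<lambda>x. f (e x))"
  by (auto simp: linear_map_def Pi_iff)

lemma linear_map_ident: "linear_map K V V (\<lambda>x. x)"
  by (auto simp: linear_map_def)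

lemma linear_map_cong:
  "\<lbrakk>\<And>x. x \<in> carrier V \<Longrightarrow> f x = g x; Module.module K V\<rbrakk>
    \<Longrightarrow> linear_map K V W f \<longleftrightarrow> linear_map K V W g"
  unfolding linear_map_def
  by (auto simp: Pi_iff abelian_groupE module.smult_closed dest: module.axioms)

lemma linear_map_zero:
  assumes "Module.module K V" "Module.module K W" "linear_map K V W f"
  shows "f \<zero>\<^bsub>V\<^esub> = \<zero>\<^bsub>W\<^esub>"
proof -
  interpret V: Module.module K V by fact
  interpret W: Module.module K W by fact
  have "f \<zero>\<^bsub>V\<^esub> = f (\<zero>\<^bsub>K\<^esub> \<odot>\<^bsub>V\<^esub> \<zero>\<^bsub>V\<^esub>)" by simp
  also have "\<dots> = \<zero>\<^bsub>K\<^esub> \<odot>\<^bsub>W\<^esub> f \<zero>\<^bsub>V\<^esub>"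
    using linear_map_smult[OF assms(3)] by blast
  also have "\<dots> = \<zero>\<^bsub>W\<^esub>" using linear_map_closed[OF assms(3)] by simp
  finally show ?thesis .
qed

lemma bilinear_mapI:
  assumes "\<And>x. x \<in> carrier U \<Longrightarrow> linear_map K V W (F x)"
    and "\<And>y. y \<in> carrier V \<Longrightarrow> linear_map K U W (\<lambda>x. F x y)"
  shows "bilinear_map K U V W F"
  using assms by (auto simp: bilinear_map_def)

text \<open>\<open>sw\<close> reads its list off a tensor and admits no induction; the same sum over
  an arbitrary list does, and can be compared on equivalent lists.\<close>

definition lsum :: "('k, 'w, 'd) module_scheme \<Rightarrow> ('x \<Rightarrow> 'y \<Rightarrow> 'w) \<Rightarrow> ('x \<times> 'y) list \<Rightarrow> 'w" where
  "lsum Z F l = foldr (\<lambda>(x, y) z. F x y \<oplus>\<^bsub>Z\<^esub> z) l \<zero>\<^bsub>Z\<^esub>"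

lemma sw_lsum: "sw Z r F = lsum Z F (summands r)"
  by (simp add: sw_def lsum_def)

lemma lsum_Nil [simp]: "lsum Z F [] = \<zero>\<^bsub>Z\<^esub>"
  by (simp add: lsum_def)

lemma lsum_Cons [simp]: "lsum Z F ((x, y) # l) = F x y \<oplus>\<^bsub>Z\<^esub> lsum Z F l"
  by (simp add: lsum_def)

lemma lsum_cong:
  "l = l' \<Longrightarrow> (\<And>x y. (x, y) \<in> set l' \<Longrightarrow> F x y = G x y) \<Longrightarrow> lsum Z F l = lsum Z G l'"
  unfolding lsum_def by (auto intro!: foldr_cong)

lemma lsum_linear:
  assumes "Module.module K Z" "Module.module K Z'" "linear_map K Z Z' f"
    and "\<And>x y. (x, y) \<in> set l \<Longrightarrow> F x y \<in> carrier Z"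
  shows "lsum Z F l \<in> carrier Z" "f (lsum Z F l) = lsum Z' (\<lambda>x y. f (F x y)) l"
proof -
  interpret Z: Module.module K Z by fact
  have "lsum Z F l \<in> carrier Z \<and> f (lsum Z F l) = lsum Z' (\<lambda>x y. f (F x y)) l"
    using assms(4)
    by (induction l) (auto simp: linear_map_zero[OF assms(1-3)] linear_map_add[OF assms(3)])
  then show "lsum Z F l \<in> carrier Z" "f (lsum Z F l) = lsum Z' (\<lambda>x y. f (F x y)) l"
    by auto
qed

context module begin

lemma lsum_closed:
  "(\<And>x y. (x, y) \<in> set l \<Longrightarrow> F x y \<in> carrier M) \<Longrightarrow> lsum M F l \<in> carrier M"
  by (induction l) auto

lemma lsum_append:
  "\<lbrakk>\<And>x y. (x, y) \<in> set l \<Longrightarrow> F x y \<in> carrier M; \<And>x y. (x, y) \<in> set l' \<Longrightarrow> F x y \<in> carrier M\<rbrakk>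
    \<Longrightarrow> lsum M F (l @ l') = lsum M F l \<oplus>\<^bsub>M\<^esub> lsum M F l'"
  by (induction l) (auto simp: M.a_assoc lsum_closed)

lemma lsum_add:
  "\<lbrakk>\<And>x y. (x, y) \<in> set l \<Longrightarrow> F x y \<in> carrier M; \<And>x y. (x, y) \<in> set l \<Longrightarrow> G x y \<in> carrier M\<rbrakk>
    \<Longrightarrow> lsum M (\<lambda>x y. F x y \<oplus>\<^bsub>M\<^esub> G x y) l = lsum M F l \<oplus>\<^bsub>M\<^esub> lsum M G l"
  by (induction l) (auto simp: M.a_ac lsum_closed)

lemma lsum_smult:
  "\<lbrakk>a \<in> carrier R; \<And>x y. (x, y) \<in> set l \<Longrightarrow> F x y \<in> carrier M\<rbrakk>
    \<Longrightarrow> lsum M (\<lambda>x y. a \<odot>\<^bsub>M\<^esub> F x y) l = a \<odot>\<^bsub>M\<^esub> lsum M F l"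
  by (induction l) (auto simp: lsum_closed smult_r_distr)

lemma lsum_zero: "lsum M (\<lambda>x y. \<zero>\<^bsub>M\<^esub>) l = \<zero>\<^bsub>M\<^esub>"
  by (induction l) auto

lemma lsum_swap:
  assumes "\<And>x y z w. (x, y) \<in> set l \<Longrightarrow> (z, w) \<in> set l' \<Longrightarrow> F x y z w \<in> carrier M"
  shows "lsum M (\<lambda>x y. lsum M (F x y) l') l = lsum M (\<lambda>z w. lsum M (\<lambda>x y. F x y z w) l) l'"
  using assms
proof (induction l)
  case Nil
  then show ?case by (simp add: lsum_zero)
next
  case (Cons p l)
  then show ?case
    by (cases p) (simp add: lsum_add lsum_closed)
qed

end

lemma linear_map_lsum:
  assumes "Module.module K V" "Module.module K Z"
    and "\<And>a b. (a, b) \<in> set l \<Longrightarrow> linear_map K V Z (\<lambda>x. F x a b)"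
  shows "linear_map K V Z (\<lambda>x. lsum Z (F x) l)"
proof -
  interpret V: Module.module K V by fact
  interpret Z: Module.module K Z by fact
  have Fc: "(a, b) \<in> set l \<Longrightarrow> x \<in> carrier V \<Longrightarrow> F x a b \<in> carrier Z" for x a b
    using assms(3) by (rule linear_map_closed)
  show ?thesis
  proof (rule linear_mapI)
    fix x assume x: "x \<in> carrier V"
    then show "lsum Z (F x) l \<in> carrier Z" using Fc by (intro Z.lsum_closed) auto
    fix y assume y: "y \<in> carrier V"
    have "lsum Z (F (x \<oplus>\<^bsub>V\<^esub> y)) l = lsum Z (\<lambda>a b. F x a b \<oplus>\<^bsub>Z\<^esub> F y a b) l"
      using x y by (intro lsum_cong) (auto simp: linear_map_add[OF assms(3)])
    then show "lsum Z (F (x \<oplus>\<^bsub>V\<^esub> y)) l = lsum Z (F x) l \<oplus>\<^bsub>Z\<^esub> lsum Z (F y) l"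
      using x y Fc by (simp add: Z.lsum_add)
  next
    fix a x assume a: "a \<in> carrier K" and x: "x \<in> carrier V"
    have "lsum Z (F (a \<odot>\<^bsub>V\<^esub> x)) l = lsum Z (\<lambda>b c. a \<odot>\<^bsub>Z\<^esub> F x b c) l"
      using x a by (intro lsum_cong) (auto simp: linear_map_smult[OF assms(3)])
    then show "lsum Z (F (a \<odot>\<^bsub>V\<^esub> x)) l = a \<odot>\<^bsub>Z\<^esub> lsum Z (F x) l"
      using x a Fc by (simp add: Z.lsum_smult)
  qed
qed


section \<open>Tensor products\<close>

text \<open>Membership is a premise only of the base rules of \<open>tensor_eq\<close>; the
  \<open>append\<close> case of the next lemma has to recover it from the relation itself.\<close>

lemma tensor_eq_lists:
  assumes "Module.module K V" "Module.module K W" "tensor_eq K V W l l'"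
  shows "l \<in> lists (carrier V \<times> carrier W) \<and> l' \<in> lists (carrier V \<times> carrier W)"
proof -
  interpret V: Module.module K V by fact
  interpret W: Module.module K W by fact
  show ?thesis using assms(3) by induction auto
qed

text \<open>Bilinear evaluation descends to the tensor product: each generating relation becomes a
  bilinearity identity in \<open>Z\<close>, and \<open>comm\<close> becomes commutativity of
  addition.\<close>

lemma lsum_tensor_eq:
  assumes "Module.module K V" "Module.module K W" "Module.module K Z" "bilinear_map K V W Z F"
    and "tensor_eq K V W l l'"
  shows "lsum Z F l = lsum Z F l'"
proof -
  interpret V: Module.module K V by fact
  interpret W: Module.module K W by fact
  interpret Z: Module.module K Z by fact
  have l1: "linear_map K W Z (F x)" if "x \<in> carrier V" for x
    using assms(4) that by (auto simp: bilinear_map_def)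
  have l2: "linear_map K V Z (\<lambda>x. F x y)" if "y \<in> carrier W" for y
    using assms(4) that by (auto simp: bilinear_map_def)
  have c: "F x y \<in> carrier Z" if "x \<in> carrier V" "y \<in> carrier W" for x y
    using linear_map_closed[OF l1] that by blast
  have app: "lsum Z F (k @ k') = lsum Z F k \<oplus>\<^bsub>Z\<^esub> lsum Z F k'"
    if "k \<in> lists (carrier V \<times> carrier W)" "k' \<in> lists (carrier V \<times> carrier W)" for k k'
    using that c by (intro Z.lsum_append) auto
  note lsts = tensor_eq_lists[OF assms(1,2)]
  show ?thesis using assms(5)
  proof induction
    case (append l1 l1' l2 l2')
    then show ?case using lsts[OF append.hyps(1)] lsts[OF append.hyps(2)] by (simp only: app)
  next
    case (comm l1 l2)
    then have "lsum Z F l1 \<in> carrier Z" "lsum Z F l2 \<in> carrier Z"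
      using c by (auto intro!: Z.lsum_closed)
    with comm show ?case by (simp only: app Z.M.a_comm)
  next
    case (zero y)
    then show ?case using linear_map_zero[OF assms(1,3) l2] by simp
  next
    case (balanced a x y)
    then show ?case by (simp add: linear_map_smult[OF l1] linear_map_smult[OF l2] c)
  next
    case (add_left x x' y)
    then show ?case by (simp add: linear_map_add[OF l2] Z.M.a_assoc c)
  next
    case (add_right x y y')
    then show ?case by (simp add: linear_map_add[OF l1] Z.M.a_assoc c)
  qed auto
qed

text \<open>Equivalent lists define the same predicate of being equivalent to the list, so the
  choice operator picks the same representative. This is where the relation becomes
  equality.\<close>

lemma tclass_eqI: "tensor_eq K V W l l' \<Longrightarrow> tclass K V W l = tclass K V W l'"
  unfolding tclass_def
  by (intro arg_cong[where f = Tensor] arg_cong[where f = Eps] ext)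
    (blast intro: tensor_eq.sym tensor_eq.trans)

lemma tensor_eq_summands:
  "l \<in> lists (carrier V \<times> carrier W) \<Longrightarrow> tensor_eq K V W l (summands (tclass K V W l))"
  unfolding tclass_def by (simp, rule someI, rule tensor_eq.refl)

lemma tensor_eq_map_smult:
  assumes "Module.module K V" "Module.module K W" "a \<in> carrier K" "tensor_eq K V W l l'"
  shows "tensor_eq K V W (map (\<lambda>(x, y). (a \<odot>\<^bsub>V\<^esub> x, y)) l) (map (\<lambda>(x, y). (a \<odot>\<^bsub>V\<^esub> x, y)) l')"
proof -
  interpret V: Module.module K V by fact
  interpret W: Module.module K W by fact
  have lst: "map (\<lambda>(x, y). (a \<odot>\<^bsub>V\<^esub> x, y)) k \<in> lists (carrier V \<times> carrier W)"
    if "k \<in> lists (carrier V \<times> carrier W)" for k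
    using that assms(3) by force
  show ?thesis using assms(4)
  proof induction
    case (refl l)
    then show ?case by (intro tensor_eq.refl lst)
  next
    case (append l1 l1' l2 l2')
    then show ?case by (simp add: tensor_eq.append)
  next
    case (comm l1 l2)
    then show ?case by (simp only: map_append) (intro tensor_eq.comm lst)
  next
    case (zero y)
    then show ?case using assms(3) by (simp add: tensor_eq.zero)
  next
    case (add_left x x' y)
    then show ?case using assms(3) by (simp add: V.smult_r_distr tensor_eq.add_left)
  next
    case (add_right x y y')
    then show ?case using assms(3) by (simp add: tensor_eq.add_right)
  next
    case (balanced b x y)
    \<comment> \<open>\<open>balanced\<close> moves \<open>b\<close>, which stands inside
      \<open>a\<close>; commutativity of the scalars brings it outside.\<close>
    then show ?case using assms(3)
      by (simp flip: V.smult_assoc1 add: V.R.m_comm[of a b])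
         (simp add: V.smult_assoc1 tensor_eq.balanced)
  qed (blast intro: tensor_eq.sym tensor_eq.trans)+
qed

lemma tsp_sel:
  "carrier (tsp K V W) = tclass K V W ` lists (carrier V \<times> carrier W)"
  "\<zero>\<^bsub>tsp K V W\<^esub> = tclass K V W []"
  "r \<oplus>\<^bsub>tsp K V W\<^esub> r' = tclass K V W (summands r @ summands r')"
  "a \<odot>\<^bsub>tsp K V W\<^esub> r = tclass K V W (map (\<lambda>(x, y). (a \<odot>\<^bsub>V\<^esub> x, y)) (summands r))"
  by (simp_all add: tsp_def)

lemma tclass_add:
  assumes "l \<in> lists (carrier V \<times> carrier W)" "l' \<in> lists (carrier V \<times> carrier W)"
  shows "tclass K V W l \<oplus>\<^bsub>tsp K V W\<^esub> tclass K V W l' = tclass K V W (l @ l')"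
  unfolding tsp_sel
  by (rule tclass_eqI, rule tensor_eq.append) (intro tensor_eq.sym[OF tensor_eq_summands] assms)+

lemma tclass_smult:
  assumes "Module.module K V" "Module.module K W" "a \<in> carrier K"
    "l \<in> lists (carrier V \<times> carrier W)"
  shows "a \<odot>\<^bsub>tsp K V W\<^esub> tclass K V W l = tclass K V W (map (\<lambda>(x, y). (a \<odot>\<^bsub>V\<^esub> x, y)) l)"
  unfolding tsp_sel
  by (rule tclass_eqI, rule tensor_eq_map_smult[OF assms(1-3)])
    (intro tensor_eq.sym[OF tensor_eq_summands] assms)

lemma tsp_cases:
  assumes "r \<in> carrier (tsp K V W)"
  obtains l where "l \<in> lists (carrier V \<times> carrier W)" "r = tclass K V W l"
  using assms by (auto simp: tsp_sel)

lemma summands_tsp: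
  assumes "Module.module K V" "Module.module K W" "r \<in> carrier (tsp K V W)"
  shows "summands r \<in> lists (carrier V \<times> carrier W)" "tclass K V W (summands r) = r"
  using assms tensor_eq_lists[OF assms(1,2)] tensor_eq_summands tclass_eqI
  by (metis tsp_cases)+

lemma tsp_module:
  assumes "Module.module K V" "Module.module K W"
  shows "Module.module K (tsp K V W)"
proof -
  interpret V: Module.module K V by fact
  interpret W: Module.module K W by fact
  let ?T = "tsp K V W" and ?L = "lists (carrier V \<times> carrier W)" and ?t = "tclass K V W"
  let ?m = "\<lambda>a. map (\<lambda>(x, y). (a \<odot>\<^bsub>V\<^esub> x, y))"
  note add = tclass_add[of _ V W _ K] and smul = tclass_smult[OF assms]
  have m: "?m a l \<in> ?L" if "a \<in> carrier K" "l \<in> ?L" for a l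
    using that by force
  have zero: "tensor_eq K V W (?m \<zero>\<^bsub>K\<^esub> l) []" if "l \<in> ?L" for l
    using that
  proof (induction l)
    case Nil
    then show ?case by (simp add: tensor_eq.refl)
  next
    case (Cons p l)
    obtain x y where p: "p = (x, y)" by force
    have "tensor_eq K V W ([(\<zero>\<^bsub>V\<^esub>, y)] @ ?m \<zero>\<^bsub>K\<^esub> l) ([] @ [])"
      using Cons p by (intro tensor_eq.append tensor_eq.zero) auto
    then show ?case using Cons p by simp
  qed
  have dist: "tensor_eq K V W (?m (a \<oplus>\<^bsub>K\<^esub> b) l) (?m a l @ ?m b l)"
    if "a \<in> carrier K" "b \<in> carrier K" "l \<in> ?L" for a b l
    using that(3)
  proof (induction l)
    case Nil
    then show ?case by (simp add: tensor_eq.refl)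
  next
    case (Cons p l)
    obtain x y where p: "p = (x, y)" by force
    then have xy: "x \<in> carrier V" "y \<in> carrier W" using Cons.hyps by auto
    note l = Cons.hyps(2)
    let ?a = "a \<odot>\<^bsub>V\<^esub> x" and ?b = "b \<odot>\<^bsub>V\<^esub> x"
    have "tensor_eq K V W ([((a \<oplus>\<^bsub>K\<^esub> b) \<odot>\<^bsub>V\<^esub> x, y)] @ ?m (a \<oplus>\<^bsub>K\<^esub> b) l)
        ([(?a, y), (?b, y)] @ (?m a l @ ?m b l))"
      using xy that Cons
      by (intro tensor_eq.append) (auto simp: V.smult_l_distr intro: tensor_eq.add_left)
    \<comment> \<open>The summand for \<open>b\<close> split off from the head has to move past the
      whole list \<open>?m a l\<close>, which is an instance of \<open>comm\<close>.\<close>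
    moreover have "tensor_eq K V W ([(?a, y)] @ ([(?b, y)] @ ?m a l) @ ?m b l)
        ([(?a, y)] @ (?m a l @ [(?b, y)]) @ ?m b l)"
      using xy that l m[of a l] m[of b l]
      by (intro tensor_eq.append tensor_eq.comm tensor_eq.refl) auto
    ultimately show ?case using p by (auto intro: tensor_eq.trans)
  qed
  have ag: "abelian_group ?T"
  proof (rule abelian_groupI)
    fix r assume "r \<in> carrier ?T"
    then obtain l where l: "l \<in> ?L" "r = ?t l" by (rule tsp_cases)
    show "\<zero>\<^bsub>?T\<^esub> \<oplus>\<^bsub>?T\<^esub> r = r" using l add[of "[]" l] by (simp add: tsp_sel(2))
    \<comment> \<open>Formal sums have no subtraction, so the negative scales by -1: both lists
      together are equivalent to \<open>l\<close> scaled by -1 + 1 = 0.\<close>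
    let ?l' = "?m (\<ominus>\<^bsub>K\<^esub> \<one>\<^bsub>K\<^esub>) l"
    have "map (\<lambda>(x, y). (\<one>\<^bsub>K\<^esub> \<odot>\<^bsub>V\<^esub> x, y)) l = l"
      using l by (intro map_idI) auto
    then have "tensor_eq K V W (?l' @ l) []"
      using dist[of "\<ominus>\<^bsub>K\<^esub> \<one>\<^bsub>K\<^esub>" "\<one>\<^bsub>K\<^esub>" l] zero[OF l(1)] l
      by (auto simp: V.R.l_neg intro: tensor_eq.sym tensor_eq.trans)
    then have "?t ?l' \<oplus>\<^bsub>?T\<^esub> r = \<zero>\<^bsub>?T\<^esub>"
      using l add[OF m l(1)] by (simp add: tclass_eqI tsp_sel(2))
    moreover have "?t ?l' \<in> carrier ?T" using l by (simp only: tsp_sel) (intro imageI m, simp_all)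
    ultimately show "\<exists>y\<in>carrier ?T. y \<oplus>\<^bsub>?T\<^esub> r = \<zero>\<^bsub>?T\<^esub>" by blast
    fix r' assume "r' \<in> carrier ?T"
    then obtain l' where l': "l' \<in> ?L" "r' = ?t l'" by (rule tsp_cases)
    show "r \<oplus>\<^bsub>?T\<^esub> r' \<in> carrier ?T" using l l' add[OF l(1) l'(1)]
      by (auto simp: tsp_sel(1) intro!: imageI)
    show "r \<oplus>\<^bsub>?T\<^esub> r' = r' \<oplus>\<^bsub>?T\<^esub> r" using l l'
      by (simp only: add) (intro tclass_eqI tensor_eq.comm)
    fix r'' assume "r'' \<in> carrier ?T"
    then obtain l'' where l'': "l'' \<in> ?L" "r'' = ?t l''" by (rule tsp_cases)
    show "(r \<oplus>\<^bsub>?T\<^esub> r') \<oplus>\<^bsub>?T\<^esub> r'' = r \<oplus>\<^bsub>?T\<^esub> (r' \<oplus>\<^bsub>?T\<^esub> r'')"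
      using l l' l'' by (simp only: add append_in_lists_conv append_assoc simp_thms)
  qed (auto simp: tsp_sel)
  show ?thesis
  proof (rule moduleI[OF V.R.is_cring ag])
    fix a r assume a: "a \<in> carrier K" and "r \<in> carrier ?T"
    then obtain l where l: "l \<in> ?L" "r = ?t l" by (rule_tac tsp_cases)
    show "a \<odot>\<^bsub>?T\<^esub> r \<in> carrier ?T" using l a
      by (simp only: smul tsp_sel(1)) (intro imageI m)
    fix b assume b: "b \<in> carrier K"
    show "(a \<oplus>\<^bsub>K\<^esub> b) \<odot>\<^bsub>?T\<^esub> r = a \<odot>\<^bsub>?T\<^esub> r \<oplus>\<^bsub>?T\<^esub> b \<odot>\<^bsub>?T\<^esub> r"
      using l a b by (simp only: smul add m V.R.add.m_closed) (intro tclass_eqI dist)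
    have lV: "x \<in> carrier V" if "(x, y) \<in> set l" for x y
      using l(1) that by auto
    show "(a \<otimes>\<^bsub>K\<^esub> b) \<odot>\<^bsub>?T\<^esub> r = a \<odot>\<^bsub>?T\<^esub> (b \<odot>\<^bsub>?T\<^esub> r)"
      using l a b unfolding l(2) by (simp only: smul m V.R.m_closed)
        (auto intro!: arg_cong[where f = ?t] dest!: lV simp: V.smult_assoc1)
  next
    fix a r r' assume a: "a \<in> carrier K" and "r \<in> carrier ?T" "r' \<in> carrier ?T"
    then obtain l l' where l: "l \<in> ?L" "r = ?t l" and l': "l' \<in> ?L" "r' = ?t l'"
      by (metis tsp_cases)
    show "a \<odot>\<^bsub>?T\<^esub> (r \<oplus>\<^bsub>?T\<^esub> r') = a \<odot>\<^bsub>?T\<^esub> r \<oplus>\<^bsub>?T\<^esub> a \<odot>\<^bsub>?T\<^esub> r'"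
      using a l l' by (simp only: smul add m append_in_lists_conv map_append simp_thms)
  next
    fix r assume "r \<in> carrier ?T"
    then obtain l where l: "l \<in> ?L" "r = ?t l" by (rule tsp_cases)
    have "?m \<one>\<^bsub>K\<^esub> l = l" using l by (intro map_idI) auto
    then show "\<one>\<^bsub>K\<^esub> \<odot>\<^bsub>?T\<^esub> r = r" using l by (simp only: smul V.R.one_closed)
  qed
qed

lemma tens_bilinear:
  assumes "Module.module K V" "Module.module K W"
  shows "bilinear_map K V W (tsp K V W) (tens K V W)"
proof -
  interpret V: Module.module K V by fact
  interpret W: Module.module K W by fact
  note add = tclass_add[of _ V W _ K] and smul = tclass_smult[OF assms]
  have c: "[(x, y)] \<in> lists (carrier V \<times> carrier W)" if "x \<in> carrier V" "y \<in> carrier W" for x y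
    using that by auto
  show ?thesis
    unfolding tens_def
    by (intro bilinear_mapI linear_mapI)
      (simp_all add: add smul c tclass_eqI tensor_eq.add_left tensor_eq.add_right
        tclass_eqI[OF tensor_eq.sym[OF tensor_eq.balanced]] tsp_sel(1))
qed

text \<open>Frees \<open>sw\<close> from the chosen representative: any list of the class may be
  summed instead.\<close>

lemma sw_tclass:
  assumes "Module.module K V" "Module.module K W" "Module.module K Z" "bilinear_map K V W Z F"
    and "l \<in> lists (carrier V \<times> carrier W)"
  shows "sw Z (tclass K V W l) F = lsum Z F l"
  unfolding sw_lsum using lsum_tensor_eq[OF assms(1-4) tensor_eq_summands[OF assms(5)]] by simp

text \<open>Serves as premise for the summands in congruence and closure rules, so that the calculus
  below need not mention the representing list.\<close>

definition sw_mem :: "('k, 'a) univ \<Rightarrow> ('k, 'a) univ \<Rightarrow> ('k, 'a) univ \<Rightarrow> bool" where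
  "sw_mem r x y \<longleftrightarrow> (x, y) \<in> set (summands r)"

lemma sw_memD:
  assumes "Module.module K V" "Module.module K W" "r \<in> carrier (tsp K V W)" "sw_mem r x y"
  shows "x \<in> carrier V" "y \<in> carrier W"
  using summands_tsp(1)[OF assms(1-3)] assms(4) by (auto simp: sw_mem_def)

lemma sw_closed:
  assumes "Module.module K Z" "\<And>x y. sw_mem r x y \<Longrightarrow> F x y \<in> carrier Z"
  shows "sw Z r F \<in> carrier Z"
  unfolding sw_lsum using assms by (simp add: module.lsum_closed sw_mem_def)

lemma sw_cong:
  assumes "r = r'" "\<And>x y. sw_mem r' x y \<Longrightarrow> F x y = G x y"
  shows "sw Z r F = sw Z r' G"
  unfolding sw_lsum using assms by (intro lsum_cong) (auto simp: sw_mem_def)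

lemma sw_tens:
  assumes "Module.module K V" "Module.module K W" "Module.module K Z" "bilinear_map K V W Z F"
    and "x \<in> carrier V" "y \<in> carrier W"
  shows "sw Z (tens K V W x y) F = F x y"
proof -
  interpret Z: Module.module K Z by fact
  have "F x y \<in> carrier Z"
    using assms(4-6) by (auto simp: bilinear_map_def dest: linear_map_closed)
  then show ?thesis unfolding tens_def using sw_tclass[OF assms(1-4), of "[(x, y)]"] assms(5,6) by simp
qed

lemma linear_sw:
  assumes "Module.module K Z" "Module.module K Z'" "linear_map K Z Z' f"
    and "\<And>x y. sw_mem r x y \<Longrightarrow> F x y \<in> carrier Z"
  shows "f (sw Z r F) = sw Z' r (\<lambda>x y. f (F x y))"
  unfolding sw_lsum using assms by (intro lsum_linear(2)[OF assms(1-3)]) (auto simp: sw_mem_def)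

lemma sw_swap:
  assumes "Module.module K Z"
    and "\<And>x y z w. sw_mem r x y \<Longrightarrow> sw_mem r' z w \<Longrightarrow> F x y z w \<in> carrier Z"
  shows "sw Z r (\<lambda>x y. sw Z r' (F x y)) = sw Z r' (\<lambda>z w. sw Z r (\<lambda>x y. F x y z w))"
  unfolding sw_lsum using assms by (intro module.lsum_swap[OF assms(1)]) (auto simp: sw_mem_def)

lemma sw_linear_param:
  assumes "Module.module K U" "Module.module K Z"
    and "\<And>a b. sw_mem r a b \<Longrightarrow> linear_map K U Z (\<lambda>x. F x a b)"
  shows "linear_map K U Z (\<lambda>x. sw Z r (F x))"
  unfolding sw_lsum using assms by (intro linear_map_lsum) (auto simp: sw_mem_def)

text \<open>Existence in the universal property of the tensor product. Linearity here is in the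
  tensor; \<open>sw_linear_param\<close> is linearity in a parameter of the summand while the tensor
  is fixed.\<close>

lemma sw_linear:
  assumes "Module.module K V" "Module.module K W" "Module.module K Z" "bilinear_map K V W Z F"
  shows "linear_map K (tsp K V W) Z (\<lambda>r. sw Z r F)"
proof -
  interpret V: Module.module K V by fact
  interpret Z: Module.module K Z by fact
  note s = sw_tclass[OF assms] and add = tclass_add[of _ V W _ K]
    and smul = tclass_smult[OF assms(1,2)]
  have l2: "linear_map K V Z (\<lambda>x. F x y)" if "y \<in> carrier W" for y
    using assms(4) that by (auto simp: bilinear_map_def)
  have c: "F x y \<in> carrier Z" if "x \<in> carrier V" "y \<in> carrier W" for x y
    using linear_map_closed[OF l2] that by blast
  have sm: "lsum Z F (map (\<lambda>(x, y). (a \<odot>\<^bsub>V\<^esub> x, y)) l) = a \<odot>\<^bsub>Z\<^esub> lsum Z F l"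
    if "a \<in> carrier K" "l \<in> lists (carrier V \<times> carrier W)" for a l
  proof -
    have "lsum Z F (map (\<lambda>(x, y). (a \<odot>\<^bsub>V\<^esub> x, y)) l) = lsum Z (\<lambda>x y. a \<odot>\<^bsub>Z\<^esub> F x y) l"
      using that by (induction l) (auto simp: linear_map_smult[OF l2])
    then show ?thesis using Z.lsum_smult[OF that(1), of l F] that(2) c by force
  qed
  show ?thesis
  proof (rule linear_mapI)
    fix r assume r: "r \<in> carrier (tsp K V W)"
    then show "sw Z r F \<in> carrier Z"
      using sw_closed[OF assms(3)] sw_memD[OF assms(1,2)] c by metis
    from r obtain l where l: "l \<in> lists (carrier V \<times> carrier W)" "r = tclass K V W l" by (rule tsp_cases)
    fix r' assume "r' \<in> carrier (tsp K V W)"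
    then obtain l' where l': "l' \<in> lists (carrier V \<times> carrier W)" "r' = tclass K V W l'" by (rule tsp_cases)
    have ll: "l @ l' \<in> lists (carrier V \<times> carrier W)" using l l' by simp
    show "sw Z (r \<oplus>\<^bsub>tsp K V W\<^esub> r') F = sw Z r F \<oplus>\<^bsub>Z\<^esub> sw Z r' F"
      
      unfolding l(2) l'(2) add[OF l(1) l'(1)] s[OF l(1)] s[OF l'(1)] s[OF ll]
      using l l' c by (intro Z.lsum_append) auto
  next
    fix a r assume a: "a \<in> carrier K" and "r \<in> carrier (tsp K V W)"
    then obtain l where l: "l \<in> lists (carrier V \<times> carrier W)" "r = tclass K V W l" by (rule_tac tsp_cases)
    have "map (\<lambda>(x, y). (a \<odot>\<^bsub>V\<^esub> x, y)) l \<in> lists (carrier V \<times> carrier W)" using a l by force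
    then show "sw Z (a \<odot>\<^bsub>tsp K V W\<^esub> r) F = a \<odot>\<^bsub>Z\<^esub> sw Z r F"
      using l a sm by (simp only: smul s)
  qed
qed

lemma sw_tens_id:
  assumes "Module.module K V" "Module.module K W" "r \<in> carrier (tsp K V W)"
  shows "sw (tsp K V W) r (tens K V W) = r"
proof -
  interpret V: Module.module K V by fact
  have *: "lsum (tsp K V W) (tens K V W) l = tclass K V W l" if "l \<in> lists (carrier V \<times> carrier W)" for l
    using that
  proof (induction l)
    case Nil
    then show ?case by (simp add: tsp_sel)
  next
    case (Cons p l)
    obtain x y where "p = (x, y)" by force
    then show ?case using Cons tclass_add[of "[(x, y)]" V W l K] by (simp add: tens_def)
  qed
  show ?thesis unfolding sw_lsum using *[OF summands_tsp(1)[OF assms]] summands_tsp(2)[OF assms] by simp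
qed

text \<open>Uniqueness in the universal property: every tensor is the Sweedler sum of its own pure
  tensors (\<open>sw_tens_id\<close>), and a linear map passes through that sum.\<close>

lemma tsp_ext:
  assumes "Module.module K V" "Module.module K W" "Module.module K Z"
    and "linear_map K (tsp K V W) Z f" "linear_map K (tsp K V W) Z g"
    and "\<And>x y. x \<in> carrier V \<Longrightarrow> y \<in> carrier W \<Longrightarrow> f (tens K V W x y) = g (tens K V W x y)"
    and "r \<in> carrier (tsp K V W)"
  shows "f r = g r"
proof -
  note T = tsp_module[OF assms(1,2)]
  have t: "tens K V W x y \<in> carrier (tsp K V W)" if "x \<in> carrier V" "y \<in> carrier W" for x y
    using that by (auto simp: tens_def tsp_sel)
  have m: "tens K V W x y \<in> carrier (tsp K V W)" "f (tens K V W x y) = g (tens K V W x y)"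
    if "sw_mem r x y" for x y
    using sw_memD[OF assms(1,2,7) that] t assms(6) by auto
  have "f r = sw Z r (\<lambda>x y. f (tens K V W x y))"
    using linear_sw[OF T assms(3,4), where F = "tens K V W"] m
    by (metis sw_tens_id[OF assms(1,2,7)])
  also have "\<dots> = sw Z r (\<lambda>x y. g (tens K V W x y))"
    by (rule sw_cong) (auto simp: m)
  also have "\<dots> = g r"
    using linear_sw[OF T assms(3,5), where F = "tens K V W"] m
    by (metis sw_tens_id[OF assms(1,2,7)])
  finally show ?thesis .
qed

lemma tens_closed:
  "x \<in> carrier V \<Longrightarrow> y \<in> carrier W \<Longrightarrow> tens K V W x y \<in> carrier (tsp K V W)"
  by (auto simp: tens_def tsp_sel)

text \<open>Meant as an introduction rule: below the bounded quantifier, matching recovers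
  \<open>f\<close> and \<open>g\<close> from the two sides as functions of the tensor.\<close>

lemma tsp_eqI:
  assumes "linear_map K (tsp K V W) Z f" "linear_map K (tsp K V W) Z g"
    and "Module.module K V" "Module.module K W" "Module.module K Z"
    and "\<And>x y. x \<in> carrier V \<Longrightarrow> y \<in> carrier W \<Longrightarrow> f (tens K V W x y) = g (tens K V W x y)"
  shows "\<forall>r\<in>carrier (tsp K V W). f r = g r"
  using tsp_ext[OF assms(3-5,1,2,6)] by blast

lemma linear_map_tens:
  assumes "Module.module K V" "Module.module K W"
  shows "linear_map K U V e \<Longrightarrow> y \<in> carrier W \<Longrightarrow> linear_map K U (tsp K V W) (\<lambda>x. tens K V W (e x) y)"
    and "linear_map K U W e' \<Longrightarrow> z \<in> carrier V \<Longrightarrow> linear_map K U (tsp K V W) (\<lambda>x. tens K V W z (e' x))"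
  using tens_bilinear[OF assms] unfolding bilinear_map_def
  by (auto intro: linear_map_comp[of K V _ "\<lambda>x. tens K V W x y"] linear_map_comp[of K W _ "tens K V W z"])

lemma tsp_eqI_left:
  assumes l: "linear_map K (tsp K (tsp K U V) W) Z f" "linear_map K (tsp K (tsp K U V) W) Z g"
    and m: "Module.module K U" "Module.module K V" "Module.module K W" "Module.module K Z"
    and e: "\<And>x y z. \<lbrakk>x \<in> carrier U; y \<in> carrier V; z \<in> carrier W\<rbrakk>
      \<Longrightarrow> f (tens K (tsp K U V) W (tens K U V x y) z) = g (tens K (tsp K U V) W (tens K U V x y) z)"
  shows "\<forall>r\<in>carrier (tsp K (tsp K U V) W). f r = g r"
proof (rule tsp_eqI[OF l])
  fix r z assume "r \<in> carrier (tsp K U V)" and z: "z \<in> carrier W"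
  \<comment> \<open>With the last factor fixed, both maps are linear on the inner tensor product,
    where extensionality applies again.\<close>
  moreover have "linear_map K (tsp K U V) (tsp K (tsp K U V) W) (\<lambda>r. tens K (tsp K U V) W r z)"
    by (intro linear_map_tens tsp_module m z linear_map_ident)
  then have "\<forall>r\<in>carrier (tsp K U V). f (tens K (tsp K U V) W r z) = g (tens K (tsp K U V) W r z)"
    by (intro tsp_eqI[of _ _ _ Z] m e z) (auto intro: linear_map_comp l)
  ultimately show "f (tens K (tsp K U V) W r z) = g (tens K (tsp K U V) W r z)" by blast
qed (auto intro: m tsp_module)

lemma tsp_eqI_right:
  assumes l: "linear_map K (tsp K U (tsp K V W)) Z f" "linear_map K (tsp K U (tsp K V W)) Z g"
    and m: "Module.module K U" "Module.module K V" "Module.module K W" "Module.module K Z"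
    and e: "\<And>x y z. \<lbrakk>x \<in> carrier U; y \<in> carrier V; z \<in> carrier W\<rbrakk>
      \<Longrightarrow> f (tens K U (tsp K V W) x (tens K V W y z)) = g (tens K U (tsp K V W) x (tens K V W y z))"
  shows "\<forall>r\<in>carrier (tsp K U (tsp K V W)). f r = g r"
proof (rule tsp_eqI[OF l])
  fix x r assume x: "x \<in> carrier U" and "r \<in> carrier (tsp K V W)"
  moreover have "linear_map K (tsp K V W) (tsp K U (tsp K V W)) (\<lambda>r. tens K U (tsp K V W) x r)"
    by (intro linear_map_tens tsp_module m x linear_map_ident)
  then have "\<forall>r\<in>carrier (tsp K V W). f (tens K U (tsp K V W) x r) = g (tens K U (tsp K V W) x r)"
    by (intro tsp_eqI[of _ _ _ Z] m e x) (auto intro: linear_map_comp l)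
  ultimately show "f (tens K U (tsp K V W) x r) = g (tens K U (tsp K V W) x r)" by blast
qed (auto intro: m tsp_module)

section \<open>Integer powers of automorphisms\<close>

lemma zpow_0 [simp]: "zpow A f 0 = id"
  by (simp add: zpow_def)

lemma zpow_1: "zpow A f 1 = f"
  by (simp add: zpow_def)

lemma zpow_closed:
  assumes "bij_betw f A A" "x \<in> A"
  shows "zpow A f i x \<in> A"
proof -
  have "(f ^^ k) x \<in> A" for k
    using assms by (induction k) (auto simp: bij_betw_apply)
  moreover have "(inv_into A f ^^ k) x \<in> A" for k
    using assms bij_betw_apply[OF bij_betw_inv_into[OF assms(1)]] by (induction k) auto
  ultimately show ?thesis by (simp add: zpow_def)
qed

lemma zpow_succ:
  assumes "bij_betw f A A" "x \<in> A"
  shows "zpow A f (i + 1) x = f (zpow A f i x)"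
proof (cases "i \<ge> 0")
  case True
  then show ?thesis by (simp add: zpow_def nat_add_distrib)
next
  case False
  \<comment> \<open>For negative exponents the power of the inverse gets shorter, so one inverse is
    peeled off and later cancelled by \<open>f\<close>. The case \<open>i = -1\<close> is separate
    because there the branch of \<open>zpow\<close> changes.\<close>
  then have "nat (- i) = Suc (nat (- (i + 1)))" by simp
  then have "zpow A f i x = inv_into A f (zpow A f (i + 1) x)"
    using False by (cases "i = -1") (simp_all add: zpow_def)
  then show ?thesis
    using zpow_closed[OF assms] assms(1) by (simp add: bij_betw_inv_into_right)
qed

lemma zpow_pred:
  assumes "bij_betw f A A" "x \<in> A"
  shows "zpow A f (i - 1) x = inv_into A f (zpow A f i x)"
  using zpow_succ[OF assms, of "i - 1"] zpow_closed[OF assms, of "i - 1"] assms(1)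
  by (simp add: bij_betw_inv_into_left)

text \<open>Stated for a binary \<open>F\<close> so that one induction serves products and actions
  and, with an argument ignored, also unary maps, the counit and the commutation of automorphisms.
  The downward step cancels one \<open>h\<close> by its inverse.\<close>

lemma zpow_transfer:
  assumes "bij_betw f A A" "bij_betw g B B" "bij_betw h C C"
    and F: "\<And>a b. a \<in> A \<Longrightarrow> b \<in> B \<Longrightarrow> F a b \<in> C"
      "\<And>a b. a \<in> A \<Longrightarrow> b \<in> B \<Longrightarrow> h (F a b) = F (f a) (g b)"
    and ab: "a \<in> A" "b \<in> B"
  shows "zpow C h i (F a b) = F (zpow A f i a) (zpow B g i b)"
proof (induction i rule: int_induct[of _ 0])
  case (step1 i)
  then show ?case using ab by (simp add: zpow_succ[OF assms(1)] zpow_succ[OF assms(2)]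
      zpow_succ[OF assms(3)] zpow_closed[OF assms(1)] zpow_closed[OF assms(2)] F)
next
  case (step2 i)
  let ?a = "zpow A f (i - 1) a" and ?b = "zpow B g (i - 1) b"
  have c: "?a \<in> A" "?b \<in> B" using ab assms(1,2) by (auto intro: zpow_closed)
  have "zpow C h (i - 1) (F a b) = inv_into C h (F (zpow A f i a) (zpow B g i b))"
    using step2 ab by (simp add: zpow_pred[OF assms(3)] F)
  also have "F (zpow A f i a) (zpow B g i b) = h (F ?a ?b)"
    using zpow_succ[OF assms(1), of a "i - 1"] zpow_succ[OF assms(2), of b "i - 1"] ab c F by simp
  also have "inv_into C h (h (F ?a ?b)) = F ?a ?b"
    using c F(1) assms(3) by (intro bij_betw_inv_into_left)
  finally show ?case .
qed simp

lemma zpow_add: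
  assumes "bij_betw f A A" "x \<in> A"
  shows "zpow A f (i + j) x = zpow A f i (zpow A f j x)"
proof (induction i rule: int_induct[of _ 0])
  case (step1 i)
  have "zpow A f (i + 1 + j) x = zpow A f (i + j + 1) x" by (simp add: algebra_simps)
  then show ?case using assms step1 by (simp add: zpow_succ zpow_closed)
next
  case (step2 i)
  have "zpow A f (i - 1 + j) x = zpow A f (i + j - 1) x" by (simp add: algebra_simps)
  then show ?case using assms step2 by (simp add: zpow_pred zpow_closed)
qed simp

lemma zpow_commute:
  assumes "bij_betw f A A" "bij_betw g A A" "commute_on A f g" "x \<in> A"
  shows "zpow A f i (zpow A g j x) = zpow A g j (zpow A f i x)"
proof -
  have 1: "zpow A f i (g y) = g (zpow A f i y)" if "y \<in> A" for y
    using zpow_transfer[where F = "\<lambda>a b. g a", OF assms(1,1,1)] assms bij_betw_apply that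
    unfolding commute_on_def by metis
  show ?thesis
    using zpow_transfer[where F = "\<lambda>a b. zpow A f i a", OF assms(2,2,2)] assms zpow_closed 1
    by metis
qed

lemma zpow_id: "x \<in> A \<Longrightarrow> zpow A id i x = x"
proof -
  assume x: "x \<in> A"
  have "(id ^^ k) x = x" for k by (induction k) auto
  moreover have "(inv_into A id ^^ k) x = x" for k
    using x inv_into_f_f[of id A x] by (induction k) auto
  ultimately show ?thesis by (simp add: zpow_def)
qed

lemma linear_aut_inv:
  assumes "Module.module K V" "linear_aut K V f"
  shows "linear_map K V V (inv_into (carrier V) f)"
proof -
  interpret V: Module.module K V by fact
  have b: "bij_betw f (carrier V) (carrier V)" and l: "linear_map K V V f"
    using assms(2) by (auto simp: linear_aut_def)
  let ?g = "inv_into (carrier V) f"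
  have g: "x \<in> carrier V \<Longrightarrow> ?g x \<in> carrier V" for x
    using b bij_betw_apply bij_betw_inv_into by metis
  have r: "x \<in> carrier V \<Longrightarrow> f (?g x) = x" "x \<in> carrier V \<Longrightarrow> ?g (f x) = x" for x
    using b by (auto simp: bij_betw_inv_into_right bij_betw_inv_into_left)
  show ?thesis
  proof (rule linear_mapI)
    fix x y assume "x \<in> carrier V" "y \<in> carrier V"
    then show "?g (x \<oplus>\<^bsub>V\<^esub> y) = ?g x \<oplus>\<^bsub>V\<^esub> ?g y"
      using r(2)[of "?g x \<oplus>\<^bsub>V\<^esub> ?g y"] by (simp add: linear_map_add[OF l] g r(1))
  next
    fix a x assume "a \<in> carrier K" "x \<in> carrier V"
    then show "?g (a \<odot>\<^bsub>V\<^esub> x) = a \<odot>\<^bsub>V\<^esub> ?g x"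
      using r(2)[of "a \<odot>\<^bsub>V\<^esub> ?g x"] by (simp add: linear_map_smult[OF l] g r(1))
  qed (fact g)
qed

lemma linear_map_zpow:
  assumes "Module.module K V" "linear_aut K V f"
  shows "linear_map K V V (zpow (carrier V) f i)"
proof -
  have *: "linear_map K V V (g ^^ k)" if "linear_map K V V g" for g k
  proof (induction k)
    case 0
    then show ?case using linear_map_ident by (simp add: id_def)
  next
    case (Suc k)
    then show ?case using linear_map_comp[OF that Suc] by (simp add: comp_def)
  qed
  have f: "linear_map K V V f" using assms(2) by (simp add: linear_aut_def)
  show ?thesis
    unfolding zpow_def using *[OF linear_aut_inv[OF assms]] *[OF f] by (simp only: if_split simp_thms)
qed

lemma commuting_autsD:
  assumes "commuting_auts K M" "\<theta> \<in> {alpha M, beta M, omega M, psi M}"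
  shows "linear_aut K M \<theta>" "bij_betw \<theta> (carrier M) (carrier M)"
    "\<eta> \<in> {alpha M, beta M, omega M, psi M} \<Longrightarrow> commute_on (carrier M) \<theta> \<eta>"
  using bspec[OF assms(1)[unfolded commuting_auts_def] assms(2)] by (simp_all add: linear_aut_def) blast

lemma aut_closed: "commuting_auts K M \<Longrightarrow> x \<in> carrier M \<Longrightarrow> aut M i j k l x \<in> carrier M"
  by (simp add: aut_def zpow_closed commuting_autsD)

lemma linear_map_aut:
  assumes "Module.module K M" "commuting_auts K M" "linear_map K V M e"
  shows "linear_map K V M (\<lambda>x. aut M i j k l (e x))"
proof -
  have z: "linear_map K M M (zpow (carrier M) f i)" if "f \<in> {alpha M, beta M, omega M, psi M}" for f i
    using that assms(2) by (intro linear_map_zpow[OF assms(1)] commuting_autsD(1))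
  show ?thesis
    unfolding aut_def o_def
    by (rule linear_map_comp[OF z linear_map_comp[OF z linear_map_comp[OF z linear_map_comp[OF z assms(3)]]]])
      simp_all
qed

lemma aut_aut:
  assumes "commuting_auts K M" "x \<in> carrier M"
  shows "aut M i j k l (aut M i' j' k' l' x) = aut M (i + i') (j + j') (k + k') (l + l') x"
proof -
  let ?S = "{alpha M, beta M, omega M, psi M}" and ?z = "zpow (carrier M)"
  note cl = zpow_closed[OF commuting_autsD(2)[OF assms(1)]]
  have comm: "?z f i (?z g j x) = ?z g j (?z f i x)" if "f \<in> ?S" "g \<in> ?S" "x \<in> carrier M" for f g i j x
    using that commuting_autsD[OF assms(1)] by (intro zpow_commute) auto
  note add = zpow_add[OF commuting_autsD(2)[OF assms(1)]]
  show ?thesis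
    using assms(2)
    by (simp add: aut_def add cl comm[of "psi M" "alpha M"] comm[of "psi M" "beta M"]
        comm[of "psi M" "omega M"] comm[of "omega M" "alpha M"] comm[of "omega M" "beta M"]
        comm[of "beta M" "alpha M"])
qed

lemma aut_0 [simp]: "aut M 0 0 0 0 x = x"
  by (simp add: aut_def)

text \<open>Makes a single automorphism an instance of a composite. Once this is a rewrite rule,
  \<open>aut_aut\<close> collects all twists into integer exponents; it is switched off where an
  axiom has to be quoted in its original form.\<close>

lemma struct_aut:
  "alpha M = aut M 1 0 0 0" "beta M = aut M 0 1 0 0"
  "omega M = aut M 0 0 1 0" "psi M = aut M 0 0 0 1"
  by (simp_all add: aut_def zpow_1)

lemma aut_transfer:
  assumes "commuting_auts K A" "commuting_auts K B" "commuting_auts K C"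
    and "\<And>a b. a \<in> carrier A \<Longrightarrow> b \<in> carrier B \<Longrightarrow> F a b \<in> carrier C"
    and "\<And>a b. \<lbrakk>a \<in> carrier A; b \<in> carrier B\<rbrakk> \<Longrightarrow> alpha C (F a b) = F (alpha A a) (alpha B b)"
      "\<And>a b. \<lbrakk>a \<in> carrier A; b \<in> carrier B\<rbrakk> \<Longrightarrow> beta C (F a b) = F (beta A a) (beta B b)"
      "\<And>a b. \<lbrakk>a \<in> carrier A; b \<in> carrier B\<rbrakk> \<Longrightarrow> omega C (F a b) = F (omega A a) (omega B b)"
      "\<And>a b. \<lbrakk>a \<in> carrier A; b \<in> carrier B\<rbrakk> \<Longrightarrow> psi C (F a b) = F (psi A a) (psi B b)"
    and "a \<in> carrier A" "b \<in> carrier B"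
  shows "aut C i j k l (F a b) = F (aut A i j k l a) (aut B i j k l b)"
proof -
  note bA = commuting_autsD(2)[OF assms(1)] and bB = commuting_autsD(2)[OF assms(2)]
    and bC = commuting_autsD(2)[OF assms(3)]
  have z: "zpow (carrier C) h i (F a b) = F (zpow (carrier A) f i a) (zpow (carrier B) g i b)"
    if "f \<in> {alpha A, beta A, omega A, psi A}" "g \<in> {alpha B, beta B, omega B, psi B}"
      "h \<in> {alpha C, beta C, omega C, psi C}" "a \<in> carrier A" "b \<in> carrier B"
      "\<And>a b. \<lbrakk>a \<in> carrier A; b \<in> carrier B\<rbrakk> \<Longrightarrow> h (F a b) = F (f a) (g b)"
    for f g h i a b
    using that assms(4) by (intro zpow_transfer bA bB bC)
  show ?thesis
    using assms(9,10)
    by (simp add: aut_def z[of "alpha A" "alpha B" "alpha C"] z[of "beta A" "beta B" "beta C"]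
        z[of "omega A" "omega B" "omega C"] z[of "psi A" "psi B" "psi C"]
        assms(5-8) zpow_closed bA bB)
qed


section \<open>Spaces with the same underlying vector space\<close>

text \<open>\<open>ydl_tensor\<close> and \<open>tsp\<close> are records of different types carrying
  the same vector space. The relation isolates the fields on which tensors, Sweedler sums and
  linearity depend.\<close>

definition same_space ::
  "('k, 'v, 'd) module_scheme \<Rightarrow> ('k, 'v, 'e) module_scheme \<Rightarrow> bool" where
  "same_space V V' \<longleftrightarrow> carrier V = carrier V' \<and> \<zero>\<^bsub>V\<^esub> = \<zero>\<^bsub>V'\<^esub> \<and> add V = add V' \<and> smult V = smult V'"

lemma same_space_refl: "same_space V V"
  by (simp add: same_space_def)

lemma same_space_sym: "same_space V V' \<Longrightarrow> same_space V' V"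
  by (simp add: same_space_def)

lemma tensor_eq_same1:
  assumes "same_space V V'" "same_space W W'" "tensor_eq K V W l l'"
  shows "tensor_eq K V' W' l l'"
  using assms(3)
proof induction
  case (trans l l' l'')
  then show ?case by (blast intro: tensor_eq.trans)
next
  case (sym l l')
  then show ?case by (blast intro: tensor_eq.sym)
next
  case (comm l\<^sub>1 l\<^sub>2)
  then show ?case using assms(1,2) by (intro tensor_eq.comm) (auto simp: same_space_def)
qed (use assms(1,2) in \<open>auto simp: same_space_def intro: tensor_eq.refl tensor_eq.append
    tensor_eq.zero tensor_eq.add_left tensor_eq.add_right tensor_eq.balanced\<close>)

lemma
  assumes "same_space V V'" "same_space W W'"
  shows tensor_eq_same: "tensor_eq K V W = tensor_eq K V' W'"
    and tclass_same: "tclass K V W = tclass K V' W'"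
    and tens_same: "tens K V W = tens K V' W'"
    and tsp_same: "tsp K V W = tsp K V' W'"
proof -
  show "tensor_eq K V W = tensor_eq K V' W'"
    using tensor_eq_same1[OF assms] tensor_eq_same1[OF assms[THEN same_space_sym]]
    by (intro ext) blast
  then show "tclass K V W = tclass K V' W'" by (simp add: tclass_def fun_eq_iff)
  then show "tens K V W = tens K V' W'" "tsp K V W = tsp K V' W'"
    using assms by (auto simp: tens_def tsp_def fun_eq_iff same_space_def)
qed

lemma linear_map_same:
  "\<lbrakk>same_space V V'; same_space W W'\<rbrakk> \<Longrightarrow> linear_map K V W = linear_map K V' W'"
  by (auto simp: linear_map_def same_space_def fun_eq_iff)

lemma sw_same: "same_space Z Z' \<Longrightarrow> sw Z = sw Z'"
  by (simp add: sw_def fun_eq_iff same_space_def)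

lemma module_same1:
  assumes "Module.module K V" "same_space V V'"
  shows "Module.module K V'"
proof -
  interpret V: Module.module K V by fact
  have s: "carrier V' = carrier V" "\<zero>\<^bsub>V'\<^esub> = \<zero>\<^bsub>V\<^esub>" "add V' = add V" "smult V' = smult V"
    using assms(2) by (simp_all add: same_space_def)
  have ag: "abelian_group V'"
    by (rule abelian_groupI)
      (auto simp: s V.M.a_ac intro: V.M.l_neg bexI[of _ "\<ominus>\<^bsub>V\<^esub> _"])
  show ?thesis
    by (intro moduleI V.R.is_cring ag)
      (simp_all add: s V.smult_l_distr V.smult_r_distr V.smult_assoc1)
qed

lemma module_same: "same_space V V' \<Longrightarrow> Module.module K V \<longleftrightarrow> Module.module K V'"
  using module_same1[of K V V'] module_same1[of K V' V] same_space_sym[of V V'] by blast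

lemma same_space_tensor: "same_space (ydl_tensor K H M N) (tsp K M N)"
  by (simp add: same_space_def ydl_tensor_def Let_def)

lemma same_space_unit: "same_space (ydl_unit K H) (scalar_space K)"
  by (simp add: same_space_def ydl_unit_def Let_def)

text \<open>Oriented so that spaces become \<open>tsp\<close> and the generic rules apply;
  \<open>ydl_tensor\<close> is kept where its automorphisms, actions or coactions are read.\<close>

lemmas tensor_same [simp] =
  tens_same[OF same_space_tensor same_space_refl] tens_same[OF same_space_refl same_space_tensor]
  tsp_same[OF same_space_tensor same_space_refl] tsp_same[OF same_space_refl same_space_tensor]
  linear_map_same[OF same_space_tensor same_space_refl]
  linear_map_same[OF same_space_refl same_space_tensor]
  sw_same[OF same_space_tensor] module_same[OF same_space_tensor]

lemmas unit_same [simp] =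
  tens_same[OF same_space_unit same_space_refl] tens_same[OF same_space_refl same_space_unit]
  tsp_same[OF same_space_unit same_space_refl] tsp_same[OF same_space_refl same_space_unit]
  linear_map_same[OF same_space_unit same_space_refl]
  linear_map_same[OF same_space_refl same_space_unit]
  sw_same[OF same_space_unit] module_same[OF same_space_unit]

lemma carrier_ydl_tensor [simp]: "carrier (ydl_tensor K H M N) = carrier (tsp K M N)"
  by (simp add: ydl_tensor_def Let_def)

lemma carrier_ydl_unit [simp]: "carrier (ydl_unit K H) = carrier (scalar_space K)"
  by (simp add: ydl_unit_def Let_def)

section \<open>Sweedler calculus\<close>

text \<open>
  \<open>sw_elem\<close> is a copy of \<open>sw_mem\<close>, so that \<open>sw_mem_iff\<close> does not loop as a rewrite rule. The premises
  \<open>mem_info V x\<close> make the simplifier derive, for an element of a tensor product, that its summands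
  consist of elements of the factors; the arrow \<open>=simp=>\<close> makes it simplify these premises first.
\<close>

definition sw_elem :: "('k, 'a) univ \<Rightarrow> ('k, 'a) univ \<Rightarrow> ('k, 'a) univ \<Rightarrow> bool" where
  "sw_elem = sw_mem"

lemma sw_mem_iff:
  assumes "Module.module K V" "Module.module K W" "r \<in> carrier (tsp K V W)"
  shows "sw_mem r x y \<longleftrightarrow> x \<in> carrier V \<and> y \<in> carrier W \<and> sw_elem r x y"
  using sw_memD[OF assms] by (auto simp: sw_elem_def)

definition mem_info :: "('k, 'v, 'd) module_scheme \<Rightarrow> 'v \<Rightarrow> bool" where
  "mem_info V x \<longleftrightarrow> x \<in> carrier V"

lemma mem_info_tsp [simp]:
  assumes "Module.module K V" "Module.module K W"
  shows "mem_info (tsp K V W) r \<longleftrightarrow> r \<in> carrier (tsp K V W) \<and> (\<forall>x y. sw_mem r x y \<longrightarrow>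
    x \<in> carrier V \<and> y \<in> carrier W \<and> mem_info V x \<and> mem_info W y)"
  using sw_memD[OF assms] by (auto simp: mem_info_def)

text \<open>Bilinearity is split into one linearity condition per variable, since linearity of an
  expression in one variable can be proved by structural rewrite rules.\<close>

lemma sw_tens_simp:
  assumes "Module.module K V" "Module.module K W" "Module.module K Z"
    and "x \<in> carrier V" "y \<in> carrier W"
    and "\<And>x. x \<in> carrier V =simp=> mem_info V x =simp=> linear_map K W Z (F x)"
    and "\<And>y. y \<in> carrier W =simp=> mem_info W y =simp=> linear_map K V Z (\<lambda>x. F x y)"
  shows "sw Z (tens K V W x y) F = F x y"
  by (rule sw_tens) (use assms in \<open>auto intro: bilinear_mapI simp: mem_info_def simp_implies_def\<close>)

text \<open>Substitution of one Sweedler sum into another. Together with \<open>sw_tens_simp\<close>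
  it removes intermediate tensors and leaves nested sums.\<close>

lemma sw_sw:
  assumes "Module.module K V" "Module.module K W" "Module.module K Z"
    and "\<And>x y. sw_mem r x y =simp=> G x y \<in> carrier (tsp K V W)"
    and "\<And>x. x \<in> carrier V =simp=> mem_info V x =simp=> linear_map K W Z (F x)"
    and "\<And>y. y \<in> carrier W =simp=> mem_info W y =simp=> linear_map K V Z (\<lambda>x. F x y)"
  shows "sw Z (sw (tsp K V W) r G) F = sw Z r (\<lambda>x y. sw Z (G x y) F)"
  using assms unfolding simp_implies_def by (intro linear_sw[of K "tsp K V W" Z "\<lambda>r. sw Z r F"] sw_linear[of K V W] tsp_module
      bilinear_mapI) (simp_all add: mem_info_def)

lemma linear_map_sw:
  assumes "linear_map K U (tsp K V W) e" "Module.module K V" "Module.module K W" "Module.module K Z"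
    and "\<And>x. \<lbrakk>x \<in> carrier V; mem_info V x\<rbrakk> \<Longrightarrow> linear_map K W Z (F x)"
    and "\<And>y. \<lbrakk>y \<in> carrier W; mem_info W y\<rbrakk> \<Longrightarrow> linear_map K V Z (\<lambda>x. F x y)"
  shows "linear_map K U Z (\<lambda>x. sw Z (e x) F)"
  by (rule linear_map_comp[OF sw_linear[OF assms(2-4) bilinear_mapI[OF assms(5,6)]] assms(1)])
    (simp_all add: mem_info_def)

lemma tens_sw:
  assumes "Module.module K V" "Module.module K W"
  shows "\<lbrakk>v \<in> carrier V; \<And>x y. sw_mem r x y =simp=> F x y \<in> carrier W\<rbrakk>
      \<Longrightarrow> tens K V W v (sw W r F) = sw (tsp K V W) r (\<lambda>x y. tens K V W v (F x y))"
    and "\<lbrakk>w \<in> carrier W; \<And>x y. sw_mem r x y =simp=> G x y \<in> carrier V\<rbrakk>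
      \<Longrightarrow> tens K V W (sw V r G) w = sw (tsp K V W) r (\<lambda>x y. tens K V W (G x y) w)"
  using tens_bilinear[OF assms] tsp_module[OF assms] assms unfolding bilinear_map_def simp_implies_def
  by (auto intro!: linear_sw[of K W "tsp K V W" "tens K V W v"] linear_sw[of K V "tsp K V W" "\<lambda>x. tens K V W x w"])

lemma linear_map_smult_left:
  assumes "Module.module K V" "Module.module K W" "linear_map K V W e" "a \<in> carrier K"
  shows "linear_map K V W (\<lambda>x. a \<odot>\<^bsub>W\<^esub> e x)"
proof -
  interpret V: Module.module K V by fact
  interpret W: Module.module K W by fact
  show ?thesis
  proof (rule linear_mapI)
    fix b x assume b: "b \<in> carrier K" and x: "x \<in> carrier V"
    then have "a \<odot>\<^bsub>W\<^esub> (b \<odot>\<^bsub>W\<^esub> e x) = b \<odot>\<^bsub>W\<^esub> (a \<odot>\<^bsub>W\<^esub> e x)"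
      using assms(4) linear_map_closed[OF assms(3)]
      by (simp flip: W.smult_assoc1 add: V.R.m_comm)
    then show "a \<odot>\<^bsub>W\<^esub> e (b \<odot>\<^bsub>V\<^esub> x) = b \<odot>\<^bsub>W\<^esub> (a \<odot>\<^bsub>W\<^esub> e x)"
      using b x by (simp add: linear_map_smult[OF assms(3)])
  qed (use assms(4) linear_map_closed[OF assms(3)] in
      \<open>auto simp: linear_map_add[OF assms(3)] W.smult_r_distr\<close>)
qed

lemma tens_smult:
  assumes "Module.module K V" "Module.module K W" "a \<in> carrier K" "x \<in> carrier V" "y \<in> carrier W"
  shows "tens K V W (a \<odot>\<^bsub>V\<^esub> x) y = a \<odot>\<^bsub>tsp K V W\<^esub> tens K V W x y"
    and "tens K V W x (a \<odot>\<^bsub>W\<^esub> y) = a \<odot>\<^bsub>tsp K V W\<^esub> tens K V W x y"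
  using tens_bilinear[OF assms(1,2)] assms(3-5) unfolding bilinear_map_def
  by (auto simp: linear_map_smult[of K W _ "tens K V W x"] linear_map_smult[of K V _ "\<lambda>x. tens K V W x y"])

lemma smult_sw:
  assumes "Module.module K Z" "a \<in> carrier K" "\<And>x y. sw_mem r x y =simp=> F x y \<in> carrier Z"
  shows "a \<odot>\<^bsub>Z\<^esub> sw Z r F = sw Z r (\<lambda>x y. a \<odot>\<^bsub>Z\<^esub> F x y)"
  by (rule linear_sw[of K Z Z]) (use assms in \<open>auto simp: simp_implies_def intro: linear_map_smult_left linear_map_ident\<close>)

lemma sw_smult:
  assumes "Module.module K V" "Module.module K W" "Module.module K Z"
    and "a \<in> carrier K" "r \<in> carrier (tsp K V W)"
    and "\<And>x. x \<in> carrier V =simp=> mem_info V x =simp=> linear_map K W Z (F x)"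
    and "\<And>y. y \<in> carrier W =simp=> mem_info W y =simp=> linear_map K V Z (\<lambda>x. F x y)"
  shows "sw Z (a \<odot>\<^bsub>tsp K V W\<^esub> r) F = a \<odot>\<^bsub>Z\<^esub> sw Z r F"
  by (rule linear_map_smult[OF sw_linear[OF assms(1-3) bilinear_mapI[OF assms(6,7)[unfolded simp_implies_def]]] assms(4,5)])
    (simp_all add: mem_info_def simp_implies_def)

text \<open>The conclusion of the general rule \<open>linear_map_sw\<close> does not determine the
  factors \<open>V\<close> and \<open>W\<close>. In the shapes listed here they can be read off the
  goal, so the simplifier can use them; coproducts and coactions get rules of their own
  later.\<close>

lemma linear_map_sw_simps [simp]:
  assumes "Module.module K V" "Module.module K W" "Module.module K Z"
    and "\<And>x. x \<in> carrier V =simp=> mem_info V x =simp=> linear_map K W Z (F x)"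
    and "\<And>y. y \<in> carrier W =simp=> mem_info W y =simp=> linear_map K V Z (\<lambda>x. F x y)"
  shows "linear_map K (tsp K V W) Z (\<lambda>r. sw Z r F)"
    and "linear_map K U (tsp K V W) (\<lambda>x. tens K V W (e x) (f x))
      \<Longrightarrow> linear_map K U Z (\<lambda>x. sw Z (tens K V W (e x) (f x)) F)"
    and "linear_map K U (tsp K V W) (\<lambda>x. sw (tsp K V W) (r x) (G x))
      \<Longrightarrow> linear_map K U Z (\<lambda>x. sw Z (sw (tsp K V W) (r x) (G x)) F)"
  using assms unfolding simp_implies_def by (auto intro!: linear_map_sw[of K _ V W] linear_map_ident)

lemma sw_closed_simp:
  "\<lbrakk>Module.module K Z; \<And>x y. sw_mem r x y =simp=> F x y \<in> carrier Z\<rbrakk> \<Longrightarrow> sw Z r F \<in> carrier Z"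
  unfolding simp_implies_def by (rule sw_closed)

lemma sw_linear_param_simp [simp]:
  "\<lbrakk>Module.module K U; Module.module K Z; \<And>a b. sw_mem r a b =simp=> linear_map K U Z (\<lambda>x. F x a b)\<rbrakk>
    \<Longrightarrow> linear_map K U Z (\<lambda>x. sw Z r (F x))"
  unfolding simp_implies_def by (rule sw_linear_param)

section \<open>Tensor products of linear maps and their powers\<close>

lemma linear_map_tmap:
  assumes "Module.module K V" "Module.module K W" "Module.module K V'" "Module.module K W'"
    and "linear_map K V V' f" "linear_map K W W' g"
  shows "linear_map K (tsp K V W) (tsp K V' W') (tmap K V' W' f g)"
  unfolding tmap_def using assms
  by (intro sw_linear[of K V W] bilinear_mapI linear_map_tens tsp_module) (auto intro: linear_map_closed)

lemma tmap_tens: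
  assumes "Module.module K V" "Module.module K W" "Module.module K V'" "Module.module K W'"
    and "linear_map K V V' f" "linear_map K W W' g" "x \<in> carrier V" "y \<in> carrier W"
  shows "tmap K V' W' f g (tens K V W x y) = tens K V' W' (f x) (g y)"
  unfolding tmap_def using assms
  by (intro sw_tens[of K V W] bilinear_mapI linear_map_tens tsp_module) (auto intro: linear_map_closed)

lemma tmap_tmap:
  assumes "Module.module K V" "Module.module K W"
    and "linear_map K V V f" "linear_map K W W g" "linear_map K V V f'" "linear_map K W W g'"
    and "r \<in> carrier (tsp K V W)"
  shows "tmap K V W f' g' (tmap K V W f g r) = tmap K V W (\<lambda>x. f' (f x)) (\<lambda>x. g' (g x)) r"
proof -
  note l = linear_map_tmap[OF assms(1,2,1,2)]
  have "\<forall>r\<in>carrier (tsp K V W). tmap K V W f' g' (tmap K V W f g r)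
      = tmap K V W (\<lambda>x. f' (f x)) (\<lambda>x. g' (g x)) r"
    using assms(3-6)
    by (intro tsp_eqI[of K V W "tsp K V W"] linear_map_comp[OF l l] l tsp_module assms(1,2))
      (auto simp: tmap_tens[OF assms(1,2,1,2)] linear_map_closed linear_map_comp)
  then show ?thesis using assms(7) by blast
qed

lemma tmap_ident:
  assumes "Module.module K V" "Module.module K W" "r \<in> carrier (tsp K V W)"
    and "\<And>x. x \<in> carrier V \<Longrightarrow> f x = x" "\<And>x. x \<in> carrier W \<Longrightarrow> g x = x"
  shows "tmap K V W f g r = r"
proof -
  have "tmap K V W f g r = sw (tsp K V W) r (tens K V W)"
    unfolding tmap_def using assms(4,5) sw_memD[OF assms(1-3)] by (intro sw_cong) auto
  then show ?thesis by (simp add: sw_tens_id[OF assms(1-3)])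
qed

text \<open>Induction in both directions from 0. Downwards, \<open>f y\<close> is recovered from
  \<open>f (\<theta> y)\<close> by applying the inverse automorphisms to the two factors.\<close>

lemma tmap_zpow:
  assumes m: "Module.module K V" "Module.module K W"
    and a: "linear_aut K V \<theta>\<^sub>V" "linear_aut K W \<theta>\<^sub>W" "bij_betw \<theta> A A"
    and f: "\<And>x. x \<in> A \<Longrightarrow> f x \<in> carrier (tsp K V W)"
      "\<And>x. x \<in> A \<Longrightarrow> f (\<theta> x) = tmap K V W \<theta>\<^sub>V \<theta>\<^sub>W (f x)"
    and x: "x \<in> A"
  shows "f (zpow A \<theta> i x) = tmap K V W (zpow (carrier V) \<theta>\<^sub>V i) (zpow (carrier W) \<theta>\<^sub>W i) (f x)"
proof -
  have b: "bij_betw \<theta>\<^sub>V (carrier V) (carrier V)" "bij_betw \<theta>\<^sub>W (carrier W) (carrier W)"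
    using a by (auto simp: linear_aut_def)
  have la: "linear_map K V V \<theta>\<^sub>V" "linear_map K W W \<theta>\<^sub>W"
    using a by (auto simp: linear_aut_def)
  note li = linear_aut_inv[OF m(1) a(1)] linear_aut_inv[OF m(2) a(2)]
  note lz = linear_map_zpow[OF m(1) a(1)] linear_map_zpow[OF m(2) a(2)]
  have tcong: "tmap K V W g h r = tmap K V W g' h' r"
    if "r \<in> carrier (tsp K V W)" "\<And>x. x \<in> carrier V \<Longrightarrow> g x = g' x" "\<And>x. x \<in> carrier W \<Longrightarrow> h x = h' x"
    for g h g' h' r
    unfolding tmap_def using that sw_memD[OF m that(1)] by (intro sw_cong) auto
  show ?thesis
  proof (induction i rule: int_induct[of _ 0])
    case base
    then show ?case using x f(1) by (simp add: tmap_ident[OF m])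
  next
    case (step1 i)
    then show ?case using x f(1)
      by (simp add: zpow_succ[OF a(3)] f zpow_closed[OF a(3)] tmap_tmap[OF m lz la])
        (intro tcong, simp_all add: zpow_succ[OF b(1)] zpow_succ[OF b(2)] f(1)[OF x])
  next
    case (step2 i)
    let ?y = "zpow A \<theta> (i - 1) x"
    have y: "?y \<in> A" "\<theta> ?y = zpow A \<theta> i x"
      using x zpow_closed[OF a(3)] zpow_succ[OF a(3) x, of "i - 1"] by auto
    let ?j = "tmap K V W (inv_into (carrier V) \<theta>\<^sub>V) (inv_into (carrier W) \<theta>\<^sub>W)"
    have "f ?y = ?j (tmap K V W \<theta>\<^sub>V \<theta>\<^sub>W (f ?y))"
      using f(1)[OF y(1)] b by (simp add: tmap_tmap[OF m la li] tmap_ident[OF m] bij_betw_inv_into_left)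
    also have "tmap K V W \<theta>\<^sub>V \<theta>\<^sub>W (f ?y) = f (zpow A \<theta> i x)"
      using f(2)[OF y(1)] y(2) by simp
    also have "?j \<dots> = tmap K V W (zpow (carrier V) \<theta>\<^sub>V (i - 1)) (zpow (carrier W) \<theta>\<^sub>W (i - 1)) (f x)"
      unfolding step2 using f(1)[OF x] by (simp add: tmap_tmap[OF m lz li])
        (intro tcong, simp_all add: zpow_pred[OF b(1)] zpow_pred[OF b(2)])
    finally show ?case .
  qed
qed

lemma tmap_aut:
  assumes m: "Module.module K V" "Module.module K W"
    and c: "commuting_auts K U" "commuting_auts K V" "commuting_auts K W"
    and f: "\<And>x. x \<in> carrier U \<Longrightarrow> f x \<in> carrier (tsp K V W)"
      "\<And>x. x \<in> carrier U \<Longrightarrow> f (alpha U x) = tmap K V W (alpha V) (alpha W) (f x)"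
      "\<And>x. x \<in> carrier U \<Longrightarrow> f (beta U x) = tmap K V W (beta V) (beta W) (f x)"
      "\<And>x. x \<in> carrier U \<Longrightarrow> f (omega U x) = tmap K V W (omega V) (omega W) (f x)"
      "\<And>x. x \<in> carrier U \<Longrightarrow> f (psi U x) = tmap K V W (psi V) (psi W) (f x)"
    and x: "x \<in> carrier U"
  shows "f (aut U i j k l x) = tmap K V W (aut V i j k l) (aut W i j k l) (f x)"
proof -
  have z: "f (zpow (carrier U) \<theta> i x) = tmap K V W (zpow (carrier V) \<theta>\<^sub>V i) (zpow (carrier W) \<theta>\<^sub>W i) (f x)"
    if "\<theta> \<in> {alpha U, beta U, omega U, psi U}" "\<theta>\<^sub>V \<in> {alpha V, beta V, omega V, psi V}"
      "\<theta>\<^sub>W \<in> {alpha W, beta W, omega W, psi W}" "x \<in> carrier U"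
      "\<And>x. x \<in> carrier U \<Longrightarrow> f (\<theta> x) = tmap K V W \<theta>\<^sub>V \<theta>\<^sub>W (f x)" for \<theta> \<theta>\<^sub>V \<theta>\<^sub>W x i
    using that c f(1) by (intro tmap_zpow m commuting_autsD) auto
  have l1V: "linear_map K V V (zpow (carrier V) \<theta> i)"
    if "\<theta> \<in> {alpha V, beta V, omega V, psi V}" for \<theta> i
    using that c by (intro linear_map_zpow m commuting_autsD)
  have l2V: "linear_map K V V (\<lambda>x. zpow (carrier V) \<theta> i (e x))"
    if "\<theta> \<in> {alpha V, beta V, omega V, psi V}" "linear_map K V V e" for \<theta> i e
    using linear_map_comp[OF l1V that(2)] that(1) .
  have l1W: "linear_map K W W (zpow (carrier W) \<theta> i)"
    if "\<theta> \<in> {alpha W, beta W, omega W, psi W}" for \<theta> i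
    using that c by (intro linear_map_zpow m commuting_autsD)
  have l2W: "linear_map K W W (\<lambda>x. zpow (carrier W) \<theta> i (e x))"
    if "\<theta> \<in> {alpha W, beta W, omega W, psi W}" "linear_map K W W e" for \<theta> i e
    using linear_map_comp[OF l1W that(2)] that(1) .
  show ?thesis
    using x by (simp add: aut_def comp_def f z[of "alpha U" "alpha V" "alpha W"] z[of "beta U" "beta V" "beta W"]
        z[of "omega U" "omega V" "omega W"] z[of "psi U" "psi V" "psi W"]
        zpow_closed[OF commuting_autsD(2)[OF c(1)]] tmap_tmap[OF m] l1V l2V l1W l2W)
qed

text \<open>Supplies the carriers of the bound variables when the simplifier works under a Sweedler
  sum; nearly all conditional rewrites depend on them.\<close>

lemma sw_cong_simp [cong]:
  "\<lbrakk>Z = Z'; r = r'; \<And>x y. sw_mem r' x y =simp=> F x y = G x y\<rbrakk> \<Longrightarrow> sw Z r F = sw Z' r' G"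
  unfolding simp_implies_def using sw_cong[of r r' F G Z] by blast

declare linear_map_ident [simp] tsp_module [simp] tens_closed [simp]
  sw_tens_simp [simp] sw_sw [simp] linear_map_tens [simp]
  tens_sw [simp] linear_map_smult_left [simp] tens_smult [simp] sw_smult [simp]
  linear_map_aut [simp]

declare tens3_def [simp] tsp3_def [simp]

locale ydl_category =
  fixes K :: "('k, 'c) ring_scheme" and H :: "('k, 'a) bialg"
    and m n p q s t u v :: int
  assumes field_K: "Ring.field K" and bialg: "bihom_bialgebra K H"
begin

abbreviation obj :: "('k, 'a) ydlobj \<Rightarrow> bool" where
  "obj \<equiv> ydl_bimodule K H m n p q s t u v"

sublocale K: Ring.field K by (rule field_K)

text \<open>Scalars are pulled out of inner sums. This brings a counit directly under the sum over
  the coproduct or coaction it belongs to, where the counit laws match.\<close>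

declare smult_sw [where K = K, symmetric, simp] sw_closed_simp [where K = K, simp] aut_closed [where K = K, simp] aut_aut [where K = K, simp]
  module.smult_closed [where R = K, simp]

section \<open>Rewrite rules for the bialgebra\<close>

lemma bialgD:
  "bihom_algebra K H (alpha H) (beta H)"
  "bihom_coalgebra K H (comult H) (counit H) (omega H) (psi H)"
  "commuting_auts K H"
  "\<theta> \<in> {alpha H, beta H} \<Longrightarrow> bihom_coalgebra_map K H (comult H) (counit H) (omega H) (psi H)
        H (comult H) (counit H) (omega H) (psi H) \<theta>"
  "\<theta> \<in> {omega H, psi H} \<Longrightarrow> bihom_algebra_map K H (alpha H) (beta H) H (alpha H) (beta H) \<theta>"
  "comult H \<one>\<^bsub>H\<^esub> = tens K H H \<one>\<^bsub>H\<^esub> \<one>\<^bsub>H\<^esub>" "counit H \<one>\<^bsub>H\<^esub> = \<one>\<^bsub>K\<^esub>"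
  "h \<in> carrier H \<Longrightarrow> g \<in> carrier H \<Longrightarrow> counit H (h \<otimes>\<^bsub>H\<^esub> g) = counit H h \<otimes>\<^bsub>K\<^esub> counit H g"
  using bialg unfolding bihom_bialgebra_def by blast+

lemma H_simps [simp]:
  "Module.module K H" "commuting_auts K H" "\<one>\<^bsub>H\<^esub> \<in> carrier H"
  "linear_map K H (tsp K H H) (comult H)" "linear_form K H (counit H)"
  using bialgD(1-3) by (auto simp: bihom_algebra_def bihom_coalgebra_def)

lemma mult_bilinear: "bilinear_map K H H H (mult H)"
  using bialgD(1) by (auto simp: bihom_algebra_def)

lemma mult_closed [simp]: "x \<in> carrier H \<Longrightarrow> y \<in> carrier H \<Longrightarrow> x \<otimes>\<^bsub>H\<^esub> y \<in> carrier H"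
  using mult_bilinear by (auto simp: bilinear_map_def dest: linear_map_closed)

lemma comult_closed [simp]: "x \<in> carrier H \<Longrightarrow> comult H x \<in> carrier (tsp K H H)"
  by (rule linear_map_closed[OF H_simps(4)])

lemma counit_closed [simp]: "x \<in> carrier H \<Longrightarrow> counit H x \<in> carrier K"
  using H_simps(5) by (auto simp: linear_form_def)

lemma linear_map_mult [simp]:
  "linear_map K V H e \<Longrightarrow> c \<in> carrier H \<Longrightarrow> linear_map K V H (\<lambda>x. e x \<otimes>\<^bsub>H\<^esub> c)"
  "linear_map K V H e \<Longrightarrow> c \<in> carrier H \<Longrightarrow> linear_map K V H (\<lambda>x. c \<otimes>\<^bsub>H\<^esub> e x)"
  using mult_bilinear linear_map_comp[of K H H "\<lambda>x. x \<otimes>\<^bsub>H\<^esub> c" V e]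
    linear_map_comp[of K H H "\<lambda>x. c \<otimes>\<^bsub>H\<^esub> x" V e] by (auto simp: bilinear_map_def)

lemma linear_map_comult [simp]:
  "linear_map K V H e \<Longrightarrow> linear_map K V (tsp K H H) (\<lambda>x. comult H (e x))"
  by (rule linear_map_comp[OF H_simps(4)])

lemma linear_map_counit [simp]:
  assumes "Module.module K V" "Module.module K Z" "linear_map K V H e" "z \<in> carrier Z"
  shows "linear_map K V Z (\<lambda>x. counit H (e x) \<odot>\<^bsub>Z\<^esub> z)"
  using assms H_simps(5) linear_map_closed[OF assms(3)] unfolding linear_form_def
  by (intro linear_mapI) (auto simp: linear_map_add[OF assms(3)] linear_map_smult[OF assms(3)]
      module.smult_l_distr module.smult_assoc1)

lemma sw_mem_comult [simp]:
  "h \<in> carrier H \<Longrightarrow> sw_mem (comult H h) x y \<longleftrightarrow>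
    x \<in> carrier H \<and> y \<in> carrier H \<and> sw_elem (comult H h) x y"
  by (rule sw_mem_iff[of K H H]) simp_all

lemma linear_map_sw_comult [simp]:
  assumes "linear_map K U H e" "Module.module K Z"
    and "\<And>x. x \<in> carrier H =simp=> linear_map K H Z (F x)"
    and "\<And>y. y \<in> carrier H =simp=> linear_map K H Z (\<lambda>x. F x y)"
  shows "linear_map K U Z (\<lambda>x. sw Z (comult H (e x)) F)"
  using assms unfolding simp_implies_def by (intro linear_map_sw[of K U H H]) auto

lemma aut_mult [simp]:
  "x \<in> carrier H \<Longrightarrow> y \<in> carrier H \<Longrightarrow> aut H i j k l (x \<otimes>\<^bsub>H\<^esub> y) = aut H i j k l x \<otimes>\<^bsub>H\<^esub> aut H i j k l y"
  using bialgD(1) bialgD(5)[of "omega H"] bialgD(5)[of "psi H"]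
  by (intro aut_transfer[of K H H H "mult H"]) (auto simp: bihom_algebra_def bihom_algebra_map_def)

lemma aut_one [simp]: "aut H i j k l \<one>\<^bsub>H\<^esub> = \<one>\<^bsub>H\<^esub>"
  using bialgD(1) bialgD(5)[of "omega H"] bialgD(5)[of "psi H"] aut_transfer[of K H H H "\<lambda>x y. \<one>\<^bsub>H\<^esub>" "\<one>\<^bsub>H\<^esub>" "\<one>\<^bsub>H\<^esub>"]
  by (auto simp: bihom_algebra_def bihom_algebra_map_def)

lemma mult_one [simp]:
  "x \<in> carrier H \<Longrightarrow> x \<otimes>\<^bsub>H\<^esub> \<one>\<^bsub>H\<^esub> = aut H 1 0 0 0 x" "x \<in> carrier H \<Longrightarrow> \<one>\<^bsub>H\<^esub> \<otimes>\<^bsub>H\<^esub> x = aut H 0 1 0 0 x"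
  using bialgD(1) unfolding bihom_algebra_def struct_aut by blast+

text \<open>Products are bracketed to the right; solving the axiom for a plain third factor produces
  the \<beta>^-1 on \<open>z\<close>.\<close>

lemma mult_assoc [simp]:
  assumes "x \<in> carrier H" "y \<in> carrier H" "z \<in> carrier H"
  shows "(x \<otimes>\<^bsub>H\<^esub> y) \<otimes>\<^bsub>H\<^esub> z = aut H 1 0 0 0 x \<otimes>\<^bsub>H\<^esub> (y \<otimes>\<^bsub>H\<^esub> aut H 0 (-1) 0 0 z)"
proof -
  have "\<forall>a\<in>carrier H. \<forall>b\<in>carrier H. \<forall>c\<in>carrier H. aut H 1 0 0 0 a \<otimes>\<^bsub>H\<^esub> (b \<otimes>\<^bsub>H\<^esub> c) = (a \<otimes>\<^bsub>H\<^esub> b) \<otimes>\<^bsub>H\<^esub> aut H 0 1 0 0 c"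
    using bialgD(1) unfolding bihom_algebra_def struct_aut by blast
  from this[rule_format, of x y "aut H 0 (-1) 0 0 z"] show ?thesis using assms by simp
qed

lemma counit_mult [simp]:
  "h \<in> carrier H \<Longrightarrow> g \<in> carrier H \<Longrightarrow> counit H (h \<otimes>\<^bsub>H\<^esub> g) = counit H h \<otimes>\<^bsub>K\<^esub> counit H g"
  "counit H \<one>\<^bsub>H\<^esub> = \<one>\<^bsub>K\<^esub>"
  using bialgD(7,8) by auto

lemma counit_struct:
  assumes "\<theta> \<in> {alpha H, beta H, omega H, psi H}" "h \<in> carrier H"
  shows "counit H (\<theta> h) = counit H h" "comult H (\<theta> h) = tmap K H H \<theta> \<theta> (comult H h)"
  using assms bialgD(2) bialgD(4)[of "alpha H"] bialgD(4)[of "beta H"]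
  unfolding bihom_coalgebra_def bihom_coalgebra_map_def by auto

lemma counit_aut [simp]: "h \<in> carrier H \<Longrightarrow> counit H (aut H i j k l h) = counit H h"
proof -
  have z: "counit H (zpow (carrier H) \<theta> i h) = counit H h"
    if \<theta>: "\<theta> \<in> {alpha H, beta H, omega H, psi H}" and h: "h \<in> carrier H" for \<theta> i h
  proof -
    have b: "bij_betw \<theta> (carrier H) (carrier H)"
      using \<theta> by (rule commuting_autsD(2)[OF H_simps(2)])
    show ?thesis
      \<comment> \<open>The counit is treated as a binary map that ignores one argument, with the
        identity as automorphism of the scalars.\<close>
      using zpow_transfer[where F = "\<lambda>a b. counit H a" and A = "carrier H" and B = "carrier H"
          and C = "carrier K" and h = id, OF b b bij_betw_id _ _ h h] counit_struct(1)[OF \<theta>] h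
      by (simp add: zpow_id)
  qed
  assume "h \<in> carrier H"
  then show ?thesis by (simp add: aut_def z zpow_closed[OF commuting_autsD(2)[OF H_simps(2)]])
qed


lemma comult_aut [simp]:
  assumes "h \<in> carrier H"
  shows "comult H (aut H i j k l h)
    = sw (tsp K H H) (comult H h) (\<lambda>a b. tens K H H (aut H i j k l a) (aut H i j k l b))"
  using tmap_aut[of K H H H "comult H"] assms by (simp add: tmap_def[symmetric] counit_struct(2))

lemma comult_mult [simp]:
  assumes "h \<in> carrier H" "g \<in> carrier H"
  shows "comult H (h \<otimes>\<^bsub>H\<^esub> g) = sw (tsp K H H) (comult H h) (\<lambda>h1 h2. sw (tsp K H H) (comult H g) (\<lambda>g1 g2.
            tens K H H (h1 \<otimes>\<^bsub>H\<^esub> g1) (h2 \<otimes>\<^bsub>H\<^esub> g2)))"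
  using bialg assms unfolding bihom_bialgebra_def by blast

lemma comult_one [simp]: "comult H \<one>\<^bsub>H\<^esub> = tens K H H \<one>\<^bsub>H\<^esub> \<one>\<^bsub>H\<^esub>"
  by (rule bialgD(6))

declare struct_aut [simp]

lemma counit_left [simp]:
  assumes "h \<in> carrier H" "Module.module K Z" "linear_map K H Z F"
  shows "sw Z (comult H h) (\<lambda>a b. counit H a \<odot>\<^bsub>Z\<^esub> F b) = F (aut H 0 0 0 1 h)"
proof -
  have "sw H (comult H h) (\<lambda>a b. counit H a \<odot>\<^bsub>H\<^esub> b) = aut H 0 0 0 1 h"
    using bialgD(2) assms(1) unfolding bihom_coalgebra_def struct_aut by blast
  then show ?thesis
    using linear_sw[OF _ assms(2,3), where r = "comult H h" and F = "\<lambda>a b. counit H a \<odot>\<^bsub>H\<^esub> b"] assms(1)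
    by (simp add: linear_map_smult[OF assms(3)])
qed

lemma counit_right [simp]:
  assumes "h \<in> carrier H" "Module.module K Z" "linear_map K H Z F"
  shows "sw Z (comult H h) (\<lambda>a b. counit H b \<odot>\<^bsub>Z\<^esub> F a) = F (aut H 0 0 1 0 h)"
proof -
  have "sw H (comult H h) (\<lambda>a b. counit H b \<odot>\<^bsub>H\<^esub> a) = aut H 0 0 1 0 h"
    using bialgD(2) assms(1) unfolding bihom_coalgebra_def struct_aut by blast
  then show ?thesis
    using linear_sw[OF _ assms(2,3), where r = "comult H h" and F = "\<lambda>a b. counit H b \<odot>\<^bsub>H\<^esub> a"] assms(1)
    by (simp add: linear_map_smult[OF assms(3)])
qed


text \<open>The axiom equates two tensors of \<open>tsp3\<close>; evaluating both with the trilinear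
  \<open>F\<close> gives the rule inside any expression. All twists are put on the right-hand side,
  so that matching the left-hand side with a goal finds \<open>F\<close>.\<close>

lemma comult_coassoc:
  assumes h: "h \<in> carrier H" and Z: "Module.module K Z"
    and F: "\<And>b c. b \<in> carrier H \<Longrightarrow> c \<in> carrier H \<Longrightarrow> linear_map K H Z (\<lambda>a. F a b c)"
      "\<And>a c. a \<in> carrier H \<Longrightarrow> c \<in> carrier H \<Longrightarrow> linear_map K H Z (\<lambda>b. F a b c)"
      "\<And>a b. a \<in> carrier H \<Longrightarrow> b \<in> carrier H \<Longrightarrow> linear_map K H Z (\<lambda>c. F a b c)"
  shows "sw Z (comult H h) (\<lambda>a b. sw Z (comult H a) (\<lambda>a1 a2. F a1 a2 b))
    = sw Z (comult H h) (\<lambda>a b. sw Z (comult H b) (\<lambda>b1 b2. F (aut H 0 0 1 0 a) b1 (aut H 0 0 0 (-1) b2)))"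
proof -
  \<comment> \<open>The axiom has \<psi> on its third component; this \<psi>^-1 cancels it.\<close>
  let ?G = "\<lambda>a b c. F a b (aut H 0 0 0 (-1) c)"
  have 3: "linear_map K H Z (\<lambda>c. ?G a b c)" if "a \<in> carrier H" "b \<in> carrier H" for a b
    using linear_map_comp[OF F(3)[OF that], of H "\<lambda>c. aut H 0 0 0 (-1) c"] that by simp
  have ax: "sw (tsp3 K H H H) (comult H h) (\<lambda>a b. sw (tsp3 K H H H) (comult H b) (\<lambda>b1 b2.
            tens3 K H H H (omega H a) b1 b2))
        = sw (tsp3 K H H H) (comult H h) (\<lambda>a b. sw (tsp3 K H H H) (comult H a) (\<lambda>a1 a2.
            tens3 K H H H a1 a2 (psi H b)))"
    using bialgD(2) h unfolding bihom_coalgebra_def by blast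
  show ?thesis
    using h Z F 3 arg_cong[OF ax, of "\<lambda>r. sw Z r (\<lambda>a t. sw Z t (?G a))"] by simp
qed


text \<open>The opposite regrouping needs its own rule: read backwards,
  \<open>comult_coassoc\<close> matches only expressions that already carry its twists.\<close>

lemma comult_coassoc':
  assumes h: "h \<in> carrier H" and Z: "Module.module K Z"
    and F: "\<And>b c. b \<in> carrier H \<Longrightarrow> c \<in> carrier H \<Longrightarrow> linear_map K H Z (\<lambda>a. F a b c)"
      "\<And>a c. a \<in> carrier H \<Longrightarrow> c \<in> carrier H \<Longrightarrow> linear_map K H Z (\<lambda>b. F a b c)"
      "\<And>a b. a \<in> carrier H \<Longrightarrow> b \<in> carrier H \<Longrightarrow> linear_map K H Z (\<lambda>c. F a b c)"
  shows "sw Z (comult H h) (\<lambda>a b. sw Z (comult H b) (\<lambda>b1 b2. F a b1 b2))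
    = sw Z (comult H h) (\<lambda>a b. sw Z (comult H a) (\<lambda>a1 a2. F (aut H 0 0 (-1) 0 a1) a2 (aut H 0 0 0 1 b)))"
proof -
  have 1: "linear_map K H Z (\<lambda>a. F (aut H 0 0 (-1) 0 a) b c)" if "b \<in> carrier H" "c \<in> carrier H" for b c
    using linear_map_comp[OF F(1)[OF that], of H "\<lambda>c. aut H 0 0 (-1) 0 c"] by simp
  have 3: "linear_map K H Z (\<lambda>c. F a b (aut H 0 0 0 1 c))" if "a \<in> carrier H" "b \<in> carrier H" for a b
    using linear_map_comp[OF F(3)[OF that], of H "\<lambda>c. aut H 0 0 0 1 c"] by simp
  show ?thesis
    by (subst comult_coassoc[OF h Z]) (use h Z F 1 3 in simp_all)
qed

section \<open>Rewrite rules for actions and coactions\<close>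

lemma objD:
  assumes "obj M"
  shows "left_module K H M" "right_module K H M" "left_comodule K H M" "right_comodule K H M"
    "bimodule K H M" "bicomodule K H M"
  using assms by (auto simp: ydl_bimodule_def bimodule_def bicomodule_def)

lemma obj_simps [simp]:
  assumes "obj M"
  shows "Module.module K M" "commuting_auts K M"
    "linear_map K M (tsp K H M) (lcoact M)" "linear_map K M (tsp K M H) (rcoact M)"
  using objD[OF assms] by (auto simp: left_module_def left_comodule_def right_comodule_def)

lemma act_bilinear:
  assumes "obj M"
  shows "bilinear_map K H M M (lact M)" "bilinear_map K M H M (ract M)"
  using objD[OF assms] by (auto simp: left_module_def right_module_def)

lemma act_closed [simp]:
  assumes "obj M" "x \<in> carrier M"
  shows "h \<in> carrier H \<Longrightarrow> lact M h x \<in> carrier M" "h \<in> carrier H \<Longrightarrow> ract M x h \<in> carrier M"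
    "lcoact M x \<in> carrier (tsp K H M)" "rcoact M x \<in> carrier (tsp K M H)"
  using act_bilinear[OF assms(1)] assms(2) linear_map_closed[OF obj_simps(3)[OF assms(1)]]
    linear_map_closed[OF obj_simps(4)[OF assms(1)]]
  by (auto simp: bilinear_map_def dest: linear_map_closed)

lemma linear_map_act [simp]:
  assumes "obj M"
  shows "linear_map K V H e \<Longrightarrow> x \<in> carrier M \<Longrightarrow> linear_map K V M (\<lambda>h. lact M (e h) x)"
    and "linear_map K V M f \<Longrightarrow> h \<in> carrier H \<Longrightarrow> linear_map K V M (\<lambda>x. lact M h (f x))"
    and "linear_map K V H e \<Longrightarrow> x \<in> carrier M \<Longrightarrow> linear_map K V M (\<lambda>h. ract M x (e h))"
    and "linear_map K V M f \<Longrightarrow> h \<in> carrier H \<Longrightarrow> linear_map K V M (\<lambda>x. ract M (f x) h)"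
    and "linear_map K V M f \<Longrightarrow> linear_map K V (tsp K H M) (\<lambda>x. lcoact M (f x))"
    and "linear_map K V M f \<Longrightarrow> linear_map K V (tsp K M H) (\<lambda>x. rcoact M (f x))"
  using act_bilinear[OF assms] obj_simps(3,4)[OF assms] unfolding bilinear_map_def
  by (auto intro: linear_map_comp[of K H M "\<lambda>h. lact M h x" V e] linear_map_comp[of K M M "\<lambda>x. lact M h x" V f]
      linear_map_comp[of K H M "\<lambda>h. ract M x h" V e] linear_map_comp[of K M M "\<lambda>x. ract M x h" V f]
      linear_map_comp[of K M _ "lcoact M" V f] linear_map_comp[of K M _ "rcoact M" V f])

lemma sw_mem_coact [simp]:
  assumes "obj M" "x \<in> carrier M"
  shows "sw_mem (lcoact M x) a y \<longleftrightarrow> a \<in> carrier H \<and> y \<in> carrier M \<and> sw_elem (lcoact M x) a y"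
    and "sw_mem (rcoact M x) y a \<longleftrightarrow> y \<in> carrier M \<and> a \<in> carrier H \<and> sw_elem (rcoact M x) y a"
  using sw_mem_iff[of K H M "lcoact M x"] sw_mem_iff[of K M H "rcoact M x"] assms by auto

lemma linear_map_sw_coact [simp]:
  assumes "obj M" "linear_map K U M e" "Module.module K Z"
  shows "\<lbrakk>\<And>a. a \<in> carrier H =simp=> linear_map K M Z (F a);
      \<And>x. x \<in> carrier M =simp=> linear_map K H Z (\<lambda>a. F a x)\<rbrakk>
      \<Longrightarrow> linear_map K U Z (\<lambda>x. sw Z (lcoact M (e x)) F)"
    and "\<lbrakk>\<And>a. a \<in> carrier H =simp=> linear_map K M Z (\<lambda>x. G x a);
      \<And>x. x \<in> carrier M =simp=> linear_map K H Z (G x)\<rbrakk>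
      \<Longrightarrow> linear_map K U Z (\<lambda>x. sw Z (rcoact M (e x)) G)"
  using assms linear_map_sw[of K U H M "\<lambda>x. lcoact M (e x)" Z F]
    linear_map_sw[of K U M H "\<lambda>x. rcoact M (e x)" Z G] unfolding simp_implies_def by auto

lemma aut_act [simp]:
  assumes "obj M" "h \<in> carrier H" "x \<in> carrier M"
  shows "aut M i j k l (lact M h x) = lact M (aut H i j k l h) (aut M i j k l x)"
    "aut M i j k l (ract M x h) = ract M (aut M i j k l x) (aut H i j k l h)"
proof goal_cases
  case 1
  show ?case
    using objD(1)[OF assms(1)] assms
    by (intro aut_transfer[of K H M M "lact M"]) (simp_all add: left_module_def theta_pairs_def del: struct_aut)
next
  case 2
  show ?case
    using objD(2)[OF assms(1)] assms
    by (intro aut_transfer[of K M H M "ract M"]) (simp_all add: right_module_def theta_pairs_def del: struct_aut)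
qed

lemma coact_aut [simp]:
  assumes "obj M" "x \<in> carrier M"
  shows "lcoact M (aut M i j k l x)
      = sw (tsp K H M) (lcoact M x) (\<lambda>a y. tens K H M (aut H i j k l a) (aut M i j k l y))"
    and "rcoact M (aut M i j k l x)
      = sw (tsp K M H) (rcoact M x) (\<lambda>y a. tens K M H (aut M i j k l y) (aut H i j k l a))"
  unfolding tmap_def[symmetric]
proof goal_cases
  case 1
  show ?case
    using objD(3)[OF assms(1)] assms
    by (intro tmap_aut[of K H M M "lcoact M"]) (simp_all add: left_comodule_def theta_pairs_def del: struct_aut)
next
  case 2
  show ?case
    using objD(4)[OF assms(1)] assms
    by (intro tmap_aut[of K M H M "rcoact M"]) (simp_all add: right_comodule_def theta_pairs_def del: struct_aut)
qed

lemma act_one [simp]: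
  assumes "obj M" "x \<in> carrier M"
  shows "lact M \<one>\<^bsub>H\<^esub> x = aut M 0 1 0 0 x" "ract M x \<one>\<^bsub>H\<^esub> = aut M 1 0 0 0 x"
  using objD(1,2)[OF assms(1)] assms(2) by (auto simp: left_module_def right_module_def)

text \<open>Normal form of an element acted on from both sides: a single left action outside, a
  single right action inside. The inverse powers come from solving the axioms for untwisted
  arguments.\<close>

lemma act_act [simp]:
  assumes "obj M" "h \<in> carrier H" "g \<in> carrier H" "x \<in> carrier M"
  shows "lact M h (lact M g x) = lact M (aut H (-1) 0 0 0 h \<otimes>\<^bsub>H\<^esub> g) (aut M 0 1 0 0 x)"
    and "ract M (ract M x h) g = ract M (aut M 1 0 0 0 x) (h \<otimes>\<^bsub>H\<^esub> aut H 0 (-1) 0 0 g)"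
    and "ract M (lact M h x) g = lact M (aut H 1 0 0 0 h) (ract M x (aut H 0 (-1) 0 0 g))"
proof -
  note o = objD(1,2,5)[OF assms(1)]
  have "\<forall>h\<in>carrier H. \<forall>g\<in>carrier H. \<forall>x\<in>carrier M.
        lact M (aut H 1 0 0 0 h) (lact M g x) = lact M (h \<otimes>\<^bsub>H\<^esub> g) (aut M 0 1 0 0 x)"
    using o(1) unfolding left_module_def struct_aut by blast
  from this[rule_format, of "aut H (-1) 0 0 0 h" g x]
  show "lact M h (lact M g x) = lact M (aut H (-1) 0 0 0 h \<otimes>\<^bsub>H\<^esub> g) (aut M 0 1 0 0 x)"
    using assms by simp
  have "\<forall>h\<in>carrier H. \<forall>g\<in>carrier H. \<forall>x\<in>carrier M.
        ract M (ract M x h) (aut H 0 1 0 0 g) = ract M (aut M 1 0 0 0 x) (h \<otimes>\<^bsub>H\<^esub> g)"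
    using o(2) unfolding right_module_def struct_aut by blast
  from this[rule_format, of h "aut H 0 (-1) 0 0 g" x]
  show "ract M (ract M x h) g = ract M (aut M 1 0 0 0 x) (h \<otimes>\<^bsub>H\<^esub> aut H 0 (-1) 0 0 g)"
    using assms by simp
  have "\<forall>a\<in>carrier H. \<forall>b\<in>carrier H. \<forall>x\<in>carrier M.
        lact M (aut H 1 0 0 0 a) (ract M x b) = ract M (lact M a x) (aut H 0 1 0 0 b)"
    using o(3) unfolding bimodule_def struct_aut by blast
  from this[rule_format, of h "aut H 0 (-1) 0 0 g" x]
  show "ract M (lact M h x) g = lact M (aut H 1 0 0 0 h) (ract M x (aut H 0 (-1) 0 0 g))"
    using assms by simp
qed

text \<open>Conditions (ii) and (iv) compute the coaction of one acted-on element and so are rewrite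
  rules. Conditions (i) and (iii) only relate two sums over a coproduct and have to be invoked
  explicitly.\<close>

lemma act_coact [simp]:
  assumes "obj M" "h \<in> carrier H" "x \<in> carrier M"
  shows "rcoact M (lact M h x)
      = sw (tsp K M H) (rcoact M x) (\<lambda>y a. tens K M H (lact M (aut H 0 0 1 0 h) y) (aut H 0 1 0 0 a))"
    and "lcoact M (ract M x h)
      = sw (tsp K H M) (lcoact M x) (\<lambda>a y. tens K H M (aut H 1 0 0 0 a) (ract M y (aut H 0 0 0 1 h)))"
  using assms unfolding ydl_bimodule_def by auto

lemma coact_counit [simp]:
  assumes "obj M" "x \<in> carrier M" "Module.module K Z" "linear_map K M Z F"
  shows "sw Z (lcoact M x) (\<lambda>a y. counit H a \<odot>\<^bsub>Z\<^esub> F y) = F (aut M 0 0 0 1 x)"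
    and "sw Z (rcoact M x) (\<lambda>y a. counit H a \<odot>\<^bsub>Z\<^esub> F y) = F (aut M 0 0 1 0 x)"
proof -
  have "sw M (lcoact M x) (\<lambda>a y. counit H a \<odot>\<^bsub>M\<^esub> y) = aut M 0 0 0 1 x"
    "sw M (rcoact M x) (\<lambda>y a. counit H a \<odot>\<^bsub>M\<^esub> y) = aut M 0 0 1 0 x"
    using objD(3,4)[OF assms(1)] assms(2) unfolding left_comodule_def right_comodule_def struct_aut by blast+
  then show "sw Z (lcoact M x) (\<lambda>a y. counit H a \<odot>\<^bsub>Z\<^esub> F y) = F (aut M 0 0 0 1 x)"
    "sw Z (rcoact M x) (\<lambda>y a. counit H a \<odot>\<^bsub>Z\<^esub> F y) = F (aut M 0 0 1 0 x)"
    using linear_sw[OF _ assms(3,4), where r = "lcoact M x" and F = "\<lambda>a y. counit H a \<odot>\<^bsub>M\<^esub> y"]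
      linear_sw[OF _ assms(3,4), where r = "rcoact M x" and F = "\<lambda>y a. counit H a \<odot>\<^bsub>M\<^esub> y"] assms
    by (simp_all add: linear_map_smult[OF assms(4)])
qed

section \<open>Coassociativity, exchange of coactions and conditions (i), (iii) inside multilinear
  expressions\<close>

lemma lcoact_coassoc:
  assumes M: "obj M" and x: "x \<in> carrier M" and Z: "Module.module K Z"
    and F: "\<And>b c. b \<in> carrier H \<Longrightarrow> c \<in> carrier M \<Longrightarrow> linear_map K H Z (\<lambda>a. F a b c)"
      "\<And>a c. a \<in> carrier H \<Longrightarrow> c \<in> carrier M \<Longrightarrow> linear_map K H Z (\<lambda>b. F a b c)"
      "\<And>a b. a \<in> carrier H \<Longrightarrow> b \<in> carrier H \<Longrightarrow> linear_map K M Z (\<lambda>c. F a b c)"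
  shows "sw Z (lcoact M x) (\<lambda>a y. sw Z (comult H a) (\<lambda>a1 a2. F a1 a2 y))
    = sw Z (lcoact M x) (\<lambda>a y. sw Z (lcoact M y) (\<lambda>b z. F (aut H 0 0 1 0 a) b (aut M 0 0 0 (-1) z)))"
proof -
  let ?G = "\<lambda>a b c. F a b (aut M 0 0 0 (-1) c)"
  have 3: "linear_map K M Z (\<lambda>c. ?G a b c)" if "a \<in> carrier H" "b \<in> carrier H" for a b
    using linear_map_comp[OF F(3)[OF that], of M "\<lambda>c. aut M 0 0 0 (-1) c"] M by simp
  have ax: "sw (tsp3 K H H M) (lcoact M x) (\<lambda>a y. sw (tsp3 K H H M) (comult H a) (\<lambda>a1 a2.
            tens3 K H H M a1 a2 (psi M y)))
        = sw (tsp3 K H H M) (lcoact M x) (\<lambda>a y. sw (tsp3 K H H M) (lcoact M y) (\<lambda>b z.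
            tens3 K H H M (omega H a) b z))"
    using objD(3)[OF M] x unfolding left_comodule_def by blast
  show ?thesis
    using M x Z F 3 arg_cong[OF ax, of "\<lambda>r. sw Z r (\<lambda>a t. sw Z t (?G a))"] by simp
qed

lemma lcoact_coassoc':
  assumes M: "obj M" and x: "x \<in> carrier M" and Z: "Module.module K Z"
    and F: "\<And>b c. b \<in> carrier H \<Longrightarrow> c \<in> carrier M \<Longrightarrow> linear_map K H Z (\<lambda>a. F a b c)"
      "\<And>a c. a \<in> carrier H \<Longrightarrow> c \<in> carrier M \<Longrightarrow> linear_map K H Z (\<lambda>b. F a b c)"
      "\<And>a b. a \<in> carrier H \<Longrightarrow> b \<in> carrier H \<Longrightarrow> linear_map K M Z (\<lambda>c. F a b c)"
  shows "sw Z (lcoact M x) (\<lambda>a y. sw Z (lcoact M y) (\<lambda>b z. F a b z))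
    = sw Z (lcoact M x) (\<lambda>a y. sw Z (comult H a) (\<lambda>a1 a2. F (aut H 0 0 (-1) 0 a1) a2 (aut M 0 0 0 1 y)))"
proof -
  have 1: "linear_map K H Z (\<lambda>a. F (aut H 0 0 (-1) 0 a) b c)" if "b \<in> carrier H" "c \<in> carrier M" for b c
    using linear_map_comp[OF F(1)[OF that], of H "\<lambda>c. aut H 0 0 (-1) 0 c"] by simp
  have 3: "linear_map K M Z (\<lambda>c. F a b (aut M 0 0 0 1 c))" if "a \<in> carrier H" "b \<in> carrier H" for a b
    using linear_map_comp[OF F(3)[OF that], of M "\<lambda>c. aut M 0 0 0 1 c"] M by simp
  show ?thesis
    by (subst lcoact_coassoc[OF M x Z]) (use M x Z F 1 3 in simp_all)
qed

lemma rcoact_coassoc: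
  assumes M: "obj M" and x: "x \<in> carrier M" and Z: "Module.module K Z"
    and F: "\<And>b c. b \<in> carrier H \<Longrightarrow> c \<in> carrier H \<Longrightarrow> linear_map K M Z (\<lambda>a. F a b c)"
      "\<And>a c. a \<in> carrier M \<Longrightarrow> c \<in> carrier H \<Longrightarrow> linear_map K H Z (\<lambda>b. F a b c)"
      "\<And>a b. a \<in> carrier M \<Longrightarrow> b \<in> carrier H \<Longrightarrow> linear_map K H Z (\<lambda>c. F a b c)"
  shows "sw Z (rcoact M x) (\<lambda>y a. sw Z (comult H a) (\<lambda>a1 a2. F y a1 a2))
    = sw Z (rcoact M x) (\<lambda>y a. sw Z (rcoact M y) (\<lambda>z b. F (aut M 0 0 (-1) 0 z) b (aut H 0 0 0 1 a)))"
proof -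
  let ?G = "\<lambda>a b c. F (aut M 0 0 (-1) 0 a) b c"
  have 1: "linear_map K M Z (\<lambda>a. ?G a b c)" if "b \<in> carrier H" "c \<in> carrier H" for b c
    using linear_map_comp[OF F(1)[OF that], of M "\<lambda>c. aut M 0 0 (-1) 0 c"] M by simp
  have ax: "sw (tsp3 K M H H) (rcoact M x) (\<lambda>y a. sw (tsp3 K M H H) (comult H a) (\<lambda>a1 a2.
            tens3 K M H H (omega M y) a1 a2))
        = sw (tsp3 K M H H) (rcoact M x) (\<lambda>y a. sw (tsp3 K M H H) (rcoact M y) (\<lambda>z b.
            tens3 K M H H z b (psi H a)))"
    using objD(4)[OF M] x unfolding right_comodule_def by blast
  show ?thesis
    using M x Z F 1 arg_cong[OF ax, of "\<lambda>r. sw Z r (\<lambda>a t. sw Z t (?G a))"] by simp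
qed

lemma rcoact_coassoc':
  assumes M: "obj M" and x: "x \<in> carrier M" and Z: "Module.module K Z"
    and F: "\<And>b c. b \<in> carrier H \<Longrightarrow> c \<in> carrier H \<Longrightarrow> linear_map K M Z (\<lambda>a. F a b c)"
      "\<And>a c. a \<in> carrier M \<Longrightarrow> c \<in> carrier H \<Longrightarrow> linear_map K H Z (\<lambda>b. F a b c)"
      "\<And>a b. a \<in> carrier M \<Longrightarrow> b \<in> carrier H \<Longrightarrow> linear_map K H Z (\<lambda>c. F a b c)"
  shows "sw Z (rcoact M x) (\<lambda>y a. sw Z (rcoact M y) (\<lambda>z b. F z b a))
    = sw Z (rcoact M x) (\<lambda>y a. sw Z (comult H a) (\<lambda>a1 a2. F (aut M 0 0 1 0 y) a1 (aut H 0 0 0 (-1) a2)))"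
proof -
  have 1: "linear_map K M Z (\<lambda>a. F (aut M 0 0 1 0 a) b c)" if "b \<in> carrier H" "c \<in> carrier H" for b c
    using linear_map_comp[OF F(1)[OF that], of M "\<lambda>c. aut M 0 0 1 0 c"] M by simp
  have 3: "linear_map K H Z (\<lambda>c. F a b (aut H 0 0 0 (-1) c))" if "a \<in> carrier M" "b \<in> carrier H" for a b
    using linear_map_comp[OF F(3)[OF that], of H "\<lambda>c. aut H 0 0 0 (-1) c"] by simp
  show ?thesis
    by (subst rcoact_coassoc[OF M x Z]) (use M x Z F 1 3 in simp_all)
qed

lemma coact_commute:
  assumes M: "obj M" and x: "x \<in> carrier M" and Z: "Module.module K Z"
    and F: "\<And>b c. b \<in> carrier M \<Longrightarrow> c \<in> carrier H \<Longrightarrow> linear_map K H Z (\<lambda>a. F a b c)"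
      "\<And>a c. a \<in> carrier H \<Longrightarrow> c \<in> carrier H \<Longrightarrow> linear_map K M Z (\<lambda>b. F a b c)"
      "\<And>a b. a \<in> carrier H \<Longrightarrow> b \<in> carrier M \<Longrightarrow> linear_map K H Z (\<lambda>c. F a b c)"
  shows "sw Z (lcoact M x) (\<lambda>a y. sw Z (rcoact M y) (\<lambda>z b. F a z b))
    = sw Z (rcoact M x) (\<lambda>y b. sw Z (lcoact M y) (\<lambda>a z. F (aut H 0 0 (-1) 0 a) z (aut H 0 0 0 1 b)))"
proof -
  let ?G = "\<lambda>a b c. F (aut H 0 0 (-1) 0 a) b c"
  have 1: "linear_map K H Z (\<lambda>a. ?G a b c)" if "b \<in> carrier M" "c \<in> carrier H" for b c
    using linear_map_comp[OF F(1)[OF that], of H "\<lambda>c. aut H 0 0 (-1) 0 c"] by simp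
  have ax: "sw (tsp3 K H M H) (lcoact M x) (\<lambda>a y. sw (tsp3 K H M H) (rcoact M y) (\<lambda>z b.
            tens3 K H M H (omega H a) z b))
        = sw (tsp3 K H M H) (rcoact M x) (\<lambda>y b. sw (tsp3 K H M H) (lcoact M y) (\<lambda>a z.
            tens3 K H M H a z (psi H b)))"
    using objD(6)[OF M] x unfolding bicomodule_def by blast
  show ?thesis
    using M x Z F 1 arg_cong[OF ax, of "\<lambda>r. sw Z r (\<lambda>a t. sw Z t (?G a))"] by simp
qed

lemma coact_commute':
  assumes M: "obj M" and x: "x \<in> carrier M" and Z: "Module.module K Z"
    and F: "\<And>b c. b \<in> carrier M \<Longrightarrow> c \<in> carrier H \<Longrightarrow> linear_map K H Z (\<lambda>a. F a b c)"
      "\<And>a c. a \<in> carrier H \<Longrightarrow> c \<in> carrier H \<Longrightarrow> linear_map K M Z (\<lambda>b. F a b c)"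
      "\<And>a b. a \<in> carrier H \<Longrightarrow> b \<in> carrier M \<Longrightarrow> linear_map K H Z (\<lambda>c. F a b c)"
  shows "sw Z (rcoact M x) (\<lambda>y b. sw Z (lcoact M y) (\<lambda>a z. F a z b))
    = sw Z (lcoact M x) (\<lambda>a y. sw Z (rcoact M y) (\<lambda>z b. F (aut H 0 0 1 0 a) z (aut H 0 0 0 (-1) b)))"
proof -
  have 1: "linear_map K H Z (\<lambda>a. F (aut H 0 0 1 0 a) b c)" if "b \<in> carrier M" "c \<in> carrier H" for b c
    using linear_map_comp[OF F(1)[OF that], of H "\<lambda>c. aut H 0 0 1 0 c"] by simp
  have 3: "linear_map K H Z (\<lambda>c. F a b (aut H 0 0 0 (-1) c))" if "a \<in> carrier H" "b \<in> carrier M" for a b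
    using linear_map_comp[OF F(3)[OF that], of H "\<lambda>c. aut H 0 0 0 (-1) c"] by simp
  show ?thesis
    by (subst coact_commute[OF M x Z]) (use M x Z F 1 3 in simp_all)
qed

text \<open>The acting component on the left-hand side must carry exactly the exponents of condition
  (i). Uses of the rule choose \<open>h\<close> suitably and absorb all other twists into
  \<open>F\<close>.\<close>

lemma ydl_left:
  assumes M: "obj M" and x: "x \<in> carrier M" and h: "h \<in> carrier H" and Z: "Module.module K Z"
    and F: "\<And>b. b \<in> carrier M \<Longrightarrow> linear_map K H Z (\<lambda>a. F a b)"
      "\<And>a. a \<in> carrier H \<Longrightarrow> linear_map K M Z (\<lambda>b. F a b)"
  shows "sw Z (comult H h) (\<lambda>h1 h2. sw Z (lcoact M (lact M (aut H s (p + 1) q (t + 1) h1) x))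
      (\<lambda>a y. F (a \<otimes>\<^bsub>H\<^esub> aut H 1 (-1) 1 (-1) h2) y))
    = sw Z (comult H h) (\<lambda>h1 h2. sw Z (lcoact M x)
      (\<lambda>a y. F (h1 \<otimes>\<^bsub>H\<^esub> aut H 1 0 0 0 a) (lact M (aut H s (p + 1) (q + 1) (t + 1) h2) y)))"
proof -
  have ax: "sw (tsp K H M) (comult H h) (\<lambda>h\<^sub>1 h\<^sub>2.
          sw (tsp K H M) (lcoact M (lact M (aut H s (p + 1) q (t + 1) h\<^sub>1) x)) (\<lambda>y\<^sub>m y\<^sub>0.
            tens K H M (y\<^sub>m \<otimes>\<^bsub>H\<^esub> aut H 1 (-1) 1 (-1) h\<^sub>2) y\<^sub>0))
        = sw (tsp K H M) (comult H h) (\<lambda>h\<^sub>1 h\<^sub>2. sw (tsp K H M) (lcoact M x) (\<lambda>x\<^sub>m x\<^sub>0.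
            tens K H M (h\<^sub>1 \<otimes>\<^bsub>H\<^esub> alpha H x\<^sub>m) (lact M (aut H s (p + 1) (q + 1) (t + 1) h\<^sub>2) x\<^sub>0)))"
    using M x h unfolding ydl_bimodule_def by blast
  show ?thesis
    using M x h Z F arg_cong[OF ax, of "\<lambda>r. sw Z r F"] by simp
qed

lemma ydl_right:
  assumes M: "obj M" and x: "x \<in> carrier M" and h: "h \<in> carrier H" and Z: "Module.module K Z"
    and F: "\<And>b. b \<in> carrier H \<Longrightarrow> linear_map K M Z (\<lambda>a. F a b)"
      "\<And>a. a \<in> carrier M \<Longrightarrow> linear_map K H Z (\<lambda>b. F a b)"
  shows "sw Z (comult H h) (\<lambda>h1 h2. sw Z (rcoact M (ract M x (aut H (m + 1) u (v + 1) n h2)))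
      (\<lambda>y a. F y (aut H (-1) 1 (-1) 1 h1 \<otimes>\<^bsub>H\<^esub> a)))
    = sw Z (comult H h) (\<lambda>h1 h2. sw Z (rcoact M x)
      (\<lambda>y a. F (ract M y (aut H (m + 1) u (v + 1) (n + 1) h1)) (aut H 0 1 0 0 a \<otimes>\<^bsub>H\<^esub> h2)))"
proof -
  have ax: "sw (tsp K M H) (comult H h) (\<lambda>h\<^sub>1 h\<^sub>2.
          sw (tsp K M H) (rcoact M (ract M x (aut H (m + 1) u (v + 1) n h\<^sub>2))) (\<lambda>y\<^sub>0 y\<^sub>1.
            tens K M H y\<^sub>0 (aut H (-1) 1 (-1) 1 h\<^sub>1 \<otimes>\<^bsub>H\<^esub> y\<^sub>1)))
        = sw (tsp K M H) (comult H h) (\<lambda>h\<^sub>1 h\<^sub>2. sw (tsp K M H) (rcoact M x) (\<lambda>x\<^sub>0 x\<^sub>1.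
            tens K M H (ract M x\<^sub>0 (aut H (m + 1) u (v + 1) (n + 1) h\<^sub>1)) (beta H x\<^sub>1 \<otimes>\<^bsub>H\<^esub> h\<^sub>2)))"
    using M x h unfolding ydl_bimodule_def by blast
  show ?thesis
    using M x h Z F arg_cong[OF ax, of "\<lambda>r. sw Z r F"] by simp
qed


declare module.smult_assoc1 [where R = K, simp]

lemma aut_sw [simp]:
  assumes "Module.module K M" "commuting_auts K M"
    and "\<And>x y. sw_mem r x y =simp=> F x y \<in> carrier M"
  shows "aut M i j k l (sw M r F) = sw M r (\<lambda>x y. aut M i j k l (F x y))"
  using assms unfolding simp_implies_def
  by (intro linear_sw[of K M M "\<lambda>x. aut M i j k l x"] linear_map_aut linear_map_ident)

text \<open>Used with one or both tensors prescribed, which fixes the order in which the sums are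
  nested after rewriting.\<close>

lemma sw_swap_simp:
  assumes "Module.module K Z"
    and "\<And>x y z w. sw_mem r x y =simp=> sw_mem r' z w =simp=> F x y z w \<in> carrier Z"
  shows "sw Z r (\<lambda>x y. sw Z r' (F x y)) = sw Z r' (\<lambda>z w. sw Z r (\<lambda>x y. F x y z w))"
  using assms unfolding simp_implies_def by (rule sw_swap)

section \<open>The tensor product of two bimodules\<close>

lemma smult_ydl_tensor [simp]: "smult (ydl_tensor K H M N) = smult (tsp K M N)"
  by (simp add: ydl_tensor_def Let_def)

lemma tensor_sel [simp]:
  "lact (ydl_tensor K H M N) = (\<lambda>h r. sw (tsp K M N) (comult H h) (\<lambda>h1 h2. sw (tsp K M N) r (\<lambda>x y.
     tens K M N (lact M h1 x) (lact N h2 y))))"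
  "ract (ydl_tensor K H M N) = (\<lambda>r h. sw (tsp K M N) (comult H h) (\<lambda>h1 h2. sw (tsp K M N) r (\<lambda>x y.
     tens K M N (ract M x h1) (ract N y h2))))"
  "lcoact (ydl_tensor K H M N) = (\<lambda>r. sw (tsp K H (tsp K M N)) r (\<lambda>x y.
     sw (tsp K H (tsp K M N)) (lcoact M x) (\<lambda>a x0. sw (tsp K H (tsp K M N)) (lcoact N y) (\<lambda>b y0.
       tens K H (tsp K M N) (aut H (-1) 0 (-1) 0 a \<otimes>\<^bsub>H\<^esub> aut H 0 (-1) 0 (-1) b) (tens K M N x0 y0)))))"
  "rcoact (ydl_tensor K H M N) = (\<lambda>r. sw (tsp K (tsp K M N) H) r (\<lambda>x y.
     sw (tsp K (tsp K M N) H) (rcoact M x) (\<lambda>x0 a. sw (tsp K (tsp K M N) H) (rcoact N y) (\<lambda>y0 b.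
       tens K (tsp K M N) H (tens K M N x0 y0) (aut H (-1) 0 (-1) 0 a \<otimes>\<^bsub>H\<^esub> aut H 0 (-1) 0 (-1) b)))))"
  by (simp_all add: ydl_tensor_def Let_def)

lemma bilinear_mapI_simp:
  assumes "\<And>x. x \<in> carrier U =simp=> mem_info U x =simp=> linear_map K V W (F x)"
    and "\<And>y. y \<in> carrier V =simp=> mem_info V y =simp=> linear_map K U W (\<lambda>x. F x y)"
  shows "bilinear_map K U V W F"
  using assms by (auto simp: bilinear_map_def mem_info_def simp_implies_def)

lemma linear_aut_tmap:
  assumes m: "Module.module K M" "Module.module K N"
    and a: "linear_aut K M f" "linear_aut K N g"
  shows "linear_aut K (tsp K M N) (tmap K M N f g)"
proof -
  have l: "linear_map K M M f" "linear_map K N N g"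
    and b: "bij_betw f (carrier M) (carrier M)" "bij_betw g (carrier N) (carrier N)"
    using a by (auto simp: linear_aut_def)
  note i = linear_aut_inv[OF m(1) a(1)] linear_aut_inv[OF m(2) a(2)]
  note T = linear_map_tmap[OF m m]
  let ?j = "tmap K M N (inv_into (carrier M) f) (inv_into (carrier N) g)"
  have "bij_betw (tmap K M N f g) (carrier (tsp K M N)) (carrier (tsp K M N))"
    using linear_map_closed[OF T[OF l]] linear_map_closed[OF T[OF i]] b
    by (intro bij_betw_byWitness[where f' = ?j])
      (auto simp: tmap_tmap[OF m l i] tmap_tmap[OF m i l] tmap_ident[OF m]
        bij_betw_inv_into_left bij_betw_inv_into_right)
  then show ?thesis using T[OF l] by (simp add: linear_aut_def)
qed

lemma tmap_commute:
  assumes m: "Module.module K M" "Module.module K N"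
    and l: "linear_map K M M f" "linear_map K N N g" "linear_map K M M f'" "linear_map K N N g'"
    and c: "commute_on (carrier M) f f'" "commute_on (carrier N) g g'"
  shows "commute_on (carrier (tsp K M N)) (tmap K M N f g) (tmap K M N f' g')"
  unfolding commute_on_def
proof
  fix r assume r: "r \<in> carrier (tsp K M N)"
  have "tmap K M N (\<lambda>x. f (f' x)) (\<lambda>x. g (g' x)) r = tmap K M N (\<lambda>x. f' (f x)) (\<lambda>x. g' (g x)) r"
    unfolding tmap_def using c sw_memD[OF m r] by (intro sw_cong) (auto simp: commute_on_def)
  then show "tmap K M N f g (tmap K M N f' g' r) = tmap K M N f' g' (tmap K M N f g r)"
    by (simp add: tmap_tmap[OF m l(3,4,1,2) r] tmap_tmap[OF m l r])
qed

lemma tensor_auts: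
  "alpha (ydl_tensor K H M N) = tmap K M N (alpha M) (alpha N)"
  "beta (ydl_tensor K H M N) = tmap K M N (beta M) (beta N)"
  "omega (ydl_tensor K H M N) = tmap K M N (omega M) (omega N)"
  "psi (ydl_tensor K H M N) = tmap K M N (psi M) (psi N)"
  by (simp_all add: ydl_tensor_def Let_def del: struct_aut)

lemma tensor_commuting_auts [simp]:
  assumes m: "Module.module K M" "Module.module K N" and c: "commuting_auts K M" "commuting_auts K N"
  shows "commuting_auts K (ydl_tensor K H M N)"
proof -
  have a: "linear_aut K M f" "linear_aut K N g"
    if "f \<in> {alpha M, beta M, omega M, psi M}" "g \<in> {alpha N, beta N, omega N, psi N}" for f g
    using that c by (auto intro: commuting_autsD simp del: struct_aut)
  have l: "linear_map K M M f" "linear_map K N N g"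
    if "f \<in> {alpha M, beta M, omega M, psi M}" "g \<in> {alpha N, beta N, omega N, psi N}" for f g
    using a[OF that] by (auto simp: linear_aut_def)
  have "linear_aut K (ydl_tensor K H M N) (tmap K M N f g)"
    if "f \<in> {alpha M, beta M, omega M, psi M}" "g \<in> {alpha N, beta N, omega N, psi N}" for f g
    using linear_aut_tmap[OF m a[OF that]] by (simp add: linear_aut_def)
  moreover have "commute_on (carrier (ydl_tensor K H M N)) (tmap K M N f g) (tmap K M N f' g')"
    if "f \<in> {alpha M, beta M, omega M, psi M}" "g \<in> {alpha N, beta N, omega N, psi N}"
      "f' \<in> {alpha M, beta M, omega M, psi M}" "g' \<in> {alpha N, beta N, omega N, psi N}" for f g f' g'
    using tmap_commute[OF m l[OF that(1,2)] l[OF that(3,4)]] that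
      commuting_autsD(3)[OF c(1) that(1,3)] commuting_autsD(3)[OF c(2) that(2,4)] by simp
  ultimately show ?thesis
    unfolding commuting_auts_def tensor_auts by (simp del: struct_aut)
qed

lemma aut_tensor [simp]:
  assumes "Module.module K M" "Module.module K N" "commuting_auts K M" "commuting_auts K N"
    and "x \<in> carrier M" "y \<in> carrier N"
  shows "aut (ydl_tensor K H M N) i j k l (tens K M N x y) = tens K M N (aut M i j k l x) (aut N i j k l y)"
proof -
  have "linear_map K M M f" if "f \<in> {alpha M, beta M, omega M, psi M}" for f
    using that assms(3) commuting_autsD(1) unfolding linear_aut_def by blast
  moreover have "linear_map K N N g" if "g \<in> {alpha N, beta N, omega N, psi N}" for g
    using that assms(4) commuting_autsD(1) unfolding linear_aut_def by blast
  ultimately show ?thesis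
    using assms by (intro aut_transfer[of K M N]) (simp_all add: tensor_auts tmap_tens del: struct_aut)
qed

text \<open>\<open>tensor_same\<close> turns the codomain into \<open>tsp\<close> but keeps
  \<open>ydl_tensor\<close> inside \<open>aut\<close>, so \<open>linear_map_aut\<close> no longer
  matches. Closure and summation are restated below for the same reason.\<close>

lemma linear_map_aut_tensor [simp]:
  assumes "Module.module K M" "Module.module K N" "commuting_auts K M" "commuting_auts K N"
    and "linear_map K V (tsp K M N) e"
  shows "linear_map K V (tsp K M N) (\<lambda>x. aut (ydl_tensor K H M N) i j k l (e x))"
proof -
  have "linear_map K V (ydl_tensor K H M N) (\<lambda>x. aut (ydl_tensor K H M N) i j k l (e x))"
    by (rule linear_map_aut) (use assms in simp_all)
  then show ?thesis by (simp only: tensor_same)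
qed

lemma aut_tensor_closed [simp]:
  assumes "Module.module K M" "Module.module K N" "commuting_auts K M" "commuting_auts K N"
    and "r \<in> carrier (tsp K M N)"
  shows "aut (ydl_tensor K H M N) i j k l r \<in> carrier (tsp K M N)"
  using aut_closed[of K "ydl_tensor K H M N" r] assms by simp

lemma aut_tensor_sw [simp]:
  assumes "Module.module K M" "Module.module K N" "commuting_auts K M" "commuting_auts K N"
    and "\<And>x y. sw_mem r x y =simp=> F x y \<in> carrier (tsp K M N)"
  shows "aut (ydl_tensor K H M N) i j k l (sw (tsp K M N) r F)
    = sw (tsp K M N) r (\<lambda>x y. aut (ydl_tensor K H M N) i j k l (F x y))"
proof -
  let ?T = "ydl_tensor K H M N"
  have "aut ?T i j k l (sw ?T r F) = sw ?T r (\<lambda>x y. aut ?T i j k l (F x y))"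
    by (rule aut_sw) (use assms in simp_all)
  then show ?thesis by (simp only: tensor_same)
qed

lemma sw_mem_tens [simp]:
  assumes "Module.module K V" "Module.module K W" "a \<in> carrier V" "b \<in> carrier W"
  shows "sw_mem (tens K V W a b) x y \<longleftrightarrow>
      x \<in> carrier V \<and> y \<in> carrier W \<and> sw_elem (tens K V W a b) x y"
  by (rule sw_mem_iff[OF assms(1,2) tens_closed[OF assms(3,4)]])

lemma sw_mem_sw [simp]:
  assumes "Module.module K V" "Module.module K W" "\<And>x y. sw_mem r x y =simp=> F x y \<in> carrier (tsp K V W)"
  shows "sw_mem (sw (tsp K V W) r F) x y \<longleftrightarrow>
      x \<in> carrier V \<and> y \<in> carrier W \<and> sw_elem (sw (tsp K V W) r F) x y"
  by (rule sw_mem_iff[OF assms(1,2) sw_closed_simp[OF tsp_module[OF assms(1,2)] assms(3)]])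

lemma mem_info_tensor [simp]: "mem_info (ydl_tensor K H M N) x \<longleftrightarrow> mem_info (tsp K M N) x"
  by (simp add: mem_info_def)

lemma sw_mem_aut_tensor [simp]:
  assumes "Module.module K M" "Module.module K N" "commuting_auts K M" "commuting_auts K N"
    "r \<in> carrier (tsp K M N)"
  shows "sw_mem (aut (ydl_tensor K H M N) i j k l r) x y \<longleftrightarrow>
      x \<in> carrier M \<and> y \<in> carrier N \<and> sw_elem (aut (ydl_tensor K H M N) i j k l r) x y"
  by (rule sw_mem_iff[of K M N]) (use assms in simp_all)

lemma linear_map_sw_aut_tensor [simp]:
  assumes "Module.module K M" "Module.module K N" "commuting_auts K M" "commuting_auts K N"
    "Module.module K Z" "linear_map K U (tsp K M N) e"
    and "\<And>x. x \<in> carrier M =simp=> mem_info M x =simp=> linear_map K N Z (F x)"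
    and "\<And>y. y \<in> carrier N =simp=> mem_info N y =simp=> linear_map K M Z (\<lambda>x. F x y)"
  shows "linear_map K U Z (\<lambda>x. sw Z (aut (ydl_tensor K H M N) i j k l (e x)) F)"
  using assms unfolding simp_implies_def by (intro linear_map_sw[of K U M N]) simp_all

section \<open>The axioms of an object for the tensor product\<close>

lemma tensor_left_module:
  assumes M: "obj M" and N: "obj N"
  shows "left_module K H (ydl_tensor K H M N)"
proof -
  let ?T = "ydl_tensor K H M N"
  note [simp] = M N
  have "\<forall>r\<in>carrier (tsp K M N). aut ?T i j k l (lact ?T h r) = lact ?T (aut H i j k l h) (aut ?T i j k l r)"
    if "h \<in> carrier H" for h i j k l
    using that by (intro tsp_eqI[of K M N "tsp K M N"]) simp_all
  moreover have "\<forall>r\<in>carrier (tsp K M N). lact ?T (aut H 1 0 0 0 h) (lact ?T g r) = lact ?T (h \<otimes>\<^bsub>H\<^esub> g) (aut ?T 0 1 0 0 r)"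
    if "h \<in> carrier H" "g \<in> carrier H" for h g
    using that by (intro tsp_eqI[of K M N "tsp K M N"]) simp_all
  moreover have "\<forall>r\<in>carrier (tsp K M N). lact ?T \<one>\<^bsub>H\<^esub> r = aut ?T 0 1 0 0 r"
    by (intro tsp_eqI[of K M N "tsp K M N"]) simp_all
  moreover have "bilinear_map K H ?T ?T (lact ?T)"
    by (rule bilinear_mapI_simp) simp_all
  ultimately show ?thesis
    by (simp add: left_module_def theta_pairs_def)
qed


lemma tensor_right_module:
  assumes M: "obj M" and N: "obj N"
  shows "right_module K H (ydl_tensor K H M N)"
proof -
  let ?T = "ydl_tensor K H M N"
  note [simp] = M N
  have "\<forall>r\<in>carrier (tsp K M N). aut ?T i j k l (ract ?T r h) = ract ?T (aut ?T i j k l r) (aut H i j k l h)"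
    if "h \<in> carrier H" for h i j k l
    using that by (intro tsp_eqI[of K M N "tsp K M N"]) simp_all
  moreover have "\<forall>r\<in>carrier (tsp K M N). ract ?T (ract ?T r h) (aut H 0 1 0 0 g) = ract ?T (aut ?T 1 0 0 0 r) (h \<otimes>\<^bsub>H\<^esub> g)"
    if "h \<in> carrier H" "g \<in> carrier H" for h g
    \<comment> \<open>Acting on the right by \<open>h\<close> and then by \<open>g\<close> puts the
      sum over the coproduct of \<open>g\<close> outside; multiplicativity of the coproduct puts it
      inside.\<close>
    using that by (intro tsp_eqI[of K M N "tsp K M N"])
      (simp_all add: sw_swap_simp[where r = "comult H g"])
  moreover have "\<forall>r\<in>carrier (tsp K M N). ract ?T r \<one>\<^bsub>H\<^esub> = aut ?T 1 0 0 0 r"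
    by (intro tsp_eqI[of K M N "tsp K M N"]) simp_all
  moreover have "bilinear_map K ?T H ?T (ract ?T)"
    by (rule bilinear_mapI_simp) simp_all
  ultimately show ?thesis
    by (simp add: right_module_def theta_pairs_def)
qed

lemma tensor_bimodule:
  assumes M: "obj M" and N: "obj N"
  shows "bimodule K H (ydl_tensor K H M N)"
proof -
  let ?T = "ydl_tensor K H M N"
  note [simp] = M N
  have "\<forall>r\<in>carrier (tsp K M N). lact ?T (aut H 1 0 0 0 h) (ract ?T r g) = ract ?T (lact ?T h r) (aut H 0 1 0 0 g)"
    if "h \<in> carrier H" "g \<in> carrier H" for h g
    using that by (intro tsp_eqI[of K M N "tsp K M N"]) (simp_all add: sw_swap_simp[where r = "comult H g"])
  then show ?thesis
    using tensor_left_module[OF M N] tensor_right_module[OF M N] by (simp add: bimodule_def)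
qed

lemma tensor_left_comodule:
  assumes M: "obj M" and N: "obj N"
  shows "left_comodule K H (ydl_tensor K H M N)"
proof -
  let ?T = "ydl_tensor K H M N" and ?S = "tsp K M N"
  note [simp] = M N
  have "\<forall>r\<in>carrier ?S. lcoact ?T (aut ?T i j k l r) = tmap K H ?T (aut H i j k l) (aut ?T i j k l) (lcoact ?T r)"
    for i j k l
    by (intro tsp_eqI[of K M N "tsp K H ?S"]) (simp_all add: tmap_def algebra_simps)
  moreover have "\<forall>r\<in>carrier ?S. sw (tsp3 K H H ?S) (lcoact ?T r) (\<lambda>a x. sw (tsp3 K H H ?S) (comult H a) (\<lambda>a1 a2.
            tens3 K H H ?S a1 a2 (aut ?T 0 0 0 1 x)))
        = sw (tsp3 K H H ?S) (lcoact ?T r) (\<lambda>a x. sw (tsp3 K H H ?S) (lcoact ?T x) (\<lambda>b y.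
            tens3 K H H ?S (aut H 0 0 1 0 a) b y))"
    \<comment> \<open>After the exchanges each coproduct or second coaction stands directly below
      the coaction of its own factor, so coassociativity applies to \<open>M\<close> and to
      \<open>N\<close> separately.\<close>
    by (intro tsp_eqI[of K M N "tsp3 K H H ?S"])
      (simp_all add: sw_swap_simp[of Z "lcoact N y" "comult H a" for Z y a]
        sw_swap_simp[of Z "lcoact N y" "lcoact M x" for Z x y] lcoact_coassoc)
  moreover have "\<forall>r\<in>carrier ?S. sw ?S (lcoact ?T r) (\<lambda>a x. counit H a \<odot>\<^bsub>?S\<^esub> x) = aut ?T 0 0 0 1 r"
    by (intro tsp_eqI[of K M N ?S]) simp_all
  ultimately show ?thesis
    by (simp add: left_comodule_def theta_pairs_def)
qed


lemma tensor_right_comodule: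
  assumes M: "obj M" and N: "obj N"
  shows "right_comodule K H (ydl_tensor K H M N)"
proof -
  let ?T = "ydl_tensor K H M N" and ?S = "tsp K M N"
  note [simp] = M N
  have "\<forall>r\<in>carrier ?S. rcoact ?T (aut ?T i j k l r) = tmap K ?T H (aut ?T i j k l) (aut H i j k l) (rcoact ?T r)"
    for i j k l
    by (intro tsp_eqI[of K M N "tsp K ?S H"]) (simp_all add: tmap_def algebra_simps)
  moreover have "\<forall>r\<in>carrier ?S. sw (tsp3 K ?S H H) (rcoact ?T r) (\<lambda>x a. sw (tsp3 K ?S H H) (comult H a) (\<lambda>a1 a2.
            tens3 K ?S H H (aut ?T 0 0 1 0 x) a1 a2))
        = sw (tsp3 K ?S H H) (rcoact ?T r) (\<lambda>x a. sw (tsp3 K ?S H H) (rcoact ?T x) (\<lambda>y b.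
            tens3 K ?S H H y b (aut H 0 0 0 1 a)))"
    by (intro tsp_eqI[of K M N "tsp3 K ?S H H"])
      (simp_all add: sw_swap_simp[of Z "rcoact N y" "comult H a" for Z y a]
        sw_swap_simp[of Z "rcoact N y" "rcoact M x" for Z x y] rcoact_coassoc)
  moreover have "\<forall>r\<in>carrier ?S. sw ?S (rcoact ?T r) (\<lambda>x a. counit H a \<odot>\<^bsub>?S\<^esub> x) = aut ?T 0 0 1 0 r"
    by (intro tsp_eqI[of K M N ?S]) simp_all
  ultimately show ?thesis
    by (simp add: right_comodule_def theta_pairs_def)
qed

lemma tensor_bicomodule:
  assumes M: "obj M" and N: "obj N"
  shows "bicomodule K H (ydl_tensor K H M N)"
proof -
  let ?T = "ydl_tensor K H M N" and ?S = "tsp K M N"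
  note [simp] = M N
  have "\<forall>r\<in>carrier ?S. sw (tsp3 K H ?S H) (lcoact ?T r) (\<lambda>a x. sw (tsp3 K H ?S H) (rcoact ?T x) (\<lambda>y b.
            tens3 K H ?S H (aut H 0 0 1 0 a) y b))
        = sw (tsp3 K H ?S H) (rcoact ?T r) (\<lambda>x b. sw (tsp3 K H ?S H) (lcoact ?T x) (\<lambda>a y.
            tens3 K H ?S H a y (aut H 0 0 0 1 b)))"
    by (intro tsp_eqI[of K M N "tsp3 K H ?S H"])
      (simp_all add: sw_swap_simp[of Z "lcoact N y" "rcoact M x" for Z x y]
        sw_swap_simp[of Z "rcoact N y" "lcoact M x" for Z x y]
        sw_swap_simp[of Z "lcoact N y" "lcoact M x" for Z x y]
        sw_swap_simp[of Z "rcoact N y" "rcoact M x" for Z x y] coact_commute)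
  then show ?thesis
    using tensor_left_comodule[OF M N] tensor_right_comodule[OF M N] by (simp add: bicomodule_def)
qed

lemma tensor_rcoact_lact:
  assumes "obj M" "obj N" "h \<in> carrier H"
  shows "\<forall>r\<in>carrier (tsp K M N). rcoact (ydl_tensor K H M N) (lact (ydl_tensor K H M N) h r)
        = sw (tsp K (tsp K M N) H) (rcoact (ydl_tensor K H M N) r) (\<lambda>x a.
            tens K (tsp K M N) H (lact (ydl_tensor K H M N) (aut H 0 0 1 0 h) x) (aut H 0 1 0 0 a))"
  by (intro tsp_eqI[of K M N "tsp K (tsp K M N) H"])
    (simp_all add: assms sw_swap_simp[where r = "comult H h"])

lemma tensor_lcoact_ract:
  assumes "obj M" "obj N" "h \<in> carrier H"
  shows "\<forall>r\<in>carrier (tsp K M N). lcoact (ydl_tensor K H M N) (ract (ydl_tensor K H M N) r h)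
        = sw (tsp K H (tsp K M N)) (lcoact (ydl_tensor K H M N) r) (\<lambda>a x.
            tens K H (tsp K M N) (aut H 1 0 0 0 a) (ract (ydl_tensor K H M N) x (aut H 0 0 0 1 h)))"
  by (intro tsp_eqI[of K M N "tsp K H (tsp K M N)"])
    (simp_all add: assms sw_swap_simp[where r = "comult H h"])


declare module.smult_one [where R = K, simp]

text \<open>The component of \<open>h\<close> that multiplies from the right has to pass the
  coactions of both factors. Coassociativity first groups it with the component acting on
  \<open>N\<close>, so that (i) for \<open>N\<close> applies, and then with the one acting on
  \<open>M\<close>, so that (i) for \<open>M\<close> applies.\<close>

lemma tensor_ydl_left:
  assumes M: "obj M" and N: "obj N" and h: "h \<in> carrier H"
  shows "\<forall>r\<in>carrier (tsp K M N).
        sw (tsp K H (tsp K M N)) (comult H h) (\<lambda>h1 h2.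
          sw (tsp K H (tsp K M N)) (lcoact (ydl_tensor K H M N) (lact (ydl_tensor K H M N) (aut H s (p + 1) q (t + 1) h1) r)) (\<lambda>a y.
            tens K H (tsp K M N) (a \<otimes>\<^bsub>H\<^esub> aut H 1 (-1) 1 (-1) h2) y))
        = sw (tsp K H (tsp K M N)) (comult H h) (\<lambda>h1 h2. sw (tsp K H (tsp K M N)) (lcoact (ydl_tensor K H M N) r) (\<lambda>a y.
            tens K H (tsp K M N) (h1 \<otimes>\<^bsub>H\<^esub> aut H 1 0 0 0 a) (lact (ydl_tensor K H M N) (aut H s (p + 1) (q + 1) (t + 1) h2) y)))"
    (is "\<forall>r\<in>_. ?L r = ?R r")
proof (intro tsp_eqI[of K M N "tsp K H (tsp K M N)"])
  let ?S = "tsp K M N" and ?A = "aut H s (p + 1) q (t + 1)" and ?B = "aut H s (p + 1) (q + 1) (t + 1)"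
  let ?Z = "tsp K H ?S"
  let ?\<Phi> = "\<lambda>c x y. tens K H ?S c (tens K M N x y)"
  note [simp] = M N h
  fix x y assume x [simp]: "x \<in> carrier M" and y [simp]: "y \<in> carrier N"
  note swap = sw_swap_simp[of Z "comult H g" "lcoact M w" for Z g w]
  \<comment> \<open>\<open>?G\<close>, \<open>?G1\<close> and \<open>?G2\<close> are the stages of
    this passage: the multiplying component stands to the right of both coaction components, between
    them, and to the left of both. Exponents are written as the simplifier leaves them.\<close>
  let ?G = "\<lambda>u w g. sw ?Z (lcoact M (lact M (?A u) x)) (\<lambda>a x0. sw ?Z (lcoact N (lact N (?A w) y)) (\<lambda>b y0.
      ?\<Phi> (aut H 0 0 (-1) 0 a \<otimes>\<^bsub>H\<^esub> (aut H 0 (-1) 0 (-1) b \<otimes>\<^bsub>H\<^esub> aut H 1 (-2) 1 (-1) g)) x0 y0))"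
  let ?G1 = "\<lambda>u w g. sw ?Z (lcoact M (lact M (?B u) x)) (\<lambda>a x0. sw ?Z (lcoact N y) (\<lambda>b y0.
      ?\<Phi> (aut H 0 0 (-1) 0 a \<otimes>\<^bsub>H\<^esub> (aut H 0 (-1) 0 (-1) w \<otimes>\<^bsub>H\<^esub> aut H 1 (-1) 0 (-1) b)) x0 (lact N (?B g) y0)))"
  let ?G2 = "\<lambda>u w g. sw ?Z (lcoact M x) (\<lambda>a x0. sw ?Z (lcoact N y) (\<lambda>b y0.
      ?\<Phi> (aut H 0 0 (-1) 0 u \<otimes>\<^bsub>H\<^esub> (aut H 0 0 (-1) 0 a \<otimes>\<^bsub>H\<^esub> aut H 1 (-1) 0 (-1) b))
         (lact M (?B w) x0) (lact N (aut H s (p + 1) (q + 1) (2 + t) g) y0)))"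
  have N': "sw ?Z (comult H g) (\<lambda>u w. sw ?Z (lcoact N (lact N (?A u) y)) (\<lambda>b y0.
        ?\<Phi> (c \<otimes>\<^bsub>H\<^esub> (aut H 0 (-1) 0 (-1) b \<otimes>\<^bsub>H\<^esub> aut H 1 (-2) 1 (-2) w)) x0 y0))
      = sw ?Z (comult H g) (\<lambda>u w. sw ?Z (lcoact N y) (\<lambda>b y0.
        ?\<Phi> (c \<otimes>\<^bsub>H\<^esub> (aut H 0 (-1) 0 (-1) u \<otimes>\<^bsub>H\<^esub> aut H 1 (-1) 0 (-1) b)) x0 (lact N (?B w) y0)))"
    if "c \<in> carrier H" "x0 \<in> carrier M" "g \<in> carrier H" for c x0 g
    using ydl_left[OF N y that(3), of ?Z "\<lambda>d y0. ?\<Phi> (c \<otimes>\<^bsub>H\<^esub> aut H 0 (-1) 0 (-1) d) x0 y0"] that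
    by simp
  have M': "sw ?Z (comult H g) (\<lambda>u w. sw ?Z (lcoact M (lact M (?A u) x)) (\<lambda>a x0. sw ?Z (lcoact N y) (\<lambda>b y0.
        ?\<Phi> (aut H 0 0 (-1) 0 a \<otimes>\<^bsub>H\<^esub> (aut H 0 (-1) 0 (-1) w \<otimes>\<^bsub>H\<^esub> aut H 1 (-1) 0 (-1) b)) x0
          (lact N (aut H s (p + 1) (q + 1) (2 + t) k) y0))))
      = sw ?Z (comult H g) (\<lambda>u w. ?G2 u w k)"
    if "g \<in> carrier H" "k \<in> carrier H" for g k
    using ydl_left[OF M x that(1), of ?Z "\<lambda>c x0. sw ?Z (lcoact N y) (\<lambda>b y0.
        ?\<Phi> (aut H (-1) 0 (-1) 0 c \<otimes>\<^bsub>H\<^esub> aut H 1 0 0 (-1) b) x0 (lact N (aut H s (p + 1) (q + 1) (2 + t) k) y0))"] that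
    by simp
  have "?L (tens K M N x y) = sw ?Z (comult H h) (\<lambda>h1 h2. sw ?Z (comult H h1) (\<lambda>u w. ?G u w h2))"
    by simp
  also have "\<dots> = sw ?Z (comult H h) (\<lambda>h1 h2. sw ?Z (comult H h2) (\<lambda>u w. ?G (aut H 0 0 1 0 h1) u (aut H 0 0 0 (-1) w)))"
    by (rule comult_coassoc) simp_all
  also have "\<dots> = sw ?Z (comult H h) (\<lambda>h1 h2. sw ?Z (comult H h2) (\<lambda>u w. ?G1 h1 u w))"
    by (simp add: swap N')
  also have "\<dots> = sw ?Z (comult H h) (\<lambda>h1 h2. sw ?Z (comult H h1) (\<lambda>u w. ?G1 (aut H 0 0 (-1) 0 u) w (aut H 0 0 0 1 h2)))"
    by (rule comult_coassoc') simp_all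
  also have "\<dots> = sw ?Z (comult H h) (\<lambda>h1 h2. sw ?Z (comult H h1) (\<lambda>u w. ?G2 u w h2))"
    by (simp add: M')
  also have "\<dots> = sw ?Z (comult H h) (\<lambda>h1 h2. sw ?Z (comult H h2) (\<lambda>u w. ?G2 (aut H 0 0 1 0 h1) u (aut H 0 0 0 (-1) w)))"
    by (rule comult_coassoc) simp_all
  also have "\<dots> = ?R (tens K M N x y)"
    by (simp add: swap sw_swap_simp[of Z "comult H g" "lcoact N w" for Z g w] add_ac)
  finally show "?L (tens K M N x y) = ?R (tens K M N x y)" .
qed (use M N h in simp_all)


text \<open>Mirror image: the multiplying component starts on the left, so it passes the coaction of
  \<open>M\<close> by (iii) for \<open>M\<close> before that of \<open>N\<close>.\<close>

lemma tensor_ydl_right: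
  assumes M: "obj M" and N: "obj N" and h: "h \<in> carrier H"
  shows "\<forall>r\<in>carrier (tsp K M N).
        sw (tsp K (tsp K M N) H) (comult H h) (\<lambda>h1 h2.
          sw (tsp K (tsp K M N) H) (rcoact (ydl_tensor K H M N) (ract (ydl_tensor K H M N) r (aut H (m + 1) u (v + 1) n h2))) (\<lambda>y a.
            tens K (tsp K M N) H y (aut H (-1) 1 (-1) 1 h1 \<otimes>\<^bsub>H\<^esub> a)))
        = sw (tsp K (tsp K M N) H) (comult H h) (\<lambda>h1 h2. sw (tsp K (tsp K M N) H) (rcoact (ydl_tensor K H M N) r) (\<lambda>y a.
            tens K (tsp K M N) H (ract (ydl_tensor K H M N) y (aut H (m + 1) u (v + 1) (n + 1) h1)) (aut H 0 1 0 0 a \<otimes>\<^bsub>H\<^esub> h2)))"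
    (is "\<forall>r\<in>_. ?L r = ?R r")
proof (intro tsp_eqI[of K M N "tsp K (tsp K M N) H"])
  let ?S = "tsp K M N" and ?A = "aut H (m + 1) u (v + 1) n" and ?B = "aut H (m + 1) u (v + 1) (n + 1)"
  let ?Z = "tsp K ?S H"
  let ?\<Phi> = "\<lambda>x y c. tens K ?S H (tens K M N x y) c"
  note [simp] = M N h
  fix x y assume x [simp]: "x \<in> carrier M" and y [simp]: "y \<in> carrier N"
  note swap = sw_swap_simp[of Z "comult H g" "rcoact M w" for Z g w]
  let ?G = "\<lambda>g k w. sw ?Z (rcoact M (ract M x (?A k))) (\<lambda>x0 a. sw ?Z (rcoact N (ract N y (?A w))) (\<lambda>y0 b.
      ?\<Phi> x0 y0 (aut H (-1) 1 (-1) 1 g \<otimes>\<^bsub>H\<^esub> (aut H (-1) 0 (-1) 0 a \<otimes>\<^bsub>H\<^esub> aut H 0 (-1) 0 (-1) b))))"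
  let ?G1 = "\<lambda>g k w. sw ?Z (rcoact M x) (\<lambda>x0 a. sw ?Z (rcoact N (ract N y (?B w))) (\<lambda>y0 b.
      ?\<Phi> (ract M x0 (?B g)) y0 (aut H 0 1 (-1) 0 a \<otimes>\<^bsub>H\<^esub> (aut H (-1) 0 (-1) 0 k \<otimes>\<^bsub>H\<^esub> aut H 0 (-1) 0 (-1) b))))"
  let ?G2 = "\<lambda>g k w. sw ?Z (rcoact M x) (\<lambda>x0 a. sw ?Z (rcoact N y) (\<lambda>y0 b.
      ?\<Phi> (ract M x0 (aut H (m + 1) u (2 + v) (n + 1) g)) (ract N y0 (?B k))
        (aut H 0 1 (-1) 0 a \<otimes>\<^bsub>H\<^esub> (aut H 0 0 0 (-1) b \<otimes>\<^bsub>H\<^esub> aut H 0 (-1) 0 (-1) w))))"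
  have M': "sw ?Z (comult H g) (\<lambda>c w. sw ?Z (rcoact M (ract M x (?A w))) (\<lambda>x0 a. sw ?Z (rcoact N (ract N y (?B k))) (\<lambda>y0 b.
        ?\<Phi> x0 y0 (aut H (-1) 1 (-2) 1 c \<otimes>\<^bsub>H\<^esub> (aut H (-1) 0 (-1) 0 a \<otimes>\<^bsub>H\<^esub> aut H 0 (-1) 0 (-1) b)))))
      = sw ?Z (comult H g) (\<lambda>c w. ?G1 c w k)"
    if "g \<in> carrier H" "k \<in> carrier H" for g k
    using ydl_right[OF M x that(1), of ?Z "\<lambda>x0 c. sw ?Z (rcoact N (ract N y (?B k))) (\<lambda>y0 b.
        ?\<Phi> x0 y0 (aut H (-1) 0 (-1) 0 c \<otimes>\<^bsub>H\<^esub> aut H 0 0 0 (-1) b))"] that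
    by simp
  have N': "sw ?Z (comult H g) (\<lambda>k w. sw ?Z (rcoact N (ract N y (?A w))) (\<lambda>y0 b.
        ?\<Phi> x0 y0 (c \<otimes>\<^bsub>H\<^esub> (aut H (-1) 0 (-1) 0 k \<otimes>\<^bsub>H\<^esub> aut H 0 (-1) 0 (-1) b))))
      = sw ?Z (comult H g) (\<lambda>k w. sw ?Z (rcoact N y) (\<lambda>y0 b.
        ?\<Phi> x0 (ract N y0 (?B k)) (c \<otimes>\<^bsub>H\<^esub> (aut H 0 0 0 (-1) b \<otimes>\<^bsub>H\<^esub> aut H 0 (-1) 0 (-1) w))))"
    if "c \<in> carrier H" "x0 \<in> carrier M" "g \<in> carrier H" for c x0 g
    using ydl_right[OF N y that(3), of ?Z "\<lambda>y0 d. ?\<Phi> x0 y0 (c \<otimes>\<^bsub>H\<^esub> aut H 0 (-1) 0 (-1) d)"] that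
    by simp
  have "?L (tens K M N x y) = sw ?Z (comult H h) (\<lambda>h1 h2. sw ?Z (comult H h2) (\<lambda>k w. ?G h1 k w))"
    by simp
  also have "\<dots> = sw ?Z (comult H h) (\<lambda>h1 h2. sw ?Z (comult H h1) (\<lambda>c w. ?G (aut H 0 0 (-1) 0 c) w (aut H 0 0 0 1 h2)))"
    by (rule comult_coassoc') simp_all
  also have "\<dots> = sw ?Z (comult H h) (\<lambda>h1 h2. sw ?Z (comult H h1) (\<lambda>c w. ?G1 c w h2))"
    by (simp add: M')
  also have "\<dots> = sw ?Z (comult H h) (\<lambda>h1 h2. sw ?Z (comult H h2) (\<lambda>k w. ?G1 (aut H 0 0 1 0 h1) k (aut H 0 0 0 (-1) w)))"
    by (rule comult_coassoc) simp_all
  also have "\<dots> = sw ?Z (comult H h) (\<lambda>h1 h2. sw ?Z (comult H h2) (\<lambda>k w. ?G2 h1 k w))"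
    by (simp add: swap N')
  also have "\<dots> = sw ?Z (comult H h) (\<lambda>h1 h2. sw ?Z (comult H h1) (\<lambda>c w. ?G2 (aut H 0 0 (-1) 0 c) w (aut H 0 0 0 1 h2)))"
    by (rule comult_coassoc') simp_all
  also have "\<dots> = ?R (tens K M N x y)"
    by (simp add: swap sw_swap_simp[of Z "comult H g" "rcoact N w" for Z g w] add_ac)
  finally show "?L (tens K M N x y) = ?R (tens K M N x y)" .
qed (use M N h in simp_all)

lemma tensor_obj:
  assumes "obj M" "obj N"
  shows "obj (ydl_tensor K H M N)"
  using assms tensor_bimodule tensor_bicomodule tensor_rcoact_lact tensor_lcoact_ract tensor_ydl_left tensor_ydl_right
  unfolding ydl_bimodule_def by (simp del: tensor_sel)

section \<open>The unit object\<close>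

lemma scalar_module [simp]: "Module.module K (scalar_space K)"
proof (rule moduleI)
  show "abelian_group (scalar_space K)"
    by (rule abelian_groupI)
      (auto simp: scalar_space_def K.a_ac intro!: bexI[of _ "Scalar (\<ominus>\<^bsub>K\<^esub> _)"] K.l_neg)
qed (auto simp: scalar_space_def K.is_cring K.l_distr K.r_distr K.m_assoc)

lemma unit_sel [simp]:
  "alpha (ydl_unit K H) = id" "beta (ydl_unit K H) = id" "omega (ydl_unit K H) = id" "psi (ydl_unit K H) = id"
  "lact (ydl_unit K H) = (\<lambda>h x. counit H h \<odot>\<^bsub>scalar_space K\<^esub> x)"
  "ract (ydl_unit K H) = (\<lambda>x h. counit H h \<odot>\<^bsub>scalar_space K\<^esub> x)"
  "lcoact (ydl_unit K H) = (\<lambda>x. tens K H (scalar_space K) \<one>\<^bsub>H\<^esub> x)"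
  "rcoact (ydl_unit K H) = (\<lambda>x. tens K (scalar_space K) H x \<one>\<^bsub>H\<^esub>)"
  "smult (ydl_unit K H) = smult (scalar_space K)"
  by (simp_all add: ydl_unit_def Let_def del: struct_aut)

lemma unit_aut [simp]: "x \<in> carrier (scalar_space K) \<Longrightarrow> aut (ydl_unit K H) i j k l x = x"
  by (simp add: aut_def zpow_id del: struct_aut)

lemma smult_left_commute:
  assumes "Module.module K V" "a \<in> carrier K" "b \<in> carrier K" "x \<in> carrier V"
  shows "a \<odot>\<^bsub>V\<^esub> (b \<odot>\<^bsub>V\<^esub> x) = b \<odot>\<^bsub>V\<^esub> (a \<odot>\<^bsub>V\<^esub> x)"
  using assms by (metis K.m_comm module.smult_assoc1)

lemma unit_commuting_auts [simp]: "commuting_auts K (ydl_unit K H)"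
  by (simp add: commuting_auts_def commute_on_def linear_aut_def id_def linear_map_ident
      bij_betw_def inj_on_def del: struct_aut)

lemma unit_obj: "obj (ydl_unit K H)"
proof -
  let ?I = "ydl_unit K H" and ?J = "scalar_space K"
  have l: "left_module K H ?I"
    by (auto simp: left_module_def theta_pairs_def intro!: bilinear_mapI)
  have r: "right_module K H ?I"
    by (auto simp: right_module_def theta_pairs_def smult_left_commute intro!: bilinear_mapI)
  have b: "bimodule K H ?I"
    using l r by (simp add: bimodule_def smult_left_commute)
  have lc: "left_comodule K H ?I"
    by (simp add: left_comodule_def theta_pairs_def tmap_def)
  have rc: "right_comodule K H ?I"
    by (simp add: right_comodule_def theta_pairs_def tmap_def)
  have bc: "bicomodule K H ?I"
    using lc rc by (simp add: bicomodule_def)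
  show ?thesis
    using b bc by (simp add: ydl_bimodule_def)
qed


section \<open>Morphisms\<close>

abbreviation mor :: "('k, 'a) ydlobj \<Rightarrow> ('k, 'a) ydlobj \<Rightarrow> (('k, 'a) univ \<Rightarrow> ('k, 'a) univ) \<Rightarrow> bool" where
  "mor \<equiv> ydl_morphism K H"

abbreviation C :: "(('k, 'a) ydlobj, ('k, 'a) ydlarr) moncat" where
  "C \<equiv> LR K H m n p q s t u v"

text \<open>Compatibility with the four automorphisms is asked for all exponents at once, which is
  the form in which twists occur after normalisation.\<close>

lemma morI:
  assumes "obj M" "obj N" "linear_map K M N f"
    and "\<And>i j k l. \<forall>x\<in>carrier M. f (aut M i j k l x) = aut N i j k l (f x)"
    and "\<And>h. h \<in> carrier H \<Longrightarrow> \<forall>x\<in>carrier M. f (lact M h x) = lact N h (f x)"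
    and "\<And>h. h \<in> carrier H \<Longrightarrow> \<forall>x\<in>carrier M. f (ract M x h) = ract N (f x) h"
    and "\<forall>x\<in>carrier M. lcoact N (f x) = sw (tsp K H N) (lcoact M x) (\<lambda>a y. tens K H N a (f y))"
    and "\<forall>x\<in>carrier M. rcoact N (f x) = sw (tsp K N H) (rcoact M x) (\<lambda>y a. tens K N H (f y) a)"
  shows "mor M N f"
  using assms by (simp add: ydl_morphism_def tmap_def)

lemma morD:
  assumes "obj M" "obj N" "mor M N f"
  shows "linear_map K M N f" "x \<in> carrier M \<Longrightarrow> f x \<in> carrier N"
    "linear_map K V M e \<Longrightarrow> linear_map K V N (\<lambda>x. f (e x))"
    "x \<in> carrier M \<Longrightarrow> f (aut M i j k l x) = aut N i j k l (f x)"
    "\<lbrakk>h \<in> carrier H; x \<in> carrier M\<rbrakk> \<Longrightarrow> f (lact M h x) = lact N h (f x)"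
    "\<lbrakk>h \<in> carrier H; x \<in> carrier M\<rbrakk> \<Longrightarrow> f (ract M x h) = ract N (f x) h"
    "x \<in> carrier M \<Longrightarrow> lcoact N (f x) = sw (tsp K H N) (lcoact M x) (\<lambda>a y. tens K H N a (f y))"
    "x \<in> carrier M \<Longrightarrow> rcoact N (f x) = sw (tsp K N H) (rcoact M x) (\<lambda>y a. tens K N H (f y) a)"
    "(\<And>x y. sw_mem r x y =simp=> F x y \<in> carrier M) \<Longrightarrow> f (sw M r F) = sw N r (\<lambda>x y. f (F x y))"
proof -
  show l: "linear_map K M N f" using assms(3) by (simp add: ydl_morphism_def)
  show "x \<in> carrier M \<Longrightarrow> f x \<in> carrier N" using l by (rule linear_map_closed)
  show "linear_map K V M e \<Longrightarrow> linear_map K V N (\<lambda>x. f (e x))" by (rule linear_map_comp[OF l])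
  show "x \<in> carrier M \<Longrightarrow> f (aut M i j k l x) = aut N i j k l (f x)"
  proof -
    have "f (alpha M x) = alpha N (f x) \<and> f (beta M x) = beta N (f x) \<and>
      f (omega M x) = omega N (f x) \<and> f (psi M x) = psi N (f x)" if "x \<in> carrier M" for x
      using assms(3) that unfolding ydl_morphism_def by blast
    then show "f (aut M i j k l x) = aut N i j k l (f x)" if "x \<in> carrier M"
      using that linear_map_closed[OF l] assms
      by (intro aut_transfer[where A = M and B = M and C = N and F = "\<lambda>x y. f x" and a = x and b = x
            and K = K, symmetric]) (simp_all del: struct_aut)
  qed
  show "\<lbrakk>h \<in> carrier H; x \<in> carrier M\<rbrakk> \<Longrightarrow> f (lact M h x) = lact N h (f x)"
    "\<lbrakk>h \<in> carrier H; x \<in> carrier M\<rbrakk> \<Longrightarrow> f (ract M x h) = ract N (f x) h"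
    "x \<in> carrier M \<Longrightarrow> lcoact N (f x) = sw (tsp K H N) (lcoact M x) (\<lambda>a y. tens K H N a (f y))"
    "x \<in> carrier M \<Longrightarrow> rcoact N (f x) = sw (tsp K N H) (rcoact M x) (\<lambda>y a. tens K N H (f y) a)"
    using assms(3) by (simp_all add: ydl_morphism_def tmap_def)
  show "(\<And>x y. sw_mem r x y =simp=> F x y \<in> carrier M) \<Longrightarrow> f (sw M r F) = sw N r (\<lambda>x y. f (F x y))"
    using assms l unfolding simp_implies_def by (intro linear_sw[of K M N]) simp_all
qed

lemma mor_cong:
  assumes "obj M" "obj N" "mor M N f" "\<And>x. x \<in> carrier M \<Longrightarrow> f x = g x"
  shows "mor M N g"
proof (rule morI)
  note D = morD[OF assms(1-3)]
  show "linear_map K M N g"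
    using D(1) linear_map_cong[of M f g K N] assms(4) obj_simps(1)[OF assms(1)] by blast
qed (simp_all add: assms(1,2) morD[OF assms(1-3)] assms(4)[symmetric])

lemma mor_comp:
  assumes "obj M" "obj N" "obj P" "mor M N f" "mor N P g"
  shows "mor M P (\<lambda>x. g (f x))"
proof -
  note [simp] = assms(1-3) morD[OF assms(1,2,4)] morD[OF assms(2,3,5)]
  show ?thesis by (rule morI) simp_all
qed

lemma mor_id: "obj M \<Longrightarrow> mor M M (\<lambda>x. x)"
  by (rule morI) (simp_all add: sw_tens_id)

lemma mor_inverse:
  assumes M: "obj M" and N: "obj N" and f: "mor M N f"
    and g: "\<And>y. y \<in> carrier N \<Longrightarrow> g y \<in> carrier M" "\<And>y. y \<in> carrier N \<Longrightarrow> f (g y) = y"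
      "\<And>x. x \<in> carrier M \<Longrightarrow> g (f x) = x"
  shows "mor N M g"
proof -
  note D = morD[OF M N f]
  note [simp] = M N g
  have l: "linear_map K N M g"
  proof (rule linear_mapI)
    fix x y assume "x \<in> carrier N" "y \<in> carrier N"
    then show "g (x \<oplus>\<^bsub>N\<^esub> y) = g x \<oplus>\<^bsub>M\<^esub> g y"
      using g(3)[of "g x \<oplus>\<^bsub>M\<^esub> g y"] obj_simps(1)[OF M]
      by (simp add: linear_map_add[OF D(1)] module.axioms abelian_groupE(1))
  next
    fix a x assume "a \<in> carrier K" "x \<in> carrier N"
    then show "g (a \<odot>\<^bsub>N\<^esub> x) = a \<odot>\<^bsub>M\<^esub> g x"
      using g(3)[of "a \<odot>\<^bsub>M\<^esub> g x"] by (simp add: linear_map_smult[OF D(1)])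
  qed (simp)
  have lg: "linear_map K V M (\<lambda>x. g (e x))" if "linear_map K V N e" for V :: "('k, ('k, 'a) univ) module" and e
    using linear_map_comp[OF l that] .
  \<comment> \<open>The identities for automorphisms and actions are all checked after applying
    \<open>f\<close>, which is injective with left inverse \<open>g\<close>.\<close>
  have gf: "g y = x" if "y = f x" "x \<in> carrier M" for x y using that g(3) by simp
  show ?thesis
  proof (rule morI[OF N M l]; intro ballI)
    fix x assume x: "x \<in> carrier N"
    show "g (aut N i j k l x) = aut M i j k l (g x)" for i j k l
      by (rule gf) (use x in \<open>simp_all add: D\<close>)
    show "g (lact N h x) = lact M h (g x)" if "h \<in> carrier H" for h
      by (rule gf) (use x that in \<open>simp_all add: D\<close>)
    show "g (ract N x h) = ract M (g x) h" if "h \<in> carrier H" for h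
      by (rule gf) (use x that in \<open>simp_all add: D\<close>)
    have gx: "g x \<in> carrier M" using x by simp
    \<comment> \<open>Colinearity of \<open>f\<close> at \<open>g x\<close>, with \<open>g\<close>
      applied to the module component: there \<open>g\<close> and \<open>f\<close> cancel and the
      original coaction remains.\<close>
    have "sw (tsp K H M) (lcoact N (f (g x))) (\<lambda>a y. tens K H M a (g y)) = sw (tsp K H M) (lcoact M (g x)) (tens K H M)"
      using gx l by (simp add: D(2,7) linear_map_comp[OF l])
    then show "lcoact M (g x) = sw (tsp K H M) (lcoact N x) (\<lambda>a y. tens K H M a (g y))"
      using x gx by (simp add: sw_tens_id)
    have "sw (tsp K M H) (rcoact N (f (g x))) (\<lambda>y a. tens K M H (g y) a) = sw (tsp K M H) (rcoact M (g x)) (tens K M H)"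
      using gx l by (simp add: D(2,8) linear_map_comp[OF l])
    then show "rcoact M (g x) = sw (tsp K M H) (rcoact N x) (\<lambda>y a. tens K M H (g y) a)"
      using x gx by (simp add: sw_tens_id)
  qed
qed

section \<open>Arrows, composition and inverses\<close>

lemma LR_sel [simp]:
  "Obj C = {M. obj M}" "Hom C = ydl_hom K H" "Id C = (\<lambda>M. arr M M id)" "cmp C = ydl_cmp"
  "tobj C = ydl_tensor K H" "tarr C = ydl_tensor_arr K H" "unit_obj C = ydl_unit K H"
  "assoc C = ydl_assoc K H" "lunit C = ydl_lunit K H" "runit C = ydl_runit K H"
  by (simp_all add: LR_def)

lemma arr_eqI: "(\<forall>x\<in>carrier M. f x = g x) \<Longrightarrow> arr M N f = arr M N g"
  by (auto simp: arr_def)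

lemma arr_hom:
  "obj M \<Longrightarrow> obj N \<Longrightarrow> mor M N f \<Longrightarrow> arr M N f \<in> ydl_hom K H M N"
  by (auto simp: arr_def ydl_hom_def intro: mor_cong[of M N f])

lemma hom_arrE:
  assumes "a \<in> ydl_hom K H M N"
  obtains f where "a = arr M N f" "mor M N f"
  proof -
  from assms obtain f where "a = (M, N, f)" "f \<in> extensional (carrier M)" "mor M N f"
    by (auto simp: ydl_hom_def)
  then show ?thesis using that[of f] by (simp add: arr_def extensional_restrict)
qed

lemma cmp_arr [simp]:
  "(\<And>x. x \<in> carrier M =simp=> mem_info M x =simp=> f x \<in> carrier N)
    \<Longrightarrow> ydl_cmp (arr N P g) (arr M N f) = arr M P (\<lambda>x. g (f x))"
  by (auto simp: arr_def simp_implies_def mem_info_def fun_eq_iff)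

lemma tensor_arr [simp]:
  assumes "Module.module K M" "Module.module K N"
  shows "ydl_tensor_arr K H (arr M M' f) (arr N N' g)
    = arr (ydl_tensor K H M N) (ydl_tensor K H M' N') (\<lambda>r. sw (tsp K M' N') r (\<lambda>x y. tens K M' N' (f x) (g y)))"
  unfolding arr_def ydl_tensor_arr.simps tmap_def using sw_memD[OF assms]
  by (auto simp: restrict_def fun_eq_iff intro!: sw_cong)

lemma category: "category C"
proof
  fix A B assume "A \<in> Obj C" "B \<in> Obj C"
  fix f assume "f \<in> Hom C A B"
  then obtain f' where "f = arr A B f'" "mor A B f'" by (auto elim: hom_arrE)
  then show "cmp C f (Id C A) = f" "cmp C (Id C B) f = f"
    using \<open>A \<in> Obj C\<close> \<open>B \<in> Obj C\<close> by (simp_all add: simp_implies_def morD)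
next
  fix A B D f g assume A: "A \<in> Obj C" "B \<in> Obj C" "D \<in> Obj C" and f: "f \<in> Hom C A B" "g \<in> Hom C B D"
  obtain f' g' where f': "f = arr A B f'" "mor A B f'" "g = arr B D g'" "mor B D g'"
    using f by (auto elim!: hom_arrE)
  then show "cmp C g f \<in> Hom C A D"
    using A mor_comp[of A B D f' g'] arr_hom by (simp add: morD)
  fix E h assume E: "E \<in> Obj C" "h \<in> Hom C D E"
  then obtain h' where h': "h = arr D E h'" "mor D E h'" by (auto elim!: hom_arrE)
  then show "cmp C h (cmp C g f) = cmp C (cmp C h g) f"
    using A E f' by (simp add: morD)
next
  show "f \<in> Hom C A B \<Longrightarrow> f \<in> Hom C A' B' \<Longrightarrow> A = A' \<and> B = B'" for f A B A' B'
    by (auto simp: ydl_hom_def)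
  show "A \<in> Obj C \<Longrightarrow> Id C A \<in> Hom C A A" for A
    using mor_id[of A] by (simp add: arr_hom id_def)
qed

lemma inverse_arrowsI:
  assumes M: "obj M" and N: "obj N" and f: "mor M N f"
    and g: "\<And>y. y \<in> carrier N \<Longrightarrow> g y \<in> carrier M" "\<forall>y\<in>carrier N. f (g y) = y"
      "\<forall>x\<in>carrier M. g (f x) = x"
  shows "inverse_arrows C M N (arr M N f) (arr N M g)"
  using assms arr_hom[OF M N f] arr_hom[OF N M mor_inverse[OF M N f g(1)]]
  by (auto simp: inverse_arrows_def simp_implies_def morD intro!: arr_eqI)

text \<open>Inverse associators enter the hexagons through a definite description; uniqueness of
  inverses lets an explicit map take its place.\<close>

lemma inv_arrow_eq:
  assumes "obj M" "obj N" "inverse_arrows C M N f g"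
  shows "inv_arrow C M N f = g"
proof -
  interpret category C by (rule category)
  show ?thesis unfolding inv_arrow_def
  proof (rule the_equality)
    fix g' assume g': "inverse_arrows C M N f g'"
    have MN: "M \<in> Obj C" "N \<in> Obj C" using assms by simp_all
    have "g' = cmp C g' (cmp C f g)"
      using cmp_id_right[OF MN(2,1), of g'] g' assms(3) by (simp add: inverse_arrows_def del: LR_sel)
    also have "\<dots> = cmp C (cmp C g' f) g"
      using cmp_assoc[OF MN(2,1,2,1), of g f g'] g' assms(3) by (simp add: inverse_arrows_def del: LR_sel)
    also have "\<dots> = g"
      using cmp_id_left[OF MN(2,1), of g] g' assms(3) by (simp add: inverse_arrows_def del: LR_sel)
    finally show "g' = g" .
  qed (fact assms(3))
qed

lemma mor_tensorI:
  assumes M: "obj M" and N: "obj N" and P: "obj P" and f: "linear_map K (tsp K M N) P f"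
    and e: "\<And>i j k l x y. \<lbrakk>x \<in> carrier M; y \<in> carrier N\<rbrakk>
        \<Longrightarrow> f (tens K M N (aut M i j k l x) (aut N i j k l y)) = aut P i j k l (f (tens K M N x y))"
      "\<And>h x y. \<lbrakk>h \<in> carrier H; x \<in> carrier M; y \<in> carrier N\<rbrakk>
        \<Longrightarrow> f (lact (ydl_tensor K H M N) h (tens K M N x y)) = lact P h (f (tens K M N x y))"
      "\<And>h x y. \<lbrakk>h \<in> carrier H; x \<in> carrier M; y \<in> carrier N\<rbrakk>
        \<Longrightarrow> f (ract (ydl_tensor K H M N) (tens K M N x y) h) = ract P (f (tens K M N x y)) h"
      "\<And>x y. \<lbrakk>x \<in> carrier M; y \<in> carrier N\<rbrakk> \<Longrightarrow> lcoact P (f (tens K M N x y))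
        = sw (tsp K H P) (lcoact (ydl_tensor K H M N) (tens K M N x y)) (\<lambda>a r. tens K H P a (f r))"
      "\<And>x y. \<lbrakk>x \<in> carrier M; y \<in> carrier N\<rbrakk> \<Longrightarrow> rcoact P (f (tens K M N x y))
        = sw (tsp K P H) (rcoact (ydl_tensor K H M N) (tens K M N x y)) (\<lambda>r a. tens K P H (f r) a)"
  shows "mor (ydl_tensor K H M N) P f"
proof -
  let ?T = "ydl_tensor K H M N"
  note T = tensor_obj[OF M N]
  have lc: "linear_map K V P (\<lambda>x. f (e x))" if "linear_map K V (tsp K M N) e"
    for V :: "('k, ('k, 'a) univ) module" and e
    using linear_map_comp[OF f that] .
  note [simp] = M N P f lc linear_map_closed[OF f]
  show ?thesis
  proof (rule morI[OF T P])
    show "\<forall>x\<in>carrier ?T. f (aut ?T i j k l x) = aut P i j k l (f x)" for i j k l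
      unfolding carrier_ydl_tensor by (intro tsp_eqI[of K M N P]) (simp_all add: e(1))
    show "\<forall>x\<in>carrier ?T. f (lact ?T h x) = lact P h (f x)" if "h \<in> carrier H" for h
      unfolding carrier_ydl_tensor
      \<comment> \<open>The goal on pure tensors is closed by the hypothesis before the structure
        maps are unfolded; the second pass proves the linearity conditions.\<close>
      by (intro tsp_eqI[of K M N P]) (use that in \<open>simp_all only: e(2)\<close>, use that in simp_all)
    show "\<forall>x\<in>carrier ?T. f (ract ?T x h) = ract P (f x) h" if "h \<in> carrier H" for h
      unfolding carrier_ydl_tensor
      by (intro tsp_eqI[of K M N P]) (use that in \<open>simp_all only: e(3)\<close>, use that in simp_all)
    show "\<forall>x\<in>carrier ?T. lcoact P (f x) = sw (tsp K H P) (lcoact ?T x) (\<lambda>a y. tens K H P a (f y))"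
      unfolding carrier_ydl_tensor
      by (intro tsp_eqI[of K M N "tsp K H P"]) (simp_all only: e(4), simp_all)
    show "\<forall>x\<in>carrier ?T. rcoact P (f x) = sw (tsp K P H) (rcoact ?T x) (\<lambda>y a. tens K P H (f y) a)"
      unfolding carrier_ydl_tensor
      by (intro tsp_eqI[of K M N "tsp K P H"]) (simp_all only: e(5), simp_all)
  qed simp
qed

lemma tensor_arr_hom:
  assumes "obj M" "obj M'" "obj N" "obj N'" "mor M M' f" "mor N N' g"
  shows "mor (ydl_tensor K H M N) (ydl_tensor K H M' N') (\<lambda>r. sw (tsp K M' N') r (\<lambda>x y. tens K M' N' (f x) (g y)))"
proof -
  note [simp] = assms(1-4) morD[OF assms(1,2,5)] morD[OF assms(3,4,6)]
  show ?thesis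
    by (intro mor_tensorI tensor_obj) simp_all
qed


section \<open>Associativity and unit constraints\<close>

definition assoc_map :: "('k, 'a) ydlobj \<Rightarrow> ('k, 'a) ydlobj \<Rightarrow> ('k, 'a) ydlobj \<Rightarrow> ('k, 'a) univ \<Rightarrow> ('k, 'a) univ" where
  "assoc_map M N P r = sw (tsp3 K M N P) r (\<lambda>w z. sw (tsp3 K M N P) w (\<lambda>x y.
          tens3 K M N P (aut M 0 0 (-1) 0 x) y (aut P 0 0 0 1 z)))"

definition assoc_inv_map :: "('k, 'a) ydlobj \<Rightarrow> ('k, 'a) ydlobj \<Rightarrow> ('k, 'a) ydlobj \<Rightarrow> ('k, 'a) univ \<Rightarrow> ('k, 'a) univ" where
  "assoc_inv_map M N P r = sw (tsp K (tsp K M N) P) r (\<lambda>x w. sw (tsp K (tsp K M N) P) w (\<lambda>y z.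
          tens K (tsp K M N) P (tens K M N (aut M 0 0 1 0 x) y) (aut P 0 0 0 (-1) z)))"

lemma ydl_assoc_arr: "ydl_assoc K H M N P
    = arr (ydl_tensor K H (ydl_tensor K H M N) P) (ydl_tensor K H M (ydl_tensor K H N P)) (assoc_map M N P)"
  by (simp add: ydl_assoc_def assoc_map_def[abs_def])

lemma mor_tensorI_left:
  assumes M: "obj M" and N: "obj N" and Q: "obj Q" and P: "obj P"
    and f: "linear_map K (tsp K (tsp K M N) Q) P f"
    and e: "\<And>i j k l x y z. \<lbrakk>x \<in> carrier M; y \<in> carrier N; z \<in> carrier Q\<rbrakk>
        \<Longrightarrow> f (tens K (tsp K M N) Q (tens K M N (aut M i j k l x) (aut N i j k l y)) (aut Q i j k l z))
          = aut P i j k l (f (tens K (tsp K M N) Q (tens K M N x y) z))"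
      "\<And>h x y z. \<lbrakk>h \<in> carrier H; x \<in> carrier M; y \<in> carrier N; z \<in> carrier Q\<rbrakk>
        \<Longrightarrow> f (lact (ydl_tensor K H (ydl_tensor K H M N) Q) h (tens K (tsp K M N) Q (tens K M N x y) z))
          = lact P h (f (tens K (tsp K M N) Q (tens K M N x y) z))"
      "\<And>h x y z. \<lbrakk>h \<in> carrier H; x \<in> carrier M; y \<in> carrier N; z \<in> carrier Q\<rbrakk>
        \<Longrightarrow> f (ract (ydl_tensor K H (ydl_tensor K H M N) Q) (tens K (tsp K M N) Q (tens K M N x y) z) h)
          = ract P (f (tens K (tsp K M N) Q (tens K M N x y) z)) h"
      "\<And>x y z. \<lbrakk>x \<in> carrier M; y \<in> carrier N; z \<in> carrier Q\<rbrakk> \<Longrightarrow> lcoact P (f (tens K (tsp K M N) Q (tens K M N x y) z))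
        = sw (tsp K H P) (lcoact (ydl_tensor K H (ydl_tensor K H M N) Q) (tens K (tsp K M N) Q (tens K M N x y) z)) (\<lambda>a r. tens K H P a (f r))"
      "\<And>x y z. \<lbrakk>x \<in> carrier M; y \<in> carrier N; z \<in> carrier Q\<rbrakk> \<Longrightarrow> rcoact P (f (tens K (tsp K M N) Q (tens K M N x y) z))
        = sw (tsp K P H) (rcoact (ydl_tensor K H (ydl_tensor K H M N) Q) (tens K (tsp K M N) Q (tens K M N x y) z)) (\<lambda>r a. tens K P H (f r) a)"
  shows "mor (ydl_tensor K H (ydl_tensor K H M N) Q) P f"
proof -
  let ?T = "ydl_tensor K H (ydl_tensor K H M N) Q"
  let ?S = "tsp K (tsp K M N) Q"
  note T = tensor_obj[OF tensor_obj[OF M N] Q]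
  have lc: "linear_map K V P (\<lambda>x. f (e x))" if "linear_map K V ?S e"
    for V :: "('k, ('k, 'a) univ) module" and e
    using linear_map_comp[OF f that] .
  note [simp] = M N P Q f lc linear_map_closed[OF f] tensor_obj[OF M N]
  have c: "carrier ?T = carrier ?S" by simp
  show ?thesis
  proof (rule morI[OF T P]; (unfold c)?)
    show "\<forall>x\<in>carrier ?S. f (aut ?T i j k l x) = aut P i j k l (f x)" for i j k l
      \<comment> \<open>The rules for \<open>aut\<close> on a tensor product are instantiated by
        hand: when one factor is itself a tensor product, \<open>tensor_same\<close> has already
        replaced it by \<open>tsp\<close> in the goal, and their patterns no longer match.\<close>
      by (intro tsp_eqI_left[of K M N Q P])
        (use linear_map_aut_tensor[of "ydl_tensor K H M N" Q ?S "\<lambda>x. x"] aut_tensor[of "ydl_tensor K H M N" Q] in \<open>simp_all add: e(1)\<close>)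
    show "\<forall>x\<in>carrier ?S. f (lact ?T h x) = lact P h (f x)" if "h \<in> carrier H" for h
      by (intro tsp_eqI_left[of K M N Q P]) (use that in \<open>simp_all only: e(2)\<close>, use that in simp_all)
    show "\<forall>x\<in>carrier ?S. f (ract ?T x h) = ract P (f x) h" if "h \<in> carrier H" for h
      by (intro tsp_eqI_left[of K M N Q P]) (use that in \<open>simp_all only: e(3)\<close>, use that in simp_all)
    show "\<forall>x\<in>carrier ?S. lcoact P (f x) = sw (tsp K H P) (lcoact ?T x) (\<lambda>a y. tens K H P a (f y))"
      by (intro tsp_eqI_left[of K M N Q "tsp K H P"]) (simp_all only: e(4), simp_all)
    show "\<forall>x\<in>carrier ?S. rcoact P (f x) = sw (tsp K P H) (rcoact ?T x) (\<lambda>y a. tens K P H (f y) a)"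
      by (intro tsp_eqI_left[of K M N Q "tsp K P H"]) (simp_all only: e(5), simp_all)
  qed simp
qed

text \<open>The \<omega>^-1 on the first and the \<psi> on the third factor absorb the twists of
  coassociativity, which gives both linearities. Colinearity is associativity of the product and is
  settled by the normal form of products.\<close>

lemma assoc_mor:
  assumes "obj M" "obj N" "obj P"
  shows "mor (ydl_tensor K H (ydl_tensor K H M N) P) (ydl_tensor K H M (ydl_tensor K H N P)) (assoc_map M N P)"
proof -
  note [simp] = assms tensor_obj[OF assms(2,3)] tensor_obj[OF assms(1,2)]
  show ?thesis
  proof (rule mor_tensorI_left[OF assms tensor_obj[OF assms(1) tensor_obj[OF assms(2,3)]]], goal_cases)
    case 1
    then show ?case by (simp add: assoc_map_def[abs_def])
  next
    case (2 i j k l x y z)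
    then show ?case
      using aut_tensor[of M "ydl_tensor K H N P" "aut M 0 0 (-1) 0 x" "tens K N P y (aut P 0 0 0 1 z)"]
      by (simp add: assoc_map_def add_ac)
  next
    case (3 h x y z)
    then show ?case by (simp add: assoc_map_def comult_coassoc)
  next
    case (4 h x y z)
    then show ?case by (simp add: assoc_map_def comult_coassoc)
  next
    case (5 x y z)
    then show ?case by (simp add: assoc_map_def)
  next
    case (6 x y z)
    then show ?case by (simp add: assoc_map_def)
  qed
qed


lemma assoc_inverse:
  assumes "obj M" "obj N" "obj P"
  shows "inverse_arrows C (ydl_tensor K H (ydl_tensor K H M N) P) (ydl_tensor K H M (ydl_tensor K H N P))
    (ydl_assoc K H M N P)
    (arr (ydl_tensor K H M (ydl_tensor K H N P)) (ydl_tensor K H (ydl_tensor K H M N) P) (assoc_inv_map M N P))"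
proof -
  note [simp] = assms
  let ?A = "tsp K (tsp K M N) P" and ?B = "tsp K M (tsp K N P)"
  have l: "linear_map K ?A ?B (assoc_map M N P)" "linear_map K ?B ?A (assoc_inv_map M N P)"
    by (simp_all add: assoc_map_def[abs_def] assoc_inv_map_def[abs_def])
  have 1: "\<forall>r\<in>carrier ?B. assoc_map M N P (assoc_inv_map M N P r) = r"
    by (intro tsp_eqI_right[of K M N P ?B] linear_map_comp[OF l] linear_map_ident)
      (simp_all add: assoc_map_def assoc_inv_map_def)
  have 2: "\<forall>r\<in>carrier ?A. assoc_inv_map M N P (assoc_map M N P r) = r"
    by (intro tsp_eqI_left[of K M N P ?A] linear_map_comp[OF l(2) l(1)] linear_map_ident)
      (simp_all add: assoc_map_def assoc_inv_map_def)
  show ?thesis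
    unfolding ydl_assoc_arr
    by (rule inverse_arrowsI) (use 1 2 linear_map_closed[OF l(2)] in \<open>simp_all add: tensor_obj assoc_mor\<close>)
qed

lemma the_scalar_closed [simp]: "a \<in> carrier (scalar_space K) \<Longrightarrow> the_scalar a \<in> carrier K"
  by (auto simp: scalar_space_def)

lemma the_scalar_smult [simp]: "the_scalar (b \<odot>\<^bsub>scalar_space K\<^esub> a) = b \<otimes>\<^bsub>K\<^esub> the_scalar a"
  by (simp add: scalar_space_def)

lemma smult_the_scalar: "a \<in> carrier (scalar_space K) \<Longrightarrow> the_scalar a \<odot>\<^bsub>scalar_space K\<^esub> Scalar \<one>\<^bsub>K\<^esub> = a"
  by (auto simp: scalar_space_def)

lemma Scalar_one_closed [simp]: "Scalar \<one>\<^bsub>K\<^esub> \<in> carrier (scalar_space K)"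
  by (simp add: scalar_space_def)

lemma linear_map_the_scalar [simp]:
  assumes "linear_map K V (scalar_space K) e" "Module.module K V" "Module.module K Z" "z \<in> carrier Z"
  shows "linear_map K V Z (\<lambda>a. the_scalar (e a) \<odot>\<^bsub>Z\<^esub> z)"
proof (rule linear_mapI)
  fix x y assume "x \<in> carrier V" "y \<in> carrier V"
  then show "the_scalar (e (x \<oplus>\<^bsub>V\<^esub> y)) \<odot>\<^bsub>Z\<^esub> z = the_scalar (e x) \<odot>\<^bsub>Z\<^esub> z \<oplus>\<^bsub>Z\<^esub> the_scalar (e y) \<odot>\<^bsub>Z\<^esub> z"
    using assms linear_map_closed[OF assms(1)]
    by (simp add: linear_map_add[OF assms(1)] module.smult_l_distr[symmetric]) (simp add: scalar_space_def)
qed (use assms linear_map_closed[OF assms(1)] in \<open>simp_all add: linear_map_smult[OF assms(1)]\<close>)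

lemma struct_smult [simp]:
  assumes "obj M" "a \<in> carrier K" "x \<in> carrier M"
  shows "h \<in> carrier H \<Longrightarrow> lact M h (a \<odot>\<^bsub>M\<^esub> x) = a \<odot>\<^bsub>M\<^esub> lact M h x"
    "h \<in> carrier H \<Longrightarrow> ract M (a \<odot>\<^bsub>M\<^esub> x) h = a \<odot>\<^bsub>M\<^esub> ract M x h"
    "lcoact M (a \<odot>\<^bsub>M\<^esub> x) = a \<odot>\<^bsub>tsp K H M\<^esub> lcoact M x"
    "rcoact M (a \<odot>\<^bsub>M\<^esub> x) = a \<odot>\<^bsub>tsp K M H\<^esub> rcoact M x"
    "aut M i j k l (a \<odot>\<^bsub>M\<^esub> x) = a \<odot>\<^bsub>M\<^esub> aut M i j k l x"
  using assms linear_map_smult[of K M M "\<lambda>x. lact M h x" a x] linear_map_smult[of K M M "\<lambda>x. ract M x h" a x]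
    linear_map_smult[of K M "tsp K H M" "lcoact M" a x] linear_map_smult[of K M "tsp K M H" "rcoact M" a x]
    linear_map_smult[of K M M "\<lambda>x. aut M i j k l x" a x] by simp_all

definition lunit_map :: "('k, 'a) ydlobj \<Rightarrow> ('k, 'a) univ \<Rightarrow> ('k, 'a) univ" where
  "lunit_map M r = sw M r (\<lambda>a x. the_scalar a \<odot>\<^bsub>M\<^esub> aut M 0 0 0 (-1) x)"

definition runit_map :: "('k, 'a) ydlobj \<Rightarrow> ('k, 'a) univ \<Rightarrow> ('k, 'a) univ" where
  "runit_map M r = sw M r (\<lambda>x a. the_scalar a \<odot>\<^bsub>M\<^esub> aut M 0 0 (-1) 0 x)"

lemma ydl_unit_arr:
  "ydl_lunit K H M = arr (ydl_tensor K H (ydl_unit K H) M) M (lunit_map M)"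
  "ydl_runit K H M = arr (ydl_tensor K H M (ydl_unit K H)) M (runit_map M)"
  by (simp_all add: ydl_lunit_def lunit_map_def[abs_def] ydl_runit_def runit_map_def[abs_def])

lemma lunit_mor:
  assumes "obj M"
  shows "mor (ydl_tensor K H (ydl_unit K H) M) M (lunit_map M)"
proof -
  note [simp] = assms
  show ?thesis
    by (rule mor_tensorI[OF unit_obj assms assms])
      (simp_all add: lunit_map_def[abs_def] add_ac)
qed

lemma runit_mor:
  assumes "obj M"
  shows "mor (ydl_tensor K H M (ydl_unit K H)) M (runit_map M)"
proof -
  note [simp] = assms
  show ?thesis
    by (rule mor_tensorI[OF assms unit_obj assms])
      (simp_all add: runit_map_def[abs_def] add_ac)
qed

lemma lunit_inverse:
  assumes "obj M"
  shows "inverse_arrows C (ydl_tensor K H (ydl_unit K H) M) M (ydl_lunit K H M)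
    (arr M (ydl_tensor K H (ydl_unit K H) M) (\<lambda>x. tens K (scalar_space K) M (Scalar \<one>\<^bsub>K\<^esub>) (aut M 0 0 0 1 x)))"
proof -
  note [simp] = assms
  let ?g = "\<lambda>x. tens K (scalar_space K) M (Scalar \<one>\<^bsub>K\<^esub>) (aut M 0 0 0 1 x)"
  have "\<forall>r\<in>carrier (tsp K (scalar_space K) M). ?g (lunit_map M r) = r"
    by (intro tsp_eqI[of K "scalar_space K" M "tsp K (scalar_space K) M"])
      \<comment> \<open>The scalar is moved back into the first factor, where it multiplies
        \<open>Scalar \<one>\<close> to the original element.\<close>
      (simp_all add: lunit_map_def[abs_def], simp flip: tens_smult(1) add: smult_the_scalar)
  then show ?thesis
    unfolding ydl_unit_arr by (intro inverse_arrowsI)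
      (simp_all add: tensor_obj unit_obj lunit_mor, simp add: lunit_map_def)
qed

lemma runit_inverse:
  assumes "obj M"
  shows "inverse_arrows C (ydl_tensor K H M (ydl_unit K H)) M (ydl_runit K H M)
    (arr M (ydl_tensor K H M (ydl_unit K H)) (\<lambda>x. tens K M (scalar_space K) (aut M 0 0 1 0 x) (Scalar \<one>\<^bsub>K\<^esub>)))"
proof -
  note [simp] = assms
  let ?g = "\<lambda>x. tens K M (scalar_space K) (aut M 0 0 1 0 x) (Scalar \<one>\<^bsub>K\<^esub>)"
  have "\<forall>r\<in>carrier (tsp K M (scalar_space K)). ?g (runit_map M r) = r"
    by (intro tsp_eqI[of K M "scalar_space K" "tsp K M (scalar_space K)"])
      (simp_all add: runit_map_def[abs_def], simp flip: tens_smult(2) add: smult_the_scalar)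
  then show ?thesis
    unfolding ydl_unit_arr by (intro inverse_arrowsI)
      (simp_all add: tensor_obj unit_obj runit_mor, simp add: runit_map_def)
qed

lemma arr_tensor_left_eqI:
  assumes "linear_map K (tsp K (tsp K U V) W) Z f" "linear_map K (tsp K (tsp K U V) W) Z g"
    and "Module.module K U" "Module.module K V" "Module.module K W" "Module.module K Z"
    and "\<And>x y z. \<lbrakk>x \<in> carrier U; y \<in> carrier V; z \<in> carrier W\<rbrakk>
      \<Longrightarrow> f (tens K (tsp K U V) W (tens K U V x y) z) = g (tens K (tsp K U V) W (tens K U V x y) z)"
  shows "arr (ydl_tensor K H (ydl_tensor K H U V) W) B f = arr (ydl_tensor K H (ydl_tensor K H U V) W) B g"
  using tsp_eqI_left[OF assms] by (intro arr_eqI) simp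

lemma assoc_natural:
  assumes "obj X" "obj X'" "obj Y" "obj Y'" "obj Z" "obj Z'" "mor X X' f" "mor Y Y' g" "mor Z Z' h"
  shows "ydl_cmp (ydl_assoc K H X' Y' Z') (ydl_tensor_arr K H (ydl_tensor_arr K H (arr X X' f) (arr Y Y' g)) (arr Z Z' h))
    = ydl_cmp (ydl_tensor_arr K H (arr X X' f) (ydl_tensor_arr K H (arr Y Y' g) (arr Z Z' h))) (ydl_assoc K H X Y Z)"
proof -
  note [simp] = assms(1-6) morD[OF assms(1,2,7)] morD[OF assms(3,4,8)] morD[OF assms(5,6,9)]
  show ?thesis
    unfolding ydl_assoc_arr
    by (simp add: assoc_map_def[abs_def], rule arr_tensor_left_eqI[of _ _ _ "tsp3 K X' Y' Z'"]) simp_all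
qed

lemma lunit_natural:
  assumes "obj X" "obj X'" "mor X X' f"
  shows "ydl_cmp (ydl_lunit K H X') (ydl_tensor_arr K H (arr (ydl_unit K H) (ydl_unit K H) id) (arr X X' f))
    = ydl_cmp (arr X X' f) (ydl_lunit K H X)"
proof -
  note [simp] = assms(1,2) morD[OF assms] linear_map_smult[OF morD(1)[OF assms]]
  show ?thesis
    unfolding ydl_unit_arr
    by (simp add: lunit_map_def[abs_def], rule arr_eqI, unfold carrier_ydl_tensor tensor_same unit_same,
        rule tsp_eqI[of _ _ _ X']) simp_all
qed

lemma runit_natural:
  assumes "obj X" "obj X'" "mor X X' f"
  shows "ydl_cmp (ydl_runit K H X') (ydl_tensor_arr K H (arr X X' f) (arr (ydl_unit K H) (ydl_unit K H) id))
    = ydl_cmp (arr X X' f) (ydl_runit K H X)"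
proof -
  note [simp] = assms(1,2) morD[OF assms] linear_map_smult[OF morD(1)[OF assms]]
  show ?thesis
    unfolding ydl_unit_arr
    by (simp add: runit_map_def[abs_def], rule arr_eqI, unfold carrier_ydl_tensor tensor_same unit_same,
        rule tsp_eqI[of _ _ _ X']) simp_all
qed


lemma tsp_eqI_left4:
  assumes l: "linear_map K (tsp K (tsp K (tsp K U V) W) X) Z f" "linear_map K (tsp K (tsp K (tsp K U V) W) X) Z g"
    and m: "Module.module K U" "Module.module K V" "Module.module K W" "Module.module K X" "Module.module K Z"
    and e: "\<And>x y z w. \<lbrakk>x \<in> carrier U; y \<in> carrier V; z \<in> carrier W; w \<in> carrier X\<rbrakk>
      \<Longrightarrow> f (tens K (tsp K (tsp K U V) W) X (tens K (tsp K U V) W (tens K U V x y) z) w)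
        = g (tens K (tsp K (tsp K U V) W) X (tens K (tsp K U V) W (tens K U V x y) z) w)"
  shows "\<forall>r\<in>carrier (tsp K (tsp K (tsp K U V) W) X). f r = g r"
proof (rule tsp_eqI_left[OF l])
  fix r z w assume r: "r \<in> carrier (tsp K U V)" and z: "z \<in> carrier W" and w: "w \<in> carrier X"
  have "linear_map K (tsp K U V) (tsp K (tsp K (tsp K U V) W) X)
      (\<lambda>r. tens K (tsp K (tsp K U V) W) X (tens K (tsp K U V) W r z) w)"
    using m z w by simp
  from tsp_eqI[OF linear_map_comp[OF l(1) this] linear_map_comp[OF l(2) this] m(1,2,5)]
  show "f (tens K (tsp K (tsp K U V) W) X (tens K (tsp K U V) W r z) w)
      = g (tens K (tsp K (tsp K U V) W) X (tens K (tsp K U V) W r z) w)"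
    using r z w e by blast
qed (simp_all add: m)

text \<open>On pure tensors both sides apply \<omega>^-2, \<omega>^-1, \<psi> and \<psi>^2 to the
  four factors in this order.\<close>

lemma pentagon:
  assumes "obj W" "obj X" "obj Y" "obj Z"
  shows "ydl_cmp (ydl_assoc K H W X (ydl_tensor K H Y Z)) (ydl_assoc K H (ydl_tensor K H W X) Y Z)
    = ydl_cmp (ydl_tensor_arr K H (arr W W id) (ydl_assoc K H X Y Z))
        (ydl_cmp (ydl_assoc K H W (ydl_tensor K H X Y) Z) (ydl_tensor_arr K H (ydl_assoc K H W X Y) (arr Z Z id)))"
proof -
  note [simp] = assms tensor_obj
  show ?thesis
    unfolding ydl_assoc_arr
    by (simp add: assoc_map_def[abs_def], rule arr_eqI, unfold carrier_ydl_tensor tensor_same,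
        rule tsp_eqI_left4[of _ _ _ _ "tsp K W (tsp K X (tsp K Y Z))"]) simp_all
qed

text \<open>The \<psi> of the associator cancels the \<psi>^-1 of the left unit, and its \<omega>^-1
  is that of the right unit.\<close>

lemma triangle:
  assumes "obj X" "obj Y"
  shows "ydl_cmp (ydl_tensor_arr K H (arr X X id) (ydl_lunit K H Y)) (ydl_assoc K H X (ydl_unit K H) Y)
    = ydl_tensor_arr K H (ydl_runit K H X) (arr Y Y id)"
proof -
  note [simp] = assms tensor_obj unit_obj
  show ?thesis
    unfolding ydl_assoc_arr ydl_unit_arr
    by (simp add: assoc_map_def[abs_def] lunit_map_def[abs_def] runit_map_def[abs_def],
        rule arr_eqI, unfold carrier_ydl_tensor tensor_same unit_same,
        rule tsp_eqI_left[of _ _ _ _ "tsp K X Y"]) simp_all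
qed

lemma tensor_cmp:
  assumes "obj A" "obj A'" "obj A''" "obj B" "obj B'" "obj B''"
    "mor A A' f" "mor A' A'' f'" "mor B B' g" "mor B' B'' g'"
  shows "ydl_tensor_arr K H (ydl_cmp (arr A' A'' f') (arr A A' f)) (ydl_cmp (arr B' B'' g') (arr B B' g))
    = ydl_cmp (ydl_tensor_arr K H (arr A' A'' f') (arr B' B'' g')) (ydl_tensor_arr K H (arr A A' f) (arr B B' g))"
proof -
  note [simp] = assms(1-6) morD[OF assms(1,2,7)] morD[OF assms(2,3,8)] morD[OF assms(4,5,9)] morD[OF assms(5,6,10)]
  show ?thesis
    by (simp, rule arr_eqI, unfold carrier_ydl_tensor, rule tsp_eqI[of _ _ _ "tsp K A'' B''"]) simp_all
qed

lemma monoidal_category: "monoidal_category C"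
proof (intro monoidal_category.intro category monoidal_category_axioms.intro, goal_cases)
  case (1 A B)
  then show ?case by (simp add: tensor_obj)
next
  case 2
  then show ?case by (simp add: unit_obj)
next
  case (3 A A' B B' f g)
  then show ?case
    by (auto elim!: hom_arrE intro!: arr_hom tensor_obj tensor_arr_hom)
next
  case (4 A B)
  then show ?case by (auto intro!: arr_eqI simp: sw_tens_id)
next
  case (5 A A' A'' B B' B'' f f' g g')
  then have "f \<in> ydl_hom K H A A'" "f' \<in> ydl_hom K H A' A''" "g \<in> ydl_hom K H B B'" "g' \<in> ydl_hom K H B' B''"
    by simp_all
  then show ?case
    using 5(1-6) by (elim hom_arrE) (simp only: LR_sel mem_Collect_eq tensor_cmp)
next
  case (6 X Y Z)
  then show ?case unfolding iso_arrow_def LR_sel mem_Collect_eq using assoc_inverse by blast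
next
  case (7 X X' Y Y' Z Z' f g h)
  then show ?case by (auto elim!: hom_arrE simp only: LR_sel mem_Collect_eq intro: assoc_natural)
next
  case (8 X)
  then show ?case unfolding iso_arrow_def LR_sel mem_Collect_eq using lunit_inverse by blast
next
  case (9 X X' f)
  then show ?case by (auto elim!: hom_arrE simp only: LR_sel mem_Collect_eq intro: lunit_natural)
next
  case (10 X)
  then show ?case unfolding iso_arrow_def LR_sel mem_Collect_eq using runit_inverse by blast
next
  case (11 X X' f)
  then show ?case by (auto elim!: hom_arrE simp only: LR_sel mem_Collect_eq intro: runit_natural)
next
  case (12 W X Y Z)
  then show ?case using pentagon by simp
next
  case (13 X Y)
  then show ?case using triangle by simp
qed


section \<open>The braiding\<close>

definition braid_map :: "('k, 'a) ydlobj \<Rightarrow> ('k, 'a) ydlobj \<Rightarrow> ('k, 'a) univ \<Rightarrow> ('k, 'a) univ" where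
  "braid_map M N r = sw (tsp K N M) r (\<lambda>x y.
     sw (tsp K N M) (lcoact M x) (\<lambda>a x0. sw (tsp K N M) (rcoact N y) (\<lambda>y0 b.
       tens K N M (lact N (aut H s (p + 1) q (t + 1) a) (aut N 0 (-1) 0 (-1) y0))
         (ract M (aut M (-1) 0 (-1) 0 x0) (aut H (m + 1) u (v + 1) n b)))))"

lemma ydl_braiding_arr:
  "ydl_braiding K H m n p q s t u v M N = arr (ydl_tensor K H M N) (ydl_tensor K H N M) (braid_map M N)"
  by (simp add: ydl_braiding_def braid_map_def[abs_def])

text \<open>One component of \<open>h\<close> acts on \<open>x\<close> before the coaction is taken,
  and the other is multiplied to the coaction component inside the action on \<open>y\<close>. This
  is the left side of condition (i) for \<open>M\<close>.\<close>

lemma braid_lact: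
  assumes M: "obj M" and N: "obj N" and x: "x \<in> carrier M" and y: "y \<in> carrier N" and h: "h \<in> carrier H"
  shows "braid_map M N (lact (ydl_tensor K H M N) h (tens K M N x y))
    = lact (ydl_tensor K H N M) h (braid_map M N (tens K M N x y))"
proof -
  note [simp] = M N x y
  let ?A = "aut H s (p + 1) q (t + 1)" and ?Z = "tsp K N M"
  \<comment> \<open>In (i) the components act through \<open>?A\<close>, so \<open>h\<close> is
    written as the image of \<open>g\<close> under this automorphism.\<close>
  define g where "g = aut H (- s) (- (p + 1)) (- q) (- (t + 1)) h"
  have g [simp]: "g \<in> carrier H" and hg: "h = ?A g"
    using h by (simp_all add: g_def)
  let ?F = "\<lambda>c x0. sw ?Z (rcoact N y) (\<lambda>y0 b. tens K N M (lact N (aut H (s - 1) (p + 1) q (t + 1) c) (aut N 0 0 0 (-1) y0))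
    (ract M (aut M (-1) 0 (-1) 0 x0) (aut H (m + 1) (u + 1) (v + 1) n b)))"
  have "braid_map M N (lact (ydl_tensor K H M N) h (tens K M N x y))
      = sw ?Z (comult H g) (\<lambda>h1 h2. sw ?Z (lcoact M (lact M (?A h1) x)) (\<lambda>a x0. ?F (a \<otimes>\<^bsub>H\<^esub> aut H 1 (-1) 1 (-1) h2) x0))"
    unfolding hg by (simp add: braid_map_def add_ac)
  also have "\<dots> = sw ?Z (comult H g) (\<lambda>h1 h2. sw ?Z (lcoact M x) (\<lambda>a x0.
      ?F (h1 \<otimes>\<^bsub>H\<^esub> aut H 1 0 0 0 a) (lact M (aut H s (p + 1) (q + 1) (t + 1) h2) x0)))"
    by (rule ydl_left) simp_all
  also have "\<dots> = lact (ydl_tensor K H N M) h (braid_map M N (tens K M N x y))"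
    unfolding hg by (simp add: braid_map_def add_ac)
  finally show ?thesis .
qed

text \<open>Mirror image with condition (iii) for \<open>N\<close>; the coaction of \<open>M\<close>
  is moved inside so that the coaction of \<open>N\<close> stands directly below the
  coproduct.\<close>

lemma braid_ract:
  assumes M: "obj M" and N: "obj N" and x: "x \<in> carrier M" and y: "y \<in> carrier N" and h: "h \<in> carrier H"
  shows "braid_map M N (ract (ydl_tensor K H M N) (tens K M N x y) h)
    = ract (ydl_tensor K H N M) (braid_map M N (tens K M N x y)) h"
proof -
  note [simp] = M N x y
  let ?B = "aut H (m + 1) u (v + 1) n" and ?Z = "tsp K N M"
  define g where "g = aut H (- (m + 1)) (- u) (- (v + 1)) (- n) h"
  have g [simp]: "g \<in> carrier H" and hg: "h = ?B g"
    using h by (simp_all add: g_def)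
  note swap = sw_swap_simp[where r = "lcoact M x"]
  let ?F = "\<lambda>y0 c. sw ?Z (lcoact M x) (\<lambda>a x0. tens K N M (lact N (aut H (s + 1) (p + 1) q (t + 1) a) (aut N 0 (-1) 0 (-1) y0))
    (ract M (aut M 0 0 (-1) 0 x0) (aut H (m + 1) (u - 1) (v + 1) n c)))"
  have "braid_map M N (ract (ydl_tensor K H M N) (tens K M N x y) h)
      = sw ?Z (comult H g) (\<lambda>h1 h2. sw ?Z (rcoact N (ract N y (?B h2))) (\<lambda>y0 b. ?F y0 (aut H (-1) 1 (-1) 1 h1 \<otimes>\<^bsub>H\<^esub> b)))"
    unfolding hg by (simp add: braid_map_def swap add_ac)
  also have "\<dots> = sw ?Z (comult H g) (\<lambda>h1 h2. sw ?Z (rcoact N y) (\<lambda>y0 b.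
      ?F (ract N y0 (aut H (m + 1) u (v + 1) (n + 1) h1)) (aut H 0 1 0 0 b \<otimes>\<^bsub>H\<^esub> h2)))"
    by (rule ydl_right) simp_all
  also have "\<dots> = ract (ydl_tensor K H N M) (braid_map M N (tens K M N x y)) h"
    unfolding hg by (simp add: braid_map_def swap add_ac)
  finally show ?thesis .
qed

text \<open>Coassociativity turns the two successive coactions on \<open>x\<close> into one
  coproduct, and (i) for \<open>N\<close> applies with its components. Turned back into two
  coactions, the result differs from the goal by the order of the two coactions on \<open>y\<close>,
  which the bicomodule law exchanges.\<close>

lemma braid_lcoact:
  assumes M: "obj M" and N: "obj N" and x: "x \<in> carrier M" and y: "y \<in> carrier N"
  shows "lcoact (ydl_tensor K H N M) (braid_map M N (tens K M N x y))
    = sw (tsp K H (tsp K N M)) (lcoact (ydl_tensor K H M N) (tens K M N x y)) (\<lambda>a r. tens K H (tsp K N M) a (braid_map M N r))"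
proof -
  note [simp] = M N x y
  let ?S = "tsp K N M"
  let ?Z = "tsp K H ?S"
  let ?\<Phi> = "\<lambda>c y x. tens K H ?S c (tens K N M y x)"
  let ?F = "\<lambda>a d z. sw ?Z (rcoact N y) (\<lambda>y0 b. sw ?Z (lcoact N (lact N (aut H s (p + 1) q (t + 1) a) (aut N 0 (-1) 0 (-1) y0)))
    (\<lambda>c y1. ?\<Phi> (aut H (-1) 0 (-1) 0 c \<otimes>\<^bsub>H\<^esub> aut H 0 (-1) (-1) (-1) d) y1
      (ract M (aut M (-1) 0 (-1) 0 z) (aut H (m + 1) u (v + 1) (n + 1) b))))"
  let ?F' = "\<lambda>g k z. sw ?Z (rcoact N y) (\<lambda>y0 b. sw ?Z (lcoact N y0) (\<lambda>c y1.
      ?\<Phi> (aut H (-1) 0 (-2) 0 g \<otimes>\<^bsub>H\<^esub> aut H 0 (-1) (-1) (-1) c) (lact N (aut H s (p + 1) q (t + 1) k) (aut N 0 (-1) 0 (-1) y1))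
      (ract M (aut M (-1) 0 (-1) 1 z) (aut H (m + 1) u (v + 1) (n + 1) b))))"
  \<comment> \<open>Condition (i) for \<open>N\<close>, taken at \<omega>^-1(\<open>g\<close>) so
    that its exponents agree with those left by coassociativity.\<close>
  have L: "sw ?Z (comult H g) (\<lambda>g k. sw ?Z (lcoact N (lact N (aut H s (p + 1) (q - 1) (t + 1) g) (aut N 0 (-1) 0 (-1) y0)))
      (\<lambda>c y1. ?\<Phi> (aut H (-1) 0 (-1) 0 c \<otimes>\<^bsub>H\<^esub> aut H 0 (-1) (-1) (-1) k) y1 z))
    = sw ?Z (comult H g) (\<lambda>g k. sw ?Z (lcoact N y0) (\<lambda>c y1.
      ?\<Phi> (aut H (-1) 0 (-2) 0 g \<otimes>\<^bsub>H\<^esub> aut H 0 (-1) (-1) (-1) c) (lact N (aut H s (p + 1) q (t + 1) k) (aut N 0 (-1) 0 (-1) y1)) z))"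
    if "g \<in> carrier H" "y0 \<in> carrier N" "z \<in> carrier M" for g y0 z
    using ydl_left[OF N, of "aut N 0 (-1) 0 (-1) y0" "aut H 0 0 (-1) 0 g" ?Z "\<lambda>c y1. ?\<Phi> (aut H (-1) 0 (-1) 0 c) y1 z"] that
    by simp
  have "lcoact (ydl_tensor K H N M) (braid_map M N (tens K M N x y))
      = sw ?Z (lcoact M x) (\<lambda>a x0. sw ?Z (lcoact M x0) (\<lambda>d z. ?F a d z))"
    by (simp add: braid_map_def sw_swap_simp[of Z "lcoact N (lact N h w)" "lcoact M v" for Z h w v]
        sw_swap_simp[where r = "rcoact N y"] add_ac)
  also have "\<dots> = sw ?Z (lcoact M x) (\<lambda>a x0. sw ?Z (comult H a) (\<lambda>g k. ?F (aut H 0 0 (-1) 0 g) k (aut M 0 0 0 1 x0)))"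
    by (rule lcoact_coassoc') simp_all
  also have "\<dots> = sw ?Z (lcoact M x) (\<lambda>a x0. sw ?Z (comult H a) (\<lambda>g k. ?F' g k x0))"
    by (simp add: sw_swap_simp[of Z "comult H g" "rcoact N w" for Z g w] L)
  also have "\<dots> = sw ?Z (lcoact M x) (\<lambda>a x0. sw ?Z (lcoact M x0) (\<lambda>b z. ?F' (aut H 0 0 1 0 a) b (aut M 0 0 0 (-1) z)))"
    by (rule lcoact_coassoc) simp_all
  also have "\<dots> = sw ?Z (lcoact (ydl_tensor K H M N) (tens K M N x y)) (\<lambda>a r. tens K H ?S a (braid_map M N r))"
    by (simp add: braid_map_def coact_commute' sw_swap_simp[where r = "lcoact N y"])
  finally show ?thesis .
qed

text \<open>Mirror image: coassociativity of the right coaction on \<open>y\<close>, condition (iii)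
  for \<open>M\<close>, and the bicomodule law for \<open>x\<close>.\<close>

lemma braid_rcoact:
  assumes M: "obj M" and N: "obj N" and x: "x \<in> carrier M" and y: "y \<in> carrier N"
  shows "rcoact (ydl_tensor K H N M) (braid_map M N (tens K M N x y))
    = sw (tsp K (tsp K N M) H) (rcoact (ydl_tensor K H M N) (tens K M N x y)) (\<lambda>r a. tens K (tsp K N M) H (braid_map M N r) a)"
proof -
  note [simp] = M N x y
  let ?S = "tsp K N M"
  let ?Z = "tsp K ?S H"
  let ?\<Phi> = "\<lambda>y x c. tens K ?S H (tens K N M y x) c"
  let ?F = "\<lambda>z d b. sw ?Z (lcoact M x) (\<lambda>a x0. sw ?Z (rcoact M (ract M (aut M (-1) 0 (-1) 0 x0) (aut H (m + 1) u (v + 1) n b)))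
    (\<lambda>x1 c. ?\<Phi> (lact N (aut H s (p + 1) (q + 1) (t + 1) a) (aut N 0 (-1) 0 (-1) z)) x1
      (aut H (-1) 0 (-1) (-1) d \<otimes>\<^bsub>H\<^esub> aut H 0 (-1) 0 (-1) c)))"
  let ?F' = "\<lambda>z g k. sw ?Z (lcoact M x) (\<lambda>a x0. sw ?Z (rcoact M x0) (\<lambda>x1 c.
      ?\<Phi> (lact N (aut H s (p + 1) (q + 1) (t + 1) a) (aut N 0 (-1) 1 (-1) z))
      (ract M (aut M (-1) 0 (-1) 0 x1) (aut H (m + 1) u (v + 1) n g))
      (aut H (-1) 0 (-1) (-1) c \<otimes>\<^bsub>H\<^esub> aut H 0 (-1) 0 (-2) k)))"
  \<comment> \<open>Condition (iii) for \<open>M\<close>, taken at \<psi>^-1(\<open>g\<close>),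
    again to meet the exponents left by coassociativity.\<close>
  have R: "sw ?Z (comult H g) (\<lambda>g k. sw ?Z (rcoact M (ract M (aut M (-1) 0 (-1) 0 x0) (aut H (m + 1) u (v + 1) (n - 1) k)))
      (\<lambda>x1 c. ?\<Phi> z x1 (aut H (-1) 0 (-1) (-1) g \<otimes>\<^bsub>H\<^esub> aut H 0 (-1) 0 (-1) c)))
    = sw ?Z (comult H g) (\<lambda>g k. sw ?Z (rcoact M x0) (\<lambda>x1 c.
      ?\<Phi> z (ract M (aut M (-1) 0 (-1) 0 x1) (aut H (m + 1) u (v + 1) n g))
      (aut H (-1) 0 (-1) (-1) c \<otimes>\<^bsub>H\<^esub> aut H 0 (-1) 0 (-2) k)))"
    if "g \<in> carrier H" "x0 \<in> carrier M" "z \<in> carrier N" for g x0 z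
    using ydl_right[OF M, of "aut M (-1) 0 (-1) 0 x0" "aut H 0 0 0 (-1) g" ?Z "\<lambda>x1 c. ?\<Phi> z x1 (aut H 0 (-1) 0 (-1) c)"] that
    by simp
  have "rcoact (ydl_tensor K H N M) (braid_map M N (tens K M N x y))
      = sw ?Z (rcoact N y) (\<lambda>y0 b. sw ?Z (rcoact N y0) (\<lambda>z d. ?F z d b))"
    by (simp add: braid_map_def sw_swap_simp[where r = "lcoact M x"] add_ac)
  also have "\<dots> = sw ?Z (rcoact N y) (\<lambda>y0 b. sw ?Z (comult H b) (\<lambda>g k. ?F (aut N 0 0 1 0 y0) g (aut H 0 0 0 (-1) k)))"
    by (rule rcoact_coassoc') simp_all
  also have "\<dots> = sw ?Z (rcoact N y) (\<lambda>y0 b. sw ?Z (comult H b) (\<lambda>g k. ?F' y0 g k))"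
    by (simp add: sw_swap_simp[of Z "comult H g" "lcoact M w" for Z g w] R)
  also have "\<dots> = sw ?Z (rcoact N y) (\<lambda>y0 b. sw ?Z (rcoact N y0) (\<lambda>z d. ?F' (aut N 0 0 (-1) 0 z) d (aut H 0 0 0 1 b)))"
    by (rule rcoact_coassoc) simp_all
  also have "\<dots> = sw ?Z (rcoact (ydl_tensor K H M N) (tens K M N x y)) (\<lambda>r a. tens K ?S H (braid_map M N r) a)"
    by (simp add: braid_map_def coact_commute sw_swap_simp[of Z "rcoact N w" "rcoact M w'" for Z w w']
        sw_swap_simp[of Z "rcoact N w" "lcoact M w'" for Z w w'])
  finally show ?thesis .
qed

lemma linear_map_braid: "obj M \<Longrightarrow> obj N \<Longrightarrow> linear_map K (tsp K M N) (tsp K N M) (braid_map M N)"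
  by (simp add: braid_map_def[abs_def])

lemma braid_mor:
  assumes "obj M" "obj N"
  shows "mor (ydl_tensor K H M N) (ydl_tensor K H N M) (braid_map M N)"
proof (rule mor_tensorI[OF assms tensor_obj[OF assms(2,1)]], goal_cases)
  case 1
  then show ?case using linear_map_braid[OF assms] by simp
next
  case (2 i j k l x y)
  then show ?case using assms by (simp add: braid_map_def add_ac)
next
  case (5 x y)
  then show ?case using braid_lcoact[OF assms] by (simp del: tensor_sel)
next
  case (6 x y)
  then show ?case using braid_rcoact[OF assms] by (simp del: tensor_sel)
qed (use assms in \<open>simp_all only: braid_lact braid_ract\<close>)

lemma braid_natural:
  assumes "obj U" "obj U'" "obj V" "obj V'" "mor U U' f" "mor V V' g"
  shows "ydl_cmp (ydl_braiding K H m n p q s t u v U' V') (ydl_tensor_arr K H (arr U U' f) (arr V V' g))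
    = ydl_cmp (ydl_tensor_arr K H (arr V V' g) (arr U U' f)) (ydl_braiding K H m n p q s t u v U V)"
proof -
  note [simp] = assms(1-4) morD[OF assms(1,2,5)] morD[OF assms(3,4,6)]
  show ?thesis
    unfolding ydl_braiding_arr
    by (simp add: braid_map_def[abs_def], rule arr_eqI, unfold carrier_ydl_tensor,
        rule tsp_eqI[of _ _ _ "tsp K V' U'"]) simp_all
qed


section \<open>The hexagon identities\<close>

lemma assoc_inv_arr:
  assumes "obj X" "obj Y" "obj Z"
  shows "monoidal_category.assoc_inv C X Y Z
    = arr (ydl_tensor K H X (ydl_tensor K H Y Z)) (ydl_tensor K H (ydl_tensor K H X Y) Z) (assoc_inv_map X Y Z)"
  using inv_arrow_eq[OF _ _ assoc_inverse[OF assms]] assms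
  by (simp add: monoidal_category.assoc_inv_def[OF monoidal_category] tensor_obj)

text \<open>On the left side \<open>U\<close> is coacted on once and the coproduct acts on
  \<open>V\<close> and \<open>W\<close>; the composite coacts on \<open>U\<close> twice, so
  \<open>lcoact_coassoc\<close> compares them. Condition (iv) carries the second coaction past the
  first right action, and the two right actions combine to the product in the coaction of
  \<open>V\<close> and \<open>W\<close>.\<close>

lemma hexagon_right:
  assumes "obj U" "obj V" "obj W"
  shows "ydl_braiding K H m n p q s t u v U (ydl_tensor K H V W)
    = ydl_cmp (monoidal_category.assoc_inv C V W U) (ydl_cmp (ydl_tensor_arr K H (arr V V id) (ydl_braiding K H m n p q s t u v U W))
       (ydl_cmp (ydl_assoc K H V U W) (ydl_cmp (ydl_tensor_arr K H (ydl_braiding K H m n p q s t u v U V) (arr W W id))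
         (monoidal_category.assoc_inv C U V W))))"
proof -
  note [simp] = assms tensor_obj
  show ?thesis
    unfolding ydl_braiding_arr ydl_assoc_arr
    by (simp add: assoc_inv_arr assoc_map_def[abs_def] assoc_inv_map_def[abs_def] braid_map_def[abs_def],
        rule arr_eqI, unfold carrier_ydl_tensor tensor_same,
        rule tsp_eqI_right[of _ _ _ _ "tsp K (tsp K V W) U"], simp_all)
      (simp add: lcoact_coassoc sw_swap_simp[of Z "rcoact V y" "comult H a" for Z y a]
      sw_swap_simp[of Z "rcoact W y" "comult H a" for Z y a] sw_swap_simp[of Z "rcoact V y" "lcoact U a" for Z y a] add_ac)
qed

text \<open>Mirror image: coassociativity of the right coaction on \<open>W\<close>, condition (ii),
  and two left actions that combine to a product.\<close>

lemma hexagon_left: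
  assumes "obj U" "obj V" "obj W"
  shows "ydl_braiding K H m n p q s t u v (ydl_tensor K H U V) W
    = ydl_cmp (ydl_assoc K H W U V) (ydl_cmp (ydl_tensor_arr K H (ydl_braiding K H m n p q s t u v U W) (arr V V id))
       (ydl_cmp (monoidal_category.assoc_inv C U W V) (ydl_cmp (ydl_tensor_arr K H (arr U U id) (ydl_braiding K H m n p q s t u v V W))
         (ydl_assoc K H U V W))))"
proof -
  note [simp] = assms tensor_obj
  show ?thesis
    unfolding ydl_braiding_arr ydl_assoc_arr
    by (simp add: assoc_inv_arr assoc_map_def[abs_def] assoc_inv_map_def[abs_def] braid_map_def[abs_def],
        rule arr_eqI, unfold carrier_ydl_tensor tensor_same,
        rule tsp_eqI_left[of _ _ _ _ "tsp K W (tsp K U V)"], simp_all)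
      (simp add: rcoact_coassoc sw_swap_simp[of Z "lcoact V y" "lcoact U a" for Z y a]
      sw_swap_simp[of Z "rcoact W y" "lcoact U a" for Z y a] sw_swap_simp[of Z "rcoact W y" "lcoact V a" for Z y a] add_ac)
qed

lemma prebraided: "prebraided_monoidal_category C (ydl_braiding K H m n p q s t u v)"
proof (intro prebraided_monoidal_category.intro monoidal_category prebraided_monoidal_category_axioms.intro, goal_cases)
  case (1 U V)
  then show ?case using braid_mor by (simp add: ydl_braiding_arr arr_hom tensor_obj)
next
  case (2 U U' V V' f g)
  then show ?case by (auto elim!: hom_arrE simp only: LR_sel mem_Collect_eq intro: braid_natural)
next
  case (3 U V W)
  then show ?case using hexagon_right by (simp only: LR_sel mem_Collect_eq)
next
  case (4 U V W)
  then show ?case using hexagon_left by (simp only: LR_sel mem_Collect_eq)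
qed

end

section \<open>The antipode\<close>

locale ydl_hopf = ydl_category K H m n p q s t u v
  for K :: "('k, 'c) ring_scheme" and H :: "('k, 'a) bialg"
    and m n p q s t u v :: int +
  fixes S :: "('k, 'a) univ \<Rightarrow> ('k, 'a) univ"
  assumes antipode: "antipode K H S" and bij_S: "bij_betw S (carrier H) (carrier H)"
begin

abbreviation S' :: "('k, 'a) univ \<Rightarrow> ('k, 'a) univ" where
  "S' \<equiv> inv_into (carrier H) S"

lemma linear_S: "linear_map K H H S" and linear_S': "linear_map K H H S'"
  using antipode linear_aut_inv[of K H S] bij_S by (auto simp: antipode_def linear_aut_def)

lemma S_simps [simp]:
  "x \<in> carrier H \<Longrightarrow> S x \<in> carrier H" "x \<in> carrier H \<Longrightarrow> S' x \<in> carrier H"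
  "linear_map K V H e \<Longrightarrow> linear_map K V H (\<lambda>x. S (e x))"
  "linear_map K V H e \<Longrightarrow> linear_map K V H (\<lambda>x. S' (e x))"
  "x \<in> carrier H \<Longrightarrow> S (S' x) = x" "x \<in> carrier H \<Longrightarrow> S' (S x) = x"
  using linear_S linear_S' linear_map_closed[OF linear_S] linear_map_closed[OF linear_S']
    linear_map_comp[OF linear_S] linear_map_comp[OF linear_S']
    bij_betw_inv_into_right[OF bij_S] bij_betw_inv_into_left[OF bij_S] by auto

lemma S_aut: "x \<in> carrier H \<Longrightarrow> S (aut H i j k l x) = aut H i j k l (S x)"
proof -
  have c: "\<And>\<theta> x. \<theta> \<in> {alpha H, beta H, omega H, psi H} \<Longrightarrow> x \<in> carrier H \<Longrightarrow> S (\<theta> x) = \<theta> (S x)"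
    using antipode unfolding antipode_def commute_on_def by blast
  assume x: "x \<in> carrier H"
  show ?thesis
    by (rule aut_transfer[where A = H and B = H and C = H and F = "\<lambda>x y. S x" and a = x and b = x
            and K = K, symmetric]) (use x in \<open>simp_all add: c del: struct_aut\<close>)
qed

lemma aut_S [simp]:
  assumes "x \<in> carrier H"
  shows "aut H i j k l (S x) = S (aut H i j k l x)" "aut H i j k l (S' x) = S' (aut H i j k l x)"
proof -
  show "aut H i j k l (S x) = S (aut H i j k l x)" using S_aut[OF assms] by simp
  have "S (aut H i j k l (S' x)) = aut H i j k l x" using S_aut[of "S' x" i j k l] assms by simp
  then show "aut H i j k l (S' x) = S' (aut H i j k l x)" using assms by (metis S_simps(2,6) aut_closed H_simps(2))
qed

lemma antipode_left:
  assumes "h \<in> carrier H" "linear_map K H Z F" "Module.module K Z"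
  shows "sw Z (comult H h) (\<lambda>a b. F (S a \<otimes>\<^bsub>H\<^esub> b)) = counit H h \<odot>\<^bsub>Z\<^esub> F \<one>\<^bsub>H\<^esub>"
proof -
  have "sw H (comult H h) (\<lambda>a b. S a \<otimes>\<^bsub>H\<^esub> b) = counit H h \<odot>\<^bsub>H\<^esub> \<one>\<^bsub>H\<^esub>"
    using antipode assms(1) unfolding antipode_def by blast
  then show ?thesis
    using linear_sw[OF _ assms(3,2), where r = "comult H h" and F = "\<lambda>a b. S a \<otimes>\<^bsub>H\<^esub> b"] assms(1)
    by (simp add: linear_map_smult[OF assms(2)])
qed

lemma antipode_right:
  assumes "h \<in> carrier H" "linear_map K H Z F" "Module.module K Z"
  shows "sw Z (comult H h) (\<lambda>a b. F (a \<otimes>\<^bsub>H\<^esub> S b)) = counit H h \<odot>\<^bsub>Z\<^esub> F \<one>\<^bsub>H\<^esub>"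
proof -
  have "sw H (comult H h) (\<lambda>a b. a \<otimes>\<^bsub>H\<^esub> S b) = counit H h \<odot>\<^bsub>H\<^esub> \<one>\<^bsub>H\<^esub>"
    using antipode assms(1) unfolding antipode_def by blast
  then show ?thesis
    using linear_sw[OF _ assms(3,2), where r = "comult H h" and F = "\<lambda>a b. a \<otimes>\<^bsub>H\<^esub> S b"] assms(1)
    by (simp add: linear_map_smult[OF assms(2)])
qed

text \<open>In the untwisted product \<alpha>^-1(a) \<beta>^-1(b) and coproduct
  \<open>\<omega>\<^sup>-\<^sup>1(h\<^sub>1) \<otimes> \<psi>\<^sup>-\<^sup>1(h\<^sub>2)\<close>,
  the antipode axioms make \<phi>^-1 \<chi> S a right and \<chi>^-1 \<phi> S a left convolution
  inverse of the identity. Such inverses agree; the proof is the usual one, evaluating a triple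
  convolution in both bracketings.\<close>

lemma aut_twist1:
  assumes h: "h \<in> carrier H"
  shows "aut H 2 0 1 0 (S h) = aut H 0 2 (-1) 2 (S h)"
proof -
  \<comment> \<open>S, the identity and S convolved. \<open>R\<close> cancels the last two factors
    and \<open>L\<close> the first two.\<close>
  let ?G = "\<lambda>a b c. (S a \<otimes>\<^bsub>H\<^esub> aut H 0 0 (-1) 0 b) \<otimes>\<^bsub>H\<^esub> S (aut H 0 1 (-1) 0 c)"
  note [simp] = h
  have L: "sw H (comult H g) (\<lambda>a b. S (aut H 1 0 (-1) 0 a) \<otimes>\<^bsub>H\<^esub> (aut H 0 0 (-1) 0 b \<otimes>\<^bsub>H\<^esub> S (aut H 0 0 (-1) 1 k)))
      = counit H g \<odot>\<^bsub>H\<^esub> S (aut H 0 2 (-1) 1 k)" if "g \<in> carrier H" "k \<in> carrier H" for g k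
    using antipode_left[of g H "\<lambda>c. aut H 0 0 (-1) 0 c \<otimes>\<^bsub>H\<^esub> S (aut H 0 1 (-1) 1 k)"] that by simp
  have R: "sw H (comult H g) (\<lambda>a b. z \<otimes>\<^bsub>H\<^esub> (aut H 0 0 (-1) 0 a \<otimes>\<^bsub>H\<^esub> S (aut H 0 0 (-1) 0 b)))
      = counit H g \<odot>\<^bsub>H\<^esub> aut H 1 0 0 0 z" if "g \<in> carrier H" "z \<in> carrier H" for g z
    using antipode_right[of g H "\<lambda>c. z \<otimes>\<^bsub>H\<^esub> aut H 0 0 (-1) 0 c"] that by simp
  have "aut H 2 0 1 0 (S h) = sw H (comult H h) (\<lambda>a b. sw H (comult H b) (\<lambda>b c. ?G a b c))"
    by (simp add: R)
  also have "\<dots> = sw H (comult H h) (\<lambda>a b. sw H (comult H a) (\<lambda>a1 a2. ?G (aut H 0 0 (-1) 0 a1) a2 (aut H 0 0 0 1 b)))"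
    by (rule comult_coassoc') simp_all
  also have "\<dots> = aut H 0 2 (-1) 2 (S h)"
    by (simp add: L)
  finally show ?thesis .
qed

text \<open>The relation \<phi>^2 = \<chi>^2 as an exchange of exponents. Every \<open>x\<close> has
  the form \<open>S (S' x)\<close>, so surjectivity of the antipode removes it from
  \<open>aut_twist1\<close>.\<close>

lemma aut_twist:
  assumes "x \<in> carrier H"
  shows "aut H (i + 2) j (k + 2) l x = aut H i (j + 2) k (l + 2) x"
  using arg_cong[OF aut_twist1[of "S' x"], of "aut H i j (k + 1) l"] assms by (simp del: aut_S add: add_ac)

text \<open>Both sides are, up to twists, convolution inverses of the multiplication on pairs: the
  left by the antipode axiom at a product, the right by cancelling the factors one after the
  other.\<close>

lemma S_mult:
  assumes a: "a \<in> carrier H" and b: "b \<in> carrier H"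
  shows "S (a \<otimes>\<^bsub>H\<^esub> b) = S (aut H (-1) 1 0 0 b) \<otimes>\<^bsub>H\<^esub> S (aut H 1 (-1) 0 0 a)"
proof -
  note [simp] = a b
  \<comment> \<open>The exponents come from the antihomomorphism law of the untwisted product: S(b)
    * S(a) with \<open>a\<close>, \<open>b\<close> replaced by \<alpha>(a), \<beta>(b), rewritten in
    the given product.\<close>
  let ?P = "\<lambda>a b. S (aut H (-1) 1 0 0 b) \<otimes>\<^bsub>H\<^esub> S (aut H 1 (-1) 0 0 a)"
  \<comment> \<open>S after multiplication, multiplication, and \<open>?P\<close>, convolved over
    the coproducts of \<open>a\<close> and \<open>b\<close>.\<close>
  let ?G = "\<lambda>a1 u w b1 u' w'. (S (a1 \<otimes>\<^bsub>H\<^esub> b1) \<otimes>\<^bsub>H\<^esub> aut H 0 0 (-1) 0 (u \<otimes>\<^bsub>H\<^esub> u')) \<otimes>\<^bsub>H\<^esub> aut H 0 1 (-1) 0 (?P w w')"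
  have L: "sw H (comult H g) (\<lambda>c d. sw H (comult H k) (\<lambda>c' d'.
        S (aut H 1 0 (-1) 0 c \<otimes>\<^bsub>H\<^esub> aut H 1 0 (-1) 0 c') \<otimes>\<^bsub>H\<^esub> (aut H 1 0 (-1) 0 d \<otimes>\<^bsub>H\<^esub> (aut H 0 0 (-1) 0 d' \<otimes>\<^bsub>H\<^esub>
          (S (aut H (-1) 0 (-1) 1 y) \<otimes>\<^bsub>H\<^esub> S (aut H 1 (-2) (-1) 1 x))))))
      = counit H g \<odot>\<^bsub>H\<^esub> (counit H k \<odot>\<^bsub>H\<^esub> (S (aut H (-1) 3 (-1) 1 y) \<otimes>\<^bsub>H\<^esub> S (aut H 1 1 (-1) 1 x)))"
    if "g \<in> carrier H" "k \<in> carrier H" "x \<in> carrier H" "y \<in> carrier H" for g k x y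
    using antipode_left[of "g \<otimes>\<^bsub>H\<^esub> k" H "\<lambda>c. aut H 0 0 (-1) 0 c \<otimes>\<^bsub>H\<^esub> aut H 0 1 (-1) 1 (?P x y)"] that by simp
  \<comment> \<open>The reversed order in \<open>?P\<close> puts the components of \<open>b\<close>
    next to each other, so they cancel first; \<open>R2\<close> then cancels those of
    \<open>a\<close>.\<close>
  have R1: "sw H (comult H k) (\<lambda>c d. z \<otimes>\<^bsub>H\<^esub> (w \<otimes>\<^bsub>H\<^esub> (aut H 0 0 (-1) 0 c \<otimes>\<^bsub>H\<^esub> (S (aut H (-1) 0 (-1) 0 d) \<otimes>\<^bsub>H\<^esub> S (aut H 1 (-2) (-1) 0 y)))))
      = counit H k \<odot>\<^bsub>H\<^esub> (z \<otimes>\<^bsub>H\<^esub> (w \<otimes>\<^bsub>H\<^esub> S (aut H 1 0 (-1) 0 y)))"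
    if "k \<in> carrier H" "z \<in> carrier H" "w \<in> carrier H" "y \<in> carrier H" for k z w y
    using antipode_right[of k H "\<lambda>c. z \<otimes>\<^bsub>H\<^esub> (w \<otimes>\<^bsub>H\<^esub> (aut H (-1) 0 (-1) 0 c \<otimes>\<^bsub>H\<^esub> S (aut H 1 (-1) (-1) 0 y)))"] that by simp
  have R2: "sw H (comult H k) (\<lambda>c d. z \<otimes>\<^bsub>H\<^esub> (aut H 1 0 (-1) 0 c \<otimes>\<^bsub>H\<^esub> S (aut H 1 0 (-1) 0 d))) = counit H k \<odot>\<^bsub>H\<^esub> aut H 1 0 0 0 z"
    if "k \<in> carrier H" "z \<in> carrier H" for k z
    using antipode_right[of k H "\<lambda>c. z \<otimes>\<^bsub>H\<^esub> aut H 1 0 (-1) 0 c"] that by simp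
  have "aut H 2 0 1 0 (S (a \<otimes>\<^bsub>H\<^esub> b)) = sw H (comult H a) (\<lambda>a1 a2. sw H (comult H a2) (\<lambda>c d.
      sw H (comult H b) (\<lambda>b1 b2. sw H (comult H b2) (\<lambda>c' d'. ?G a1 c d b1 c' d'))))"
    by (simp add: R1 sw_swap_simp[of Z "comult H g" "comult H b" for Z g]) (simp add: R2)
  also have "\<dots> = sw H (comult H a) (\<lambda>a1 a2. sw H (comult H a1) (\<lambda>c d.
      sw H (comult H b) (\<lambda>b1 b2. sw H (comult H b2) (\<lambda>c' d'. ?G (aut H 0 0 (-1) 0 c) d (aut H 0 0 0 1 a2) b1 c' d'))))"
    by (rule comult_coassoc') simp_all
  also have "\<dots> = sw H (comult H a) (\<lambda>a1 a2. sw H (comult H a1) (\<lambda>c d.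
      sw H (comult H b) (\<lambda>b1 b2. sw H (comult H b1) (\<lambda>c' d'. ?G (aut H 0 0 (-1) 0 c) d (aut H 0 0 0 1 a2) (aut H 0 0 (-1) 0 c') d' (aut H 0 0 0 1 b2)))))"
    by (simp add: comult_coassoc'[where h = b])
  also have "\<dots> = sw H (comult H a) (\<lambda>a1 a2. sw H (comult H b) (\<lambda>b1 b2. counit H a1 \<odot>\<^bsub>H\<^esub> (counit H b1 \<odot>\<^bsub>H\<^esub> aut H 0 2 (-1) 1 (?P a2 b2))))"
    by (simp add: sw_swap_simp[of Z "comult H g" "comult H b" for Z g]
        L)
  also have "\<dots> = aut H 0 2 (-1) 2 (?P a b)"
    by simp
  \<comment> \<open>The two bracketings collapse with different exponents; the relation forced by
    bijectivity identifies them.\<close>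
  also have "\<dots> = aut H 2 0 1 0 (?P a b)"
    using aut_twist[of "?P a b" 0 0 "-1" 0] by simp
  finally have "aut H (-2) 0 (-1) 0 (aut H 2 0 1 0 (S (a \<otimes>\<^bsub>H\<^esub> b))) = aut H (-2) 0 (-1) 0 (aut H 2 0 1 0 (?P a b))"
    by (rule arg_cong)
  then show ?thesis by (simp del: aut_S)
qed

end

section \<open>The inverse antipode and the inverse braiding\<close>

context ydl_hopf begin

lemma S_one [simp]: "S \<one>\<^bsub>H\<^esub> = \<one>\<^bsub>H\<^esub>" "S' \<one>\<^bsub>H\<^esub> = \<one>\<^bsub>H\<^esub>"
proof -
  show 1: "S \<one>\<^bsub>H\<^esub> = \<one>\<^bsub>H\<^esub>"
    using antipode_right[of "\<one>\<^bsub>H\<^esub>" H "\<lambda>x. x"] by simp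
  show "S' \<one>\<^bsub>H\<^esub> = \<one>\<^bsub>H\<^esub>"
    using S_simps(6)[of "\<one>\<^bsub>H\<^esub>"] unfolding 1 by simp
qed

lemma S_sw: "(\<And>a b. sw_mem r a b =simp=> F a b \<in> carrier H) \<Longrightarrow> S (sw H r F) = sw H r (\<lambda>a b. S (F a b))"
  unfolding simp_implies_def by (rule linear_sw[of K H H S]) (simp_all add: linear_S)

lemma S_inj: "x \<in> carrier H \<Longrightarrow> y \<in> carrier H \<Longrightarrow> S x = S y \<Longrightarrow> x = y"
  by (metis S_simps(6))

text \<open>Under S the product is reversed and becomes a common automorphism applied to
  \<open>h\<^sub>1 S(h\<^sub>2)\<close>, where the antipode axiom applies; S is injective.\<close>

lemma antipode_inv_right:
  assumes h: "h \<in> carrier H" and F: "linear_map K H Z F" and Z: "Module.module K Z"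
  shows "sw Z (comult H h) (\<lambda>a b. F (aut H 0 0 1 (-2) b \<otimes>\<^bsub>H\<^esub> S' (aut H 0 0 (-1) 0 a))) = counit H h \<odot>\<^bsub>Z\<^esub> F \<one>\<^bsub>H\<^esub>"
proof -
  let ?x = "sw H (comult H h) (\<lambda>a b. aut H 0 0 1 (-2) b \<otimes>\<^bsub>H\<^esub> S' (aut H 0 0 (-1) 0 a))"
  \<comment> \<open>By \<open>S_mult\<close> the factors acquire \<alpha>^-1 \<beta> \<omega>^-1 and
    \<alpha> \<beta>^-1 \<omega> \<psi>^-2. The exponents in the statement are such that these two
    agree by \<open>aut_twist\<close>.\<close>
  have tw: "aut H 1 (-1) 1 (-2) b = aut H (-1) 1 (-1) 0 b" if "b \<in> carrier H" for b
    using aut_twist[OF that, of "-1" "-1" "-1" "-2"] by simp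
  have "S ?x = S (counit H h \<odot>\<^bsub>H\<^esub> \<one>\<^bsub>H\<^esub>)"
    using antipode_right[of h H "aut H (-1) 1 (-1) 0"] h
    by (simp add: S_sw S_mult tw linear_map_smult[OF linear_S])
  then have "?x = counit H h \<odot>\<^bsub>H\<^esub> \<one>\<^bsub>H\<^esub>"
    by (rule S_inj[rotated 2]) (use h in simp_all)
  then have "F ?x = F (counit H h \<odot>\<^bsub>H\<^esub> \<one>\<^bsub>H\<^esub>)" by simp
  moreover have "F ?x = sw Z (comult H h) (\<lambda>a b. F (aut H 0 0 1 (-2) b \<otimes>\<^bsub>H\<^esub> S' (aut H 0 0 (-1) 0 a)))"
    using h Z F by (intro linear_sw[of K H Z F]) simp_all
  ultimately show ?thesis using h by (simp add: linear_map_smult[OF F])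
qed

text \<open>As before, with S reducing the claim to \<open>S(h\<^sub>1) h\<^sub>2\<close>; the
  common automorphism is now \<alpha>^-1 \<beta> \<omega>^-2 \<psi>.\<close>

lemma antipode_inv_left:
  assumes h: "h \<in> carrier H" and F: "linear_map K H Z F" and Z: "Module.module K Z"
  shows "sw Z (comult H h) (\<lambda>a b. F (S' (aut H 0 0 0 (-1) b) \<otimes>\<^bsub>H\<^esub> aut H 0 0 (-2) 1 a)) = counit H h \<odot>\<^bsub>Z\<^esub> F \<one>\<^bsub>H\<^esub>"
proof -
  let ?x = "sw H (comult H h) (\<lambda>a b. S' (aut H 0 0 0 (-1) b) \<otimes>\<^bsub>H\<^esub> aut H 0 0 (-2) 1 a)"
  have tw: "aut H 1 (-1) 0 (-1) b = aut H (-1) 1 (-2) 1 b" if "b \<in> carrier H" for b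
    using aut_twist[OF that, of "-1" "-1" "-2" "-1"] by simp
  have "S ?x = S (counit H h \<odot>\<^bsub>H\<^esub> \<one>\<^bsub>H\<^esub>)"
    using antipode_left[of h H "aut H (-1) 1 (-2) 1"] h
    by (simp add: S_sw S_mult tw linear_map_smult[OF linear_S])
  then have "?x = counit H h \<odot>\<^bsub>H\<^esub> \<one>\<^bsub>H\<^esub>"
    by (rule S_inj[rotated 2]) (use h in simp_all)
  then have "F ?x = F (counit H h \<odot>\<^bsub>H\<^esub> \<one>\<^bsub>H\<^esub>)" by simp
  moreover have "F ?x = sw Z (comult H h) (\<lambda>a b. F (S' (aut H 0 0 0 (-1) b) \<otimes>\<^bsub>H\<^esub> aut H 0 0 (-2) 1 a))"
    using h Z F by (intro linear_sw[of K H Z F]) simp_all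
  ultimately show ?thesis using h by (simp add: linear_map_smult[OF F])
qed

definition braid_inv_map :: "('k, 'a) ydlobj \<Rightarrow> ('k, 'a) ydlobj \<Rightarrow> ('k, 'a) univ \<Rightarrow> ('k, 'a) univ" where
  "braid_inv_map M N r = sw (tsp K M N) r (\<lambda>y x.
     sw (tsp K M N) (lcoact M x) (\<lambda>a x0. sw (tsp K M N) (rcoact N y) (\<lambda>y0 b.
       tens K M N (ract M (aut M (-1) 0 1 (-2) x0) (S' (aut H m (u + 1) v (n + 1) b)))
         (lact N (S' (aut H (s + 1) p (q + 1) t a)) (aut N 0 (-1) (-2) 1 y0)))))"

lemma ydl_braiding_inv_arr:
  "ydl_braiding_inv K H S m n p q s t u v M N = arr (ydl_tensor K H N M) (ydl_tensor K H M N) (braid_inv_map M N)"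
  by (simp add: ydl_braiding_inv_def braid_inv_map_def[abs_def])

lemma linear_map_braid_inv: "obj M \<Longrightarrow> obj N \<Longrightarrow> linear_map K (tsp K N M) (tsp K M N) (braid_inv_map M N)"
  by (simp add: braid_inv_map_def[abs_def])

text \<open>By (ii) and (iv) each of \<open>x\<close> and \<open>y\<close> is coacted on twice in
  succession. Coassociativity makes this one coproduct whose components meet in a single action; the
  inverse antipode cancels them, and the counit laws remove the remaining coactions.\<close>

lemma braid_inv_braid:
  assumes M: "obj M" and N: "obj N" and x: "x \<in> carrier M" and y: "y \<in> carrier N"
  shows "braid_inv_map M N (braid_map M N (tens K M N x y)) = tens K M N x y"
proof -
  note [simp] = M N x y
  let ?Z = "tsp K M N"
  have L: "sw ?Z (comult H g) (\<lambda>a b. tens K M N w (lact N (S' (aut H s p q t b) \<otimes>\<^bsub>H\<^esub> aut H s p (q - 2) (2 + t) a) y))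
      = counit H g \<odot>\<^bsub>?Z\<^esub> tens K M N w (aut N 0 1 0 0 y)"
    if "g \<in> carrier H" "w \<in> carrier M" "y \<in> carrier N" for g w y
    using antipode_inv_left[of g ?Z "\<lambda>c. tens K M N w (lact N (aut H s p q (t + 1) c) y)"] that
    by (simp add: add_ac)
  have R: "sw ?Z (comult H g) (\<lambda>a b. tens K M N (ract M x (aut H m u (2 + v) (n - 2) b \<otimes>\<^bsub>H\<^esub> S' (aut H m u v n a))) w)
      = counit H g \<odot>\<^bsub>?Z\<^esub> tens K M N (aut M 1 0 0 0 x) w"
    if "g \<in> carrier H" "x \<in> carrier M" "w \<in> carrier N" for g w x
    using antipode_inv_right[of g ?Z "\<lambda>c. tens K M N (ract M x (aut H m u (v + 1) n c)) w"] that
    by (simp add: add_ac)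
  show ?thesis
    by (simp add: braid_map_def braid_inv_map_def sw_swap_simp[where r = "rcoact N y"]
        lcoact_coassoc' rcoact_coassoc' L R)
qed

lemma braid_braid_inv:
  assumes M: "obj M" and N: "obj N" and x: "x \<in> carrier M" and y: "y \<in> carrier N"
  shows "braid_map M N (braid_inv_map M N (tens K N M y x)) = tens K N M y x"
proof -
  note [simp] = M N x y
  let ?Z = "tsp K N M"
  \<comment> \<open>In this composite the components meet in the opposite order, so the two antipode
    identities exchange roles, and the exponents match them only up to
    \<open>aut_twist\<close>.\<close>
  have twL: "aut H (s - 1) (p + 1) (q - 1) (t + 1) a = aut H (s + 1) (p - 1) (1 + q) (t - 1) a" if "a \<in> carrier H" for a
    using aut_twist[OF that, of "s - 1" "p - 1" "q - 1" "t - 1"] by (simp add: add_ac)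
  have twR: "aut H (m - 1) (u + 1) (v - 3) (3 + n) a = aut H (m + 1) (u - 1) (v - 1) (n + 1) a" if "a \<in> carrier H" for a
    using aut_twist[OF that, of "m - 1" "u - 1" "v - 3" "n + 1"] by (simp add: add_ac)
  have L: "sw ?Z (comult H g) (\<lambda>a b. tens K N M (lact N (aut H (s - 1) (p + 1) (q + 1) (t - 1) b \<otimes>\<^bsub>H\<^esub> S' (aut H (s + 1) (p - 1) (1 + q) (t - 1) a)) y) w)
      = counit H g \<odot>\<^bsub>?Z\<^esub> tens K N M (aut N 0 1 0 0 y) w"
    if "g \<in> carrier H" "w \<in> carrier M" "y \<in> carrier N" for g w y
    using antipode_inv_right[of g ?Z "\<lambda>c. tens K N M (lact N (aut H (s - 1) (p + 1) q (t + 1) c) y) w"] that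
    by (simp add: twL)
  have R: "sw ?Z (comult H g) (\<lambda>a b. tens K N M w (ract M x (S' (aut H (m - 1) (u + 1) (v - 1) (1 + n) b) \<otimes>\<^bsub>H\<^esub> aut H (m + 1) (u - 1) (v - 1) (n + 1) a)))
      = counit H g \<odot>\<^bsub>?Z\<^esub> tens K N M w (aut M 1 0 0 0 x)"
    if "g \<in> carrier H" "x \<in> carrier M" "w \<in> carrier N" for g w x
    using antipode_inv_left[of g ?Z "\<lambda>c. tens K N M w (ract M x (aut H (m - 1) (u + 1) (v - 1) (n + 2) c))"] that
    by (simp add: twR)
  show ?thesis
    by (simp add: braid_map_def braid_inv_map_def sw_swap_simp[where r = "rcoact N y"]
        lcoact_coassoc' rcoact_coassoc' L R)
qed

lemma braid_inverse:
  assumes M: "obj M" and N: "obj N"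
  shows "inverse_arrows C (ydl_tensor K H M N) (ydl_tensor K H N M)
    (ydl_braiding K H m n p q s t u v M N) (ydl_braiding_inv K H S m n p q s t u v M N)"
  unfolding ydl_braiding_arr ydl_braiding_inv_arr
proof (rule inverse_arrowsI)
  note l = linear_map_braid[OF M N] linear_map_braid_inv[OF M N]
  show "y \<in> carrier (ydl_tensor K H N M) \<Longrightarrow> braid_inv_map M N y \<in> carrier (ydl_tensor K H M N)" for y
    using linear_map_closed[OF l(2)] by simp
  show "\<forall>r\<in>carrier (ydl_tensor K H N M). braid_map M N (braid_inv_map M N r) = r"
    unfolding carrier_ydl_tensor
    by (rule tsp_eqI[OF linear_map_comp[OF l] linear_map_ident]) (simp_all add: M N braid_braid_inv)
  show "\<forall>r\<in>carrier (ydl_tensor K H M N). braid_inv_map M N (braid_map M N r) = r"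
    unfolding carrier_ydl_tensor
    by (rule tsp_eqI[OF linear_map_comp[OF l(2,1)] linear_map_ident]) (simp_all add: M N braid_inv_braid)
qed (simp_all add: M N tensor_obj braid_mor)

end

theorem theorem4p3:
  fixes K :: "('k, 'c) ring_scheme" and H :: "('k, 'a) bialg" and m n p q s t u v :: int
  assumes "Ring.field K" and "bihom_bialgebra K H"
  shows "prebraided_monoidal_category (LR K H m n p q s t u v) (ydl_braiding K H m n p q s t u v)
    \<and> (\<forall>S. bihom_hopf_algebra K H S \<and> bij_betw S (carrier H) (carrier H) \<longrightarrow>
          braided_monoidal_category (LR K H m n p q s t u v) (ydl_braiding K H m n p q s t u v) \<and>
          (\<forall>M\<in>Obj (LR K H m n p q s t u v). \<forall>N\<in>Obj (LR K H m n p q s t u v).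
             inverse_arrows (LR K H m n p q s t u v)
               (tobj (LR K H m n p q s t u v) M N) (tobj (LR K H m n p q s t u v) N M)
               (ydl_braiding K H m n p q s t u v M N)
               (ydl_braiding_inv K H S m n p q s t u v M N)))"
proof -
  interpret ydl_category K H m n p q s t u v
    by (rule ydl_category.intro) (fact assms)+
  show ?thesis
  proof (intro conjI allI impI)
    show pre: "prebraided_monoidal_category C (ydl_braiding K H m n p q s t u v)"
      by (rule prebraided)
    fix S assume S: "bihom_hopf_algebra K H S \<and> bij_betw S (carrier H) (carrier H)"
    interpret ydl_hopf K H m n p q s t u v S
      using S by (intro ydl_hopf.intro ydl_category_axioms ydl_hopf_axioms.intro)
        (simp_all add: bihom_hopf_algebra_def)
    have inv: "\<forall>M\<in>Obj C. \<forall>N\<in>Obj C. inverse_arrows C (tobj C M N) (tobj C N M)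
      (ydl_braiding K H m n p q s t u v M N) (ydl_braiding_inv K H S m n p q s t u v M N)"
      using braid_inverse by simp
    then show "\<forall>M\<in>Obj C. \<forall>N\<in>Obj C. inverse_arrows C (tobj C M N) (tobj C N M)
      (ydl_braiding K H m n p q s t u v M N) (ydl_braiding_inv K H S m n p q s t u v M N)" .
    show "braided_monoidal_category C (ydl_braiding K H m n p q s t u v)"
      using pre inv by (intro braided_monoidal_category.intro braided_monoidal_category_axioms.intro)
        (auto simp only: iso_arrow_def)
  qed
qed

end
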